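(* Let $t,\theta>0$ and $1\le\lambda<1+t/\theta$. Then $\mu_{t,\theta,\lambda}$ is the unique maximizer of $$\Sigma_{V_{t,\theta,\lambda}}(\mu)=\iint_{\mathbb R_{>0}\times\mathbb R_{>0}}\log|x-y|\,\mu(dx)\mu(dy)-\int_{\mathbb R_{>0}}V_{t,\theta,\lambda}(x)\,\mu(dx)$$ over all Borel probability measures $\mu$ on $(0,\infty)$.
   Context: For $\theta>0,\lambda>0$ put $a^\pm=\theta(\sqrt\lambda\pm1)^2$ and $k_{\theta,\lambda}(x)=\frac{\sqrt{(a^+-x)(x-a^-)}}{2\pi\theta x}\mathbf 1_{(a^-,a^+)}(x)$. The R-transform of a probability measure $\mu$ on $\mathbb R$ is $R_\mu(w)=wF_\mu^{\langle-1\rangle}(1/w)-1$ with $F_\mu=1/G_\mu$, $G_\mu(z)=\int\frac{\mu(dx)}{z-x}$. For $t,\theta>0,\lambda\ge1$, $\mu_{t,\theta,\lambda}$ is the probability measure with $R_{\mu_{t,\theta,\lambda}}(z)=\int\big(\frac{1}{1-zx}-1\big)\frac{t\,k_{\theta,\lambda}(x)}{x}dx$, $z\in\mathbb C^-$. Potentials on $(0,\infty)$: $V_{t,\theta,1}(x)=(2+\frac t\theta)\log x+\frac{t^2}{\theta x}$ and, for $\lambda>1$, $V_{t,\theta,\lambda}(x)=\big(1-\frac{t}{\theta(\lambda-1)}\big)\log x+\big(1+\frac{t\lambda}{\theta(\lambda-1)}\big)\log(x+t(\lambda-1))$. *)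

theory Defs
  imports "HOL-Probability.Probability"
begin

definition a_plus :: "real \<Rightarrow> real \<Rightarrow> real" where
  "a_plus \<theta> lam = \<theta> * (sqrt lam + 1)^2"

definition a_minus :: "real \<Rightarrow> real \<Rightarrow> real" where
  "a_minus \<theta> lam = \<theta> * (sqrt lam - 1)^2"

definition kdens :: "real \<Rightarrow> real \<Rightarrow> real \<Rightarrow> real" where
  "kdens \<theta> lam x =
     sqrt ((a_plus \<theta> lam - x) * (x - a_minus \<theta> lam)) / (2 * pi * \<theta> * x)
     * indicator {a_minus \<theta> lam <..< a_plus \<theta> lam} x"

definition Rfun :: "real \<Rightarrow> real \<Rightarrow> real \<Rightarrow> complex \<Rightarrow> complex" where
  "Rfun t \<theta> lam z =
     integral\<^sup>L lborel (\<lambda>x. (1 / (1 - z * complex_of_real x) - 1)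
                              * complex_of_real (t * kdens \<theta> lam x / x))"

definition cauchy_G :: "real measure \<Rightarrow> complex \<Rightarrow> complex" where
  "cauchy_G \<mu> z = integral\<^sup>L \<mu> (\<lambda>x. 1 / (z - complex_of_real x))"

definition reciprocal_F :: "real measure \<Rightarrow> complex \<Rightarrow> complex" where
  "reciprocal_F \<mu> z = 1 / cauchy_G \<mu> z"

definition cone :: "real \<Rightarrow> real \<Rightarrow> complex set" where
  "cone \<alpha> \<beta> = {w. Im w > \<beta> \<and> \<bar>Re w\<bar> < \<alpha> * Im w}"

text \<open>R is the R-transform of mu: F_mu is injective on some truncated cone
  Gamma', its inverse F^{-1} (with values in Gamma') is defined on some truncated
  cone Gamma, and R(w) = w F^{-1}(1/w) - 1 wherever 1/w lies in Gamma
  (such w lie in the lower half plane).\<close>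
definition has_R_transform :: "real measure \<Rightarrow> (complex \<Rightarrow> complex) \<Rightarrow> bool" where
  "has_R_transform \<mu> R \<longleftrightarrow>
     (\<exists>\<alpha> \<beta> \<alpha>' \<beta>' (Finv :: complex \<Rightarrow> complex).
        \<alpha> > 0 \<and> \<beta> > 0 \<and> \<alpha>' > 0 \<and> \<beta>' > 0 \<and>
        inj_on (reciprocal_F \<mu>) (cone \<alpha>' \<beta>') \<and>
        (\<forall>w\<in>cone \<alpha> \<beta>. Finv w \<in> cone \<alpha>' \<beta>' \<and> reciprocal_F \<mu> (Finv w) = w) \<and>
        (\<forall>w. 1 / w \<in> cone \<alpha> \<beta> \<longrightarrow> R w = w * Finv (1 / w) - 1))"

definition is_mu :: "real \<Rightarrow> real \<Rightarrow> real \<Rightarrow> real measure \<Rightarrow> bool" where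
  "is_mu t \<theta> lam \<mu> \<longleftrightarrow>
     sets \<mu> = sets borel \<and> prob_space \<mu> \<and> has_R_transform \<mu> (Rfun t \<theta> lam)"

definition Vpot :: "real \<Rightarrow> real \<Rightarrow> real \<Rightarrow> real \<Rightarrow> real" where
  "Vpot t \<theta> lam x =
     (if lam = 1 then (2 + t / \<theta>) * ln x + t^2 / (\<theta> * x)
      else (1 - t / (\<theta> * (lam - 1))) * ln x
           + (1 + t * lam / (\<theta> * (lam - 1))) * ln (x + t * (lam - 1)))"

definition energy_kernel :: "real \<Rightarrow> real \<Rightarrow> real \<Rightarrow> real \<times> real \<Rightarrow> ereal" where
  "energy_kernel t \<theta> lam p =
     (if fst p = snd p then -\<infinity>
      else ereal (ln \<bar>fst p - snd p\<bar> - Vpot t \<theta> lam (fst p) / 2 - Vpot t \<theta> lam (snd p) / 2))"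

text \<open>Sigma_V(mu) = iint log|x-y| mu(dx)mu(dy) - int V dmu, written as the integral of
  the symmetrised kernel over mu x mu (positive part minus negative part, in [-oo,oo)).\<close>
definition Sigma_V :: "real \<Rightarrow> real \<Rightarrow> real \<Rightarrow> real measure \<Rightarrow> ereal" where
  "Sigma_V t \<theta> lam \<mu> =
     enn2ereal (\<integral>\<^sup>+ p. e2ennreal (max (energy_kernel t \<theta> lam p) 0) \<partial>(\<mu> \<Otimes>\<^sub>M \<mu>))
     - enn2ereal (\<integral>\<^sup>+ p. e2ennreal (max (- energy_kernel t \<theta> lam p) 0) \<partial>(\<mu> \<Otimes>\<^sub>M \<mu>))"

definition prob_on_pos :: "real measure \<Rightarrow> bool" where
  "prob_on_pos \<nu> \<longleftrightarrow> sets \<nu> = sets borel \<and> prob_space \<nu> \<and> emeasure \<nu> {0<..} = 1"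

end

theory Submission
  imports Defs "HOL-Complex_Analysis.Complex_Analysis"
begin

text \<open>
  With \<open>f\<close> the Marchenko--Pastur density, the R-transform is \<open>R(w) = t G\<^sub>f(1/w)\<close>, so the quadratic equation
  of \<open>G\<^sub>f\<close> becomes a quadratic equation for the Cauchy transform \<open>G\<close> of the wanted measure. Its
  discriminant is \<open>t\<^sup>2 ((z - m)\<^sup>2 - r\<^sup>2)\<close>, which leads to the explicit density
  \<open>t sqrt (r\<^sup>2 - (x - m)\<^sup>2) / (2 pi \<theta> x (x + s))\<close> with \<open>m = t + \<theta> + \<theta> lam\<close>,
  \<open>r = 2 sqrt (\<theta> lam (t + \<theta>))\<close>, \<open>s = t (lam - 1)\<close>; the condition \<open>lam < 1 + t / \<theta>\<close> excludes an atom at \<open>0\<close>.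

  On the real axis \<open>2 Re G - V'\<close> vanishes on the support, is positive to its left and negative to its
  right. Integrating, \<open>2 U - V\<close> (with \<open>U\<close> the logarithmic potential) is constant on the support and
  not larger elsewhere. Finally \<open>ln \<bar>d\<bar>\<close> is the integral of \<open>e / (1 + e\<^sup>2) - e / (d\<^sup>2 + e\<^sup>2)\<close> over
  \<open>e > 0\<close>, and \<open>e\<^sup>2 / (d\<^sup>2 + e\<^sup>2)\<close> is a mixture of \<open>cos (\<xi> d)\<close> over all \<open>\<xi> > 0\<close>, so the
  logarithmic kernel is strictly negative definite on differences of probability measures. The two
  facts together make the energy of any other measure strictly smaller. The same positive definite
  kernel is the imaginary part of the Cauchy transform, which gives Stieltjes uniqueness.
\<close>

section \<open>Positive definiteness of the Cauchy kernel\<close>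

text \<open>The potential can be read off the quadratic
  \<open>A G^2 - B G + (\<theta> + t) = 0\<close> of the Cauchy transform, where
  \<open>A = \<theta> z (z + s)\<close> and \<open>B = (2 \<theta> + t) z + c\<close>: on the
  support the two roots are complex conjugate, so \<open>2 Re G\<close> is their sum
  \<open>B / A\<close>, and \<open>V\<close> is a primitive of it. Two obstacles shape the rest. On
  the support \<open>Re G\<close> is a principal value; it is avoided by integrating
  \<open>Re G\<close> along a line of height \<open>1 / (n + 1)\<close>, where the potential is
  smooth, and letting the height tend to 0, with the explicit square root of the discriminant
  supplying limit and bound. And a competitor may have energy \<open>-\<infinity>\<close>, or terms
  that are not separately integrable; the growth of \<open>V\<close> shows that a finite energy
  forces the logarithmic moment, the potential term and the logarithmic energy to be finite one by
  one, so that the quadratic form argument applies. The R-transform fixes \<open>G\<close> only on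
  the image of a truncated cone, whence an analytic continuation in the proof of uniqueness.\<close>

definition cauchy_kernel :: "real \<Rightarrow> real \<Rightarrow> real" where
  "cauchy_kernel e d = e\<^sup>2 / (d\<^sup>2 + e\<^sup>2)"

lemma cauchy_kernel_measurable [measurable]: "cauchy_kernel e \<in> borel_measurable borel"
  unfolding cauchy_kernel_def by measurable

lemma cauchy_kernel_bound: "\<bar>cauchy_kernel e d\<bar> \<le> 1"
  unfolding cauchy_kernel_def using not_sum_power2_lt_zero[of d e] by (auto simp: divide_simps)

text \<open>This is why the kernel is normalised to have value 1 at 0 instead of total mass 1: it is
  then the cosine transform of a probability law and bounded by 1 for every \<open>e\<close>, which
  makes all exchanges of integrals below harmless.\<close>

lemma integral_exponential_cos:
  assumes e: "e > 0"
  shows "(\<integral>\<xi>. cos (\<xi> * d) \<partial>density lborel (exponential_density e)) = cauchy_kernel e d"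
proof -
  interpret E: prob_space "density lborel (exponential_density e)"
    using e by (rule prob_space_exponential_density)
  let ?f = "\<lambda>\<xi>. exponential_density e \<xi> * cos (\<xi> * d)"
  have intE: "integrable (density lborel (exponential_density e)) (\<lambda>\<xi>. cos (\<xi> * d))"
    by (rule E.integrable_const_bound[where B=1]) auto
  have int: "integrable lborel ?f"
    using intE e by (subst (asm) integrable_density) (auto simp: exponential_density_nonneg)
  have eq: "(\<integral>\<xi>. cos (\<xi> * d) \<partial>density lborel (exponential_density e)) = (\<integral>\<xi>. ?f \<xi> \<partial>lborel)"
    using e by (subst integral_density) (auto simp: exponential_density_nonneg)
  \<comment> \<open>An antiderivative of the integrand, found by integrating by parts twice; it
    vanishes at infinity, so the integral is \<open>- F 0\<close>.\<close>
  define F where "F = (\<lambda>x. exp (- x * e) * (d * sin (x * d) - e * cos (x * d)) * (e / (d\<^sup>2 + e\<^sup>2)))"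
  have nz: "d\<^sup>2 + e\<^sup>2 > 0" using e by (simp add: add_nonneg_pos)
  have F': "(F has_real_derivative e * exp (- x * e) * cos (x * d)) (at x)" for x
    unfolding F_def
    apply (rule derivative_eq_intros refl)+
    using nz by (simp add: divide_simps) (simp add: algebra_simps power2_eq_square)
  have lim: "((\<lambda>y. \<integral> x. indicator {.. y} x *\<^sub>R ?f x \<partial>lborel) \<longlongrightarrow> (\<integral>x. ?f x \<partial>lborel)) at_top"
    by (rule tendsto_integral_at_top[OF _ int]) simp
  have ev: "eventually (\<lambda>y. (\<integral> x. indicator {.. y} x *\<^sub>R ?f x \<partial>lborel) = F y - F 0) at_top"
    using eventually_ge_at_top[of 0]
  proof eventually_elim
    case (elim y)
    have "(\<integral> x. indicator {.. y} x *\<^sub>R ?f x \<partial>lborel)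
      = (\<integral>x. (e * exp (- x * e) * cos (x * d)) * indicator {0..y} x \<partial>lborel)"
      by (rule Bochner_Integration.integral_cong) (auto simp: exponential_density_def indicator_def)
    also have "\<dots> = F y - F 0"
      by (rule integral_FTC_Icc_real[OF elim F']) (auto intro!: continuous_intros)
    finally show ?case .
  qed
  have "((\<lambda>y. exp (- y * e)) \<longlongrightarrow> 0) at_top"
    using e by real_asymp
  then have "(F \<longlongrightarrow> 0) at_top"
  proof (rule Lim_null_comparison[rotated, OF tendsto_mult_left_zero[where c="(\<bar>d\<bar>+e) * (e / (d\<^sup>2 + e\<^sup>2))"]], intro always_eventually allI)
    fix x
    have "\<bar>d * sin (x * d) - e * cos (x * d)\<bar> \<le> \<bar>d * sin (x * d)\<bar> + \<bar>e * cos (x * d)\<bar>"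
      by (rule abs_triangle_ineq4)
    also have "\<dots> \<le> \<bar>d\<bar> + e"
      unfolding abs_mult using e by (intro add_mono) (auto intro: mult_left_le simp: mult_left_le)
    finally have "\<bar>d * sin (x * d) - e * cos (x * d)\<bar> * (e / (d\<^sup>2 + e\<^sup>2)) \<le> (\<bar>d\<bar> + e) * (e / (d\<^sup>2 + e\<^sup>2))"
      using e by (intro mult_right_mono) auto
    then show "norm (F x) \<le> exp (- x * e) * ((\<bar>d\<bar>+e) * (e / (d\<^sup>2 + e\<^sup>2)))"
      unfolding F_def using e mult_left_mono[of _ _ "exp (- x * e)"]
      by (simp add: abs_mult mult.assoc del: times_divide_eq_right)
  qed
  then have "((\<lambda>y. F y - F 0) \<longlongrightarrow> 0 - F 0) at_top"
    by (intro tendsto_intros)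
  then have "((\<lambda>y. \<integral> x. indicator {.. y} x *\<^sub>R ?f x \<partial>lborel) \<longlongrightarrow> 0 - F 0) at_top"
    using ev by (rule Lim_transform_eventually[OF _ eventually_mono]) simp
  from tendsto_unique[OF _ lim this] have "(\<integral>x. ?f x \<partial>lborel) = - F 0" by simp
  then show ?thesis
    using eq nz by (simp add: F_def cauchy_kernel_def power2_eq_square)
qed

definition cauchy_form :: "real \<Rightarrow> real measure \<Rightarrow> real measure \<Rightarrow> real" where
  "cauchy_form e M N = (\<integral>x. (\<integral>y. cauchy_kernel e (x - y) \<partial>N) \<partial>M)"

text \<open>The addition formula for \<open>cos (\<xi> * (x - y))\<close> separates the variables,
  so that the two inner integrals become real and imaginary parts of characteristic
  functions.\<close>

lemma cauchy_form_char:
  assumes e: "e > 0" and "real_distribution M" "real_distribution N"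
  shows "cauchy_form e M N =
    (\<integral>\<xi>. Re (char M \<xi>) * Re (char N \<xi>) + Im (char M \<xi>) * Im (char N \<xi>)
       \<partial>density lborel (exponential_density e))"
proof -
  define E where "E = density lborel (exponential_density e)"
  interpret M: real_distribution M by fact
  interpret N: real_distribution N by fact
  interpret E: prob_space E
    unfolding E_def using e by (rule prob_space_exponential_density)
  have sE [measurable_cong]: "sets E = sets borel" by (simp add: E_def)
  note [measurable_cong] = M.events_eq_borel N.events_eq_borel
  interpret NE: pair_prob_space N E ..
  interpret ME: pair_prob_space M E ..
  have i: "Re (char L \<xi>) = (\<integral>x. cos (\<xi> * x) \<partial>L)" "Im (char L \<xi>) = (\<integral>x. sin (\<xi> * x) \<partial>L)"
     "integrable L (\<lambda>x. cos (\<xi> * x))" "integrable L (\<lambda>x. sin (\<xi> * x))"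
    if "real_distribution L" for L \<xi>
  proof -
    interpret L: real_distribution L by fact
    have int: "complex_integrable L (\<lambda>x. iexp (\<xi> * x))"
      by (rule L.integrable_const_bound[where B=1]) auto
    show "Re (char L \<xi>) = (\<integral>x. cos (\<xi> * x) \<partial>L)" "Im (char L \<xi>) = (\<integral>x. sin (\<xi> * x) \<partial>L)"
      unfolding char_def using int by (simp_all add: integral_Re[symmetric] integral_Im[symmetric] Re_exp Im_exp del: of_real_mult)
    show "integrable L (\<lambda>x. cos (\<xi> * x))" "integrable L (\<lambda>x. sin (\<xi> * x))"
      by (rule L.integrable_const_bound[where B=1]; auto)+
  qed
  have 1: "(\<integral>y. cauchy_kernel e (x - y) \<partial>N) = (\<integral>\<xi>. (\<integral>y. cos (\<xi> * (x - y)) \<partial>N) \<partial>E)" for x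
  proof -
    have "(\<integral>y. cauchy_kernel e (x - y) \<partial>N) = (\<integral>y. (\<integral>\<xi>. cos (\<xi> * (x - y)) \<partial>E) \<partial>N)"
      using integral_exponential_cos[OF e] by (simp add: E_def)
    also have "\<dots> = (\<integral>\<xi>. (\<integral>y. cos (\<xi> * (x - y)) \<partial>N) \<partial>E)"
      by (rule NE.Fubini_integral[symmetric], rule NE.integrable_const_bound[where B=1])
         (auto simp: split_beta)
    finally show ?thesis .
  qed
  have "cauchy_form e M N = (\<integral>x. (\<integral>\<xi>. (\<integral>y. cos (\<xi> * (x - y)) \<partial>N) \<partial>E) \<partial>M)"
    unfolding cauchy_form_def 1 ..
  also have "\<dots> = (\<integral>\<xi>. (\<integral>x. (\<integral>y. cos (\<xi> * (x - y)) \<partial>N) \<partial>M) \<partial>E)"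
  proof (rule ME.Fubini_integral[symmetric], rule ME.integrable_const_bound[where B=1])
    have "norm (\<integral>y. cos (\<xi> * (x - y)) \<partial>N) \<le> 1" for x \<xi>
    proof -
      have "norm (\<integral>y. cos (\<xi> * (x - y)) \<partial>N) \<le> (\<integral>y. norm (cos (\<xi> * (x - y))) \<partial>N)"
        by (rule integral_norm_bound)
      also have "\<dots> \<le> (\<integral>y. 1 \<partial>N)"
        by (rule integral_mono) (auto intro!: N.integrable_const_bound[where B=1])
      finally show ?thesis using N.prob_space by simp
    qed
    then show "AE x in M \<Otimes>\<^sub>M E. norm (case x of (x, \<xi>) \<Rightarrow> \<integral>y. cos (\<xi> * (x - y)) \<partial>N) \<le> 1"
      by auto
  qed measurable
  also have "\<dots> = (\<integral>\<xi>. Re (char M \<xi>) * Re (char N \<xi>) + Im (char M \<xi>) * Im (char N \<xi>) \<partial>E)"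
  proof (rule Bochner_Integration.integral_cong[OF refl])
    fix \<xi>
    note iN = i[OF \<open>real_distribution N\<close>] and iM = i[OF \<open>real_distribution M\<close>]
    have "(\<integral>y. cos (\<xi> * (x - y)) \<partial>N) = cos (\<xi> * x) * Re (char N \<xi>) + sin (\<xi> * x) * Im (char N \<xi>)" for x
      unfolding right_diff_distrib cos_diff using iN by simp
    then show "(\<integral>x. (\<integral>y. cos (\<xi> * (x - y)) \<partial>N) \<partial>M)
      = Re (char M \<xi>) * Re (char N \<xi>) + Im (char M \<xi>) * Im (char N \<xi>)"
      using iM by simp
  qed
  finally show ?thesis unfolding E_def .
qed

text \<open>The left side is the quadratic form at the signed measure \<open>M - N\<close>, expanded
  into three terms because only positive measures are available as values of type
  \<open>measure\<close>.\<close>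

lemma cauchy_form_square:
  assumes e: "e > 0" and MN: "real_distribution M" "real_distribution N"
  shows "cauchy_form e M M - 2 * cauchy_form e M N + cauchy_form e N N =
    (\<integral>\<xi>. (cmod (char M \<xi> - char N \<xi>))\<^sup>2 \<partial>density lborel (exponential_density e))"
    and "integrable (density lborel (exponential_density e)) (\<lambda>\<xi>. (cmod (char M \<xi> - char N \<xi>))\<^sup>2)"
proof -
  interpret E: prob_space "density lborel (exponential_density e)"
    using e by (rule prob_space_exponential_density)
  interpret M: real_distribution M by fact
  interpret N: real_distribution N by fact
  note [measurable] = M.char_measurable N.char_measurable
  have 1: "integrable (density lborel (exponential_density e))
     (\<lambda>\<xi>. Re (char A \<xi>) * Re (char B \<xi>) + Im (char A \<xi>) * Im (char B \<xi>))" 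
     if "real_distribution A" "real_distribution B" for A B
  proof (rule E.integrable_const_bound[where B=2])
    interpret A: real_distribution A by fact
    interpret B: real_distribution B by fact
    note [measurable] = A.char_measurable B.char_measurable
    show "(\<lambda>\<xi>. Re (char A \<xi>) * Re (char B \<xi>) + Im (char A \<xi>) * Im (char B \<xi>)) \<in>
       borel_measurable (density lborel (exponential_density e))" by measurable
    have b: "\<bar>Re (char A \<xi>)\<bar> \<le> 1" "\<bar>Im (char A \<xi>)\<bar> \<le> 1" "\<bar>Re (char B \<xi>)\<bar> \<le> 1" "\<bar>Im (char B \<xi>)\<bar> \<le> 1" for \<xi>
      using A.cmod_char_le_1[of \<xi>] B.cmod_char_le_1[of \<xi>]
        abs_Re_le_cmod[of "char A \<xi>"] abs_Im_le_cmod[of "char A \<xi>"]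
        abs_Re_le_cmod[of "char B \<xi>"] abs_Im_le_cmod[of "char B \<xi>"] by linarith+
    have "\<bar>Re (char A \<xi>) * Re (char B \<xi>) + Im (char A \<xi>) * Im (char B \<xi>)\<bar> \<le> 2" for \<xi>
    proof -
      have "\<bar>Re (char A \<xi>) * Re (char B \<xi>)\<bar> \<le> 1 * 1" "\<bar>Im (char A \<xi>) * Im (char B \<xi>)\<bar> \<le> 1 * 1"
        unfolding abs_mult using b by (intro mult_mono; simp)+
      then show ?thesis by linarith
    qed
    then show "AE \<xi> in density lborel (exponential_density e).
      norm (Re (char A \<xi>) * Re (char B \<xi>) + Im (char A \<xi>) * Im (char B \<xi>)) \<le> 2" by auto
  qed
  have eq: "(cmod (char M \<xi> - char N \<xi>))\<^sup>2 =
     (Re (char M \<xi>) * Re (char M \<xi>) + Im (char M \<xi>) * Im (char M \<xi>))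
     - 2 * (Re (char M \<xi>) * Re (char N \<xi>) + Im (char M \<xi>) * Im (char N \<xi>))
     + (Re (char N \<xi>) * Re (char N \<xi>) + Im (char N \<xi>) * Im (char N \<xi>))" for \<xi>
    unfolding cmod_power2 by (simp add: power2_eq_square algebra_simps)
  have comb: "(\<integral>x. f x - 2 * g x + h x \<partial>L) = (\<integral>x. f x \<partial>L) - 2 * (\<integral>x. g x \<partial>L) + (\<integral>x. h x \<partial>L)"
    if "integrable L f" "integrable L g" "integrable L h" for L :: "real measure" and f g h :: "real \<Rightarrow> real"
    using that by simp
  note I = 1[OF MN(1) MN(1)] 1[OF MN(2) MN(2)] 1[OF MN]
  show "integrable (density lborel (exponential_density e)) (\<lambda>\<xi>. (cmod (char M \<xi> - char N \<xi>))\<^sup>2)"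
    unfolding eq by (intro Bochner_Integration.integrable_add Bochner_Integration.integrable_diff integrable_mult_right I)
  show "cauchy_form e M M - 2 * cauchy_form e M N + cauchy_form e N N =
    (\<integral>\<xi>. (cmod (char M \<xi> - char N \<xi>))\<^sup>2 \<partial>density lborel (exponential_density e))"
    unfolding cauchy_form_char[OF e MN(1) MN(1)] cauchy_form_char[OF e MN(2) MN(2)] cauchy_form_char[OF e MN] eq
    by (rule comb[OF I(1,3,2), symmetric])
qed

lemma cauchy_form_nonneg:
  assumes "e > 0" "real_distribution M" "real_distribution N"
  shows "cauchy_form e M M - 2 * cauchy_form e M N + cauchy_form e N N \<ge> 0"
  unfolding cauchy_form_square[OF assms] by (rule integral_nonneg_AE) auto

text \<open>The vanishing integral makes the characteristic functions agree almost everywhere on the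
  positive half-line, the support of the exponential law. Continuity removes the exceptional null
  set, conjugation covers negative arguments, and Levy's theorem concludes.\<close>

lemma cauchy_form_zero_imp_eq:
  assumes e: "e > 0" and MN: "real_distribution M" "real_distribution N"
    and 0: "cauchy_form e M M - 2 * cauchy_form e M N + cauchy_form e N N = 0"
  shows "M = N"
proof (rule Levy_uniqueness[OF MN], rule ext)
  interpret M: real_distribution M by fact
  interpret N: real_distribution N by fact
  note [measurable] = M.char_measurable N.char_measurable
  have "AE \<xi> in density lborel (exponential_density e). (cmod (char M \<xi> - char N \<xi>))\<^sup>2 = 0"
    using 0 integral_nonneg_eq_0_iff_AE[OF cauchy_form_square(2)[OF e MN]]
    unfolding cauchy_form_square[OF e MN] by auto
  then have "AE \<xi> in lborel. 0 < exponential_density e \<xi> \<longrightarrow> char M \<xi> = char N \<xi>"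
    by (subst (asm) AE_density) auto
  then have AE: "AE \<xi> in lborel. \<xi> > 0 \<longrightarrow> char M \<xi> = char N \<xi>"
    by eventually_elim (use e in \<open>auto simp: exponential_density_def\<close>)
  have pos: "char M \<xi> = char N \<xi>" if "\<xi> > 0" for \<xi>
  proof (rule ccontr)
    assume ne: "char M \<xi> \<noteq> char N \<xi>"
    have "continuous_on UNIV (\<lambda>\<xi>. char M \<xi> - char N \<xi>)"
      by (intro continuous_intros continuous_at_imp_continuous_on ballI M.isCont_char N.isCont_char)
    then have "open ((\<lambda>\<xi>. char M \<xi> - char N \<xi>) -` (- {0}))"
      by (subst (asm) continuous_on_open_vimage) auto
    then have "open ((\<lambda>\<xi>. char M \<xi> - char N \<xi>) -` (- {0}) \<inter> {0<..})" (is "open ?S")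
      by (intro open_Int) auto
    moreover have "\<xi> \<in> ?S" using ne that by simp
    ultimately obtain r where r: "r > 0" "ball \<xi> r \<subseteq> ?S" by (meson openE)
    have "ball \<xi> r \<in> null_sets lborel"
    proof (rule AE_iff_null_sets[THEN iffD2])
      show "AE x in lborel. x \<notin> ball \<xi> r"
        using AE by eventually_elim (use r in auto)
    qed auto
    then have "emeasure lborel (ball \<xi> r) = 0" by (rule null_setsD1)
    moreover have "ball \<xi> r = {\<xi> - r <..< \<xi> + r}" by (auto simp: dist_real_def)
    ultimately show False using r by simp
  qed
  have cnj: "char L (-\<xi>) = cnj (char L \<xi>)" for L \<xi>
    unfolding char_def by (subst Bochner_Integration.integral_cnj[symmetric]) (simp add: exp_cnj)
  show "char M \<xi> = char N \<xi>" for \<xi>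
  proof (cases "\<xi> > 0")
    case True then show ?thesis by (rule pos)
  next
    case False
    then consider "\<xi> = 0" | "-\<xi> > 0" by linarith
    then show ?thesis
    proof cases
      case 1 then show ?thesis by (simp add: M.char_zero N.char_zero)
    next
      case 2
      have "char M (-(-\<xi>)) = char N (-(-\<xi>))"
        unfolding cnj[of _ "-\<xi>"] pos[OF 2] ..
      then show ?thesis by simp
    qed
  qed
qed

section \<open>The logarithmic kernel as an integral of Cauchy kernels\<close>

lemma ln_abs_has_integral:
  fixes d :: real
  assumes d: "d \<noteq> 0"
  shows "has_bochner_integral lborel
      (\<lambda>e. indicator {0..} e * (e / (1 + e\<^sup>2) - e / (d\<^sup>2 + e\<^sup>2))) (ln \<bar>d\<bar>)"
    and "has_bochner_integral lborel
      (\<lambda>e. \<bar>indicator {0..} e * (e / (1 + e\<^sup>2) - e / (d\<^sup>2 + e\<^sup>2))\<bar>) \<bar>ln \<bar>d\<bar>\<bar>"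
proof -
  let ?h = "\<lambda>e. e / (1 + e\<^sup>2) - e / (d\<^sup>2 + e\<^sup>2)"
  define F where "F = (\<lambda>e. (ln (1 + e\<^sup>2) - ln (d\<^sup>2 + e\<^sup>2)) / 2)"
  have pos: "1 + e\<^sup>2 > 0" "d\<^sup>2 + e\<^sup>2 > 0" for e :: real
    using d by (auto simp: add_pos_nonneg)
  have F': "(F has_real_derivative ?h e) (at e)" for e
    unfolding F_def using pos[of e]
    by (auto intro!: derivative_eq_intros simp: field_simps)
  have lim: "(F \<longlongrightarrow> 0) at_top"
    unfolding F_def using pos(2)[of 0] by real_asymp
  have F0: "F 0 = - ln \<bar>d\<bar>"
    using d by (simp add: F_def ln_realpow[of "\<bar>d\<bar>" 2, simplified])
  \<comment> \<open>For \<open>e \<ge> 0\<close> the sign is that of \<open>d^2 - 1\<close> and does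
    not depend on \<open>e\<close>. Hence the integral of the absolute value is the absolute value
    of the integral, which is the bound that Fubini's theorem asks for later.\<close>
  have hform: "?h e = e * (d\<^sup>2 - 1) / ((1 + e\<^sup>2) * (d\<^sup>2 + e\<^sup>2))" for e
    using pos[of e] by (simp add: divide_simps) (simp add: algebra_simps)
  have "has_bochner_integral lborel (\<lambda>e. indicator {0..} e * ?h e) (ln \<bar>d\<bar>) \<and>
    has_bochner_integral lborel (\<lambda>e. \<bar>indicator {0..} e * ?h e\<bar>) \<bar>ln \<bar>d\<bar>\<bar>"
  proof (cases "\<bar>d\<bar> \<ge> 1")
    case True
    then have d1: "d\<^sup>2 \<ge> 1" by (simp add: abs_le_square_iff[of 1 d, simplified])
    have nn: "?h e \<ge> 0" if "e \<ge> 0" for e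
      unfolding hform using d1 pos[of e] that by (intro divide_nonneg_pos mult_nonneg_nonneg) auto
    have l: "ln \<bar>d\<bar> \<ge> 0" using True by simp
    have "(\<integral>\<^sup>+e\<in>{0..}. ennreal (?h e) \<partial>lborel) = ennreal (ln \<bar>d\<bar>)"
      using nn_integral_FTC_atLeast[of ?h 0 F 0] F' lim nn F0 by simp
    then have "(\<integral>\<^sup>+e. ennreal (indicator {0..} e * ?h e) \<partial>lborel) = ennreal (ln \<bar>d\<bar>)"
      by (subst (asm) nn_integral_cong[of _ _ "\<lambda>e. ennreal (indicator {0..} e * ?h e)"])
         (auto simp: indicator_def)
    then have 1: "has_bochner_integral lborel (\<lambda>e. indicator {0..} e * ?h e) (ln \<bar>d\<bar>)"
      by (intro has_bochner_integral_nn_integral) (use l nn in \<open>auto simp: indicator_def\<close>)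
    have "\<bar>indicator {0..} e * ?h e\<bar> = indicator {0..} e * ?h e" for e
      using nn by (auto simp: indicator_def)
    with 1 l show ?thesis by simp
  next
    case False
    then have d1: "d\<^sup>2 \<le> 1" by (simp add: abs_square_le_1)
    have nn: "- ?h e \<ge> 0" if "e \<ge> 0" for e
      unfolding hform minus_divide_left using d1 pos[of e] that
      by (intro divide_nonneg_pos) (auto simp: mult_nonneg_nonpos)
    have l: "- ln \<bar>d\<bar> \<ge> 0" using False d by (simp add: ln_le_zero_iff)
    have "(\<integral>\<^sup>+e\<in>{0..}. ennreal (- ?h e) \<partial>lborel) = ennreal (- ln \<bar>d\<bar>)"
      using nn_integral_FTC_atLeast[of "\<lambda>e. - ?h e" 0 "\<lambda>e. - F e" 0] DERIV_minus[OF F']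
        tendsto_minus[OF lim] nn F0 by simp
    then have "(\<integral>\<^sup>+e. ennreal (indicator {0..} e * (- ?h e)) \<partial>lborel) = ennreal (- ln \<bar>d\<bar>)"
      by (subst (asm) nn_integral_cong[of _ _ "\<lambda>e. ennreal (indicator {0..} e * (- ?h e))"])
         (auto simp: indicator_def)
    then have 1: "has_bochner_integral lborel (\<lambda>e. indicator {0..} e * (- ?h e)) (- ln \<bar>d\<bar>)"
      by (intro has_bochner_integral_nn_integral) (use l nn in \<open>auto simp: indicator_def\<close>)
    have "\<bar>indicator {0..} e * ?h e\<bar> = indicator {0..} e * (- ?h e)" for e
      using nn[of e] by (cases "e \<ge> 0") auto
    moreover have "indicator {0..} e * ?h e = - (indicator {0..} e * (- ?h e))" for e
      by (simp only: mult_minus_right minus_minus)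
    ultimately show ?thesis using 1 l has_bochner_integral_minus[OF 1] by simp
  qed
  then show "has_bochner_integral lborel (\<lambda>e. indicator {0..} e * ?h e) (ln \<bar>d\<bar>)"
    and "has_bochner_integral lborel (\<lambda>e. \<bar>indicator {0..} e * ?h e\<bar>) \<bar>ln \<bar>d\<bar>\<bar>" by auto
qed

text \<open>The condition on the diagonal is separate because \<open>ln 0 = 0\<close>: integrability
  alone would not notice mass on the diagonal, where the true kernel is
  \<open>-\<infinity>\<close>.\<close>

definition finite_log_energy :: "real measure \<Rightarrow> real measure \<Rightarrow> bool" where
  "finite_log_energy M N \<longleftrightarrow>
     (AE p in M \<Otimes>\<^sub>M N. fst p \<noteq> snd p) \<and> integrable (M \<Otimes>\<^sub>M N) (\<lambda>p. ln \<bar>fst p - snd p\<bar>)"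

definition log_energy :: "real measure \<Rightarrow> real measure \<Rightarrow> real" where
  "log_energy M N = (\<integral>p. ln \<bar>fst p - snd p\<bar> \<partial>(M \<Otimes>\<^sub>M N))"

text \<open>Fubini's theorem applied to \<open>ln_abs_has_integral\<close>. The term
  \<open>cauchy_kernel e 1\<close> belongs to \<open>ln 1 = 0\<close>; it makes the integral
  converge and cancels in the combination with coefficients 1, -2, 1.\<close>

lemma log_energy_cauchy_form:
  assumes "real_distribution M" "real_distribution N" and fin: "finite_log_energy M N"
  shows "has_bochner_integral lborel
    (\<lambda>e. indicator {0<..} e * ((cauchy_kernel e 1 - cauchy_form e M N) / e)) (log_energy M N)"
proof -
  interpret M: real_distribution M by fact
  interpret N: real_distribution N by fact
  note [measurable_cong] = M.events_eq_borel N.events_eq_borel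
  interpret MN: pair_prob_space M N ..
  interpret P: pair_sigma_finite "M \<Otimes>\<^sub>M N" lborel ..
  define h where "h = (\<lambda>p e :: real. indicator {0<..} e * ((cauchy_kernel e 1 - cauchy_kernel e (fst p - snd p)) / e))"
  have hm [measurable]: "(\<lambda>(p, e). h p e) \<in> borel_measurable ((M \<Otimes>\<^sub>M N) \<Otimes>\<^sub>M lborel)"
    unfolding h_def cauchy_kernel_def by measurable
  \<comment> \<open>At \<open>e = 0\<close> both integrands vanish, so the open and the closed
    half-line give the same function.\<close>
  have h_eq: "h p = (\<lambda>e. indicator {0..} e * (e / (1 + e\<^sup>2) - e / ((fst p - snd p)\<^sup>2 + e\<^sup>2)))" for p
    by (auto simp: h_def cauchy_kernel_def fun_eq_iff indicator_def power2_eq_square diff_divide_distrib)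
  have h1: "has_bochner_integral lborel (h p) (ln \<bar>fst p - snd p\<bar>)"
    and h2: "has_bochner_integral lborel (\<lambda>e. \<bar>h p e\<bar>) \<bar>ln \<bar>fst p - snd p\<bar>\<bar>" if "fst p \<noteq> snd p" for p
    using ln_abs_has_integral[of "fst p - snd p"] that unfolding h_eq by auto
  have AE: "AE p in M \<Otimes>\<^sub>M N. fst p \<noteq> snd p"
    and int: "integrable (M \<Otimes>\<^sub>M N) (\<lambda>p. ln \<bar>fst p - snd p\<bar>)"
    using fin by (auto simp: finite_log_energy_def)
  have I: "integrable ((M \<Otimes>\<^sub>M N) \<Otimes>\<^sub>M lborel) (\<lambda>(p, e). h p e)"
  proof (rule P.Fubini_integrable)
    show "integrable (M \<Otimes>\<^sub>M N) (\<lambda>p. \<integral>e. norm (case (p, e) of (p, e) \<Rightarrow> h p e) \<partial>lborel)"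
    proof (rule integrable_cong_AE_imp[OF integrable_abs[OF int]])
      show "AE p in M \<Otimes>\<^sub>M N. \<bar>ln \<bar>fst p - snd p\<bar>\<bar> = (\<integral>e. norm (case (p, e) of (p, e) \<Rightarrow> h p e) \<partial>lborel)"
        using AE by eventually_elim (use h2 in \<open>auto simp: has_bochner_integral_iff\<close>)
    qed measurable
    show "AE p in M \<Otimes>\<^sub>M N. integrable lborel (\<lambda>e. case (p, e) of (p, e) \<Rightarrow> h p e)"
      using AE by eventually_elim (use h1 in \<open>auto simp: has_bochner_integral_iff\<close>)
  qed measurable
  have inner: "(\<integral>p. h p e \<partial>(M \<Otimes>\<^sub>M N)) = indicator {0<..} e * ((cauchy_kernel e 1 - cauchy_form e M N) / e)" for e
  proof -
    have i: "integrable (M \<Otimes>\<^sub>M N) (\<lambda>(x, y). cauchy_kernel e (x - y))"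
      by (rule MN.integrable_const_bound[where B=1]) (auto simp: cauchy_kernel_bound)
    have "(\<integral>p. cauchy_kernel e (fst p - snd p) \<partial>(M \<Otimes>\<^sub>M N)) = cauchy_form e M N"
      unfolding cauchy_form_def using MN.integral_fst'[OF i] by (simp add: case_prod_beta')
    with i show ?thesis
      unfolding h_def using MN.P.prob_space by (simp add: case_prod_beta')
  qed
  have "integrable lborel (\<lambda>e. \<integral>p. h p e \<partial>(M \<Otimes>\<^sub>M N))"
    by (rule P.integrable_snd[OF I])
  moreover have "(\<integral>e. (\<integral>p. h p e \<partial>(M \<Otimes>\<^sub>M N)) \<partial>lborel) = (\<integral>p. (\<integral>e. h p e \<partial>lborel) \<partial>(M \<Otimes>\<^sub>M N))"
    by (rule P.Fubini_integral[OF I])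
  moreover have "(\<integral>p. (\<integral>e. h p e \<partial>lborel) \<partial>(M \<Otimes>\<^sub>M N)) = log_energy M N"
    unfolding log_energy_def
  proof (rule integral_cong_AE)
    show "AE p in M \<Otimes>\<^sub>M N. (\<integral>e. h p e \<partial>lborel) = ln \<bar>fst p - snd p\<bar>"
      using AE by eventually_elim (use h1 in \<open>auto simp: has_bochner_integral_iff\<close>)
  qed measurable
  ultimately show ?thesis
    unfolding inner by (auto simp: has_bochner_integral_iff)
qed

text \<open>By \<open>log_energy_cauchy_form\<close> the expression is minus the integral of
  \<open>?Q e / e\<close> over \<open>e > 0\<close>. Since \<open>M \<noteq> N\<close>, the form
  \<open>?Q e\<close> is positive for every such \<open>e\<close>, whereas a nonnegative value would
  make it vanish almost everywhere.\<close>

lemma log_energy_negative_definite: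
  assumes MN: "real_distribution M" "real_distribution N"
    and fin: "finite_log_energy M M" "finite_log_energy M N" "finite_log_energy N N"
    and ne: "M \<noteq> N"
  shows "log_energy M M - 2 * log_energy M N + log_energy N N < 0"
proof (rule ccontr)
  let ?Q = "\<lambda>e. cauchy_form e M M - 2 * cauchy_form e M N + cauchy_form e N N"
  let ?g = "\<lambda>e. indicator {0<..} e * (?Q e / e)"
  let ?E = "log_energy M M - 2 * log_energy M N + log_energy N N"
  assume "\<not> ?E < 0"
  have Q: "?Q e > 0" if "e > 0" for e
    using cauchy_form_nonneg[OF that MN] cauchy_form_zero_imp_eq[OF that MN] ne by fastforce
  have "has_bochner_integral lborel
     (\<lambda>e. - (indicator {0<..} e * ((cauchy_kernel e 1 - cauchy_form e M M) / e)
       - 2 * (indicator {0<..} e * ((cauchy_kernel e 1 - cauchy_form e M N) / e))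
       + indicator {0<..} e * ((cauchy_kernel e 1 - cauchy_form e N N) / e))) (- ?E)"
    by (intro has_bochner_integral_add has_bochner_integral_diff has_bochner_integral_minus
        has_bochner_integral_mult_right log_energy_cauchy_form MN fin)
  also have "(\<lambda>e. - (indicator {0<..} e * ((cauchy_kernel e 1 - cauchy_form e M M) / e)
       - 2 * (indicator {0<..} e * ((cauchy_kernel e 1 - cauchy_form e M N) / e))
       + indicator {0<..} e * ((cauchy_kernel e 1 - cauchy_form e N N) / e))) = ?g"
    by (auto simp: fun_eq_iff indicator_def field_simps)
  finally have g: "integrable lborel ?g" "(\<integral>e. ?g e \<partial>lborel) = - ?E"
    by (auto simp: has_bochner_integral_iff)
  have nn: "?g e \<ge> 0" for e
    using Q[of e] by (auto simp: indicator_def)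
  then have "(\<integral>e. ?g e \<partial>lborel) \<ge> 0" by (intro integral_nonneg_AE) auto
  with g \<open>\<not> ?E < 0\<close> have "(\<integral>e. ?g e \<partial>lborel) = 0" by linarith
  then have "AE e in lborel. ?g e = 0"
    using integral_nonneg_eq_0_iff_AE[OF g(1)] nn by auto
  then have "AE e in lborel. e \<notin> {0<..<1::real}"
    by eventually_elim (use Q in force)
  then have "{0<..<1::real} \<in> null_sets lborel"
    by (subst AE_iff_null_sets) auto
  then show False by (auto dest: null_setsD1)
qed

section \<open>Cauchy transforms in the upper half-plane\<close>

lemma integrable_cauchy_G:
  assumes "real_distribution M" "Im z > 0"
  shows "integrable M (\<lambda>x. 1 / (z - complex_of_real x))"
proof -
  interpret M: real_distribution M by fact
  note [measurable_cong] = M.events_eq_borel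
  show ?thesis
  proof (rule M.integrable_const_bound[where B="1 / Im z"])
    have "cmod (1 / (z - complex_of_real x)) \<le> 1 / Im z" for x
    proof -
      have "Im z \<le> cmod (z - complex_of_real x)"
        using abs_Im_le_cmod[of "z - complex_of_real x"] by simp
      then show ?thesis
        using assms(2) unfolding norm_divide norm_one by (intro divide_left_mono mult_pos_pos) linarith+
    qed
    then show "AE x in M. norm (1 / (z - complex_of_real x)) \<le> 1 / Im z" by auto
  qed measurable
qed

text \<open>The difference quotient minus the claimed derivative is the integral of
  \<open>(w - z) / ((z - x)^2 (w - x))\<close>. For \<open>w\<close> within \<open>y / 2\<close> of
  \<open>z\<close> the denominator is at least \<open>y^3 / 2\<close> in modulus, so the error is of
  order \<open>w - z\<close>.\<close>

lemma cauchy_G_has_derivative: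
  assumes M: "real_distribution M" and z: "Im z > 0"
  shows "(cauchy_G M has_field_derivative (- (\<integral>x. 1 / (z - complex_of_real x)\<^sup>2 \<partial>M))) (at z)"
proof -
  interpret M: real_distribution M by fact
  note [measurable_cong] = M.events_eq_borel
  define y where "y = Im z"
  have y: "y > 0" using z by (simp add: y_def)
  have lo: "cmod (w - complex_of_real x) \<ge> Im w" for w x
    using abs_Im_le_cmod[of "w - complex_of_real x"] by simp
  have int2: "integrable M (\<lambda>x. 1 / (z - complex_of_real x)\<^sup>2)"
  proof (rule M.integrable_const_bound[where B="1 / y\<^sup>2"])
    have "cmod (1 / (z - complex_of_real x)\<^sup>2) \<le> 1 / y\<^sup>2" for x
      unfolding norm_divide norm_power norm_one
    proof (intro divide_left_mono power_mono mult_pos_pos zero_less_power)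
      show *: "y \<le> cmod (z - complex_of_real x)" using lo[of z x] by (simp add: y_def)
      show "0 < cmod (z - complex_of_real x)" using * y by linarith
    qed (use y in simp_all)
    then show "AE x in M. norm (1 / (z - complex_of_real x)\<^sup>2) \<le> 1 / y\<^sup>2" by auto
  qed measurable
  have y3: "y ^ 3 = y\<^sup>2 * y"
    by (simp add: power3_eq_cube power2_eq_square)
  have lint_const: "(\<integral>x. c \<partial>M) = c" for c :: real
    using M.prob_space by simp
  have bound: "cmod ((cauchy_G M w - cauchy_G M z) / (w - z) + (\<integral>x. 1 / (z - complex_of_real x)\<^sup>2 \<partial>M))
      \<le> cmod (w - z) * (2 / y ^ 3)" if w: "w \<noteq> z" "cmod (w - z) < y / 2" for w
  proof -
    have imw: "Im w \<ge> y / 2"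
      using abs_Im_le_cmod[of "w - z"] w by (simp add: y_def)
    have nz: "z - complex_of_real x \<noteq> 0" "w - complex_of_real x \<noteq> 0" for x
      using lo[of z x] lo[of w x] imw y by (auto simp: y_def)
    let ?D = "\<lambda>x. (1 / (w - complex_of_real x) - 1 / (z - complex_of_real x)) / (w - z) + 1 / (z - complex_of_real x)\<^sup>2"
    have i: "integrable M (\<lambda>x. 1 / (w - complex_of_real x))" "integrable M (\<lambda>x. 1 / (z - complex_of_real x))"
      using imw y z by (auto intro!: integrable_cauchy_G M)
    have "(cauchy_G M w - cauchy_G M z) / (w - z) + (\<integral>x. 1 / (z - complex_of_real x)\<^sup>2 \<partial>M) = (\<integral>x. ?D x \<partial>M)"
      unfolding cauchy_G_def
      by (subst Bochner_Integration.integral_add) (use i int2 in \<open>auto intro!: integrable_divide_zero\<close>)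
    moreover have "cmod (\<integral>x. ?D x \<partial>M) \<le> (\<integral>x. cmod (w - z) * (2 / y ^ 3) \<partial>M)"
    proof (rule order_trans[OF integral_norm_bound integral_mono])
      show "integrable M (\<lambda>x. cmod (?D x))" using i int2 by (intro integrable_norm) simp
      show "integrable M (\<lambda>x. cmod (w - z) * (2 / y ^ 3))" by simp
      fix x
      have alg: "(1 / b - 1 / a) / (b - a) + 1 / a\<^sup>2 = (b - a) / (a\<^sup>2 * b)"
        if "a \<noteq> 0" "b \<noteq> 0" "a \<noteq> b" for a b :: complex
      proof -
        have "(1 / b - 1 / a) / (b - a) = - (1 / (a * b))"
          using that by (simp add: divide_simps)
        then show ?thesis using that by (simp add: field_simps power2_eq_square)
      qed
      have "?D x = (w - z) / ((z - complex_of_real x)\<^sup>2 * (w - complex_of_real x))"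
        using alg[OF nz[of x]] w by simp
      then have "cmod (?D x) = cmod (w - z) * (1 / ((cmod (z - complex_of_real x))\<^sup>2 * cmod (w - complex_of_real x)))"
        by (simp add: norm_divide norm_mult norm_power)
      also have "\<dots> \<le> cmod (w - z) * (1 / (y\<^sup>2 * (y / 2)))"
      proof (intro mult_left_mono divide_left_mono mult_mono power_mono mult_pos_pos zero_less_power)
        show "y \<le> cmod (z - complex_of_real x)" using lo[of z x] by (simp add: y_def)
        show "y / 2 \<le> cmod (w - complex_of_real x)" using lo[of w x] imw by linarith
      qed (use y nz[of x] in simp_all)
      also have "\<dots> = cmod (w - z) * (2 / y ^ 3)"
        by (simp only: y3 times_divide_eq_right divide_divide_eq_right mult_1_left)
      finally show "norm (?D x) \<le> cmod (w - z) * (2 / y ^ 3)" .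
    qed
    ultimately show ?thesis by (simp only: lint_const)
  qed
  have "((\<lambda>w. (cauchy_G M w - cauchy_G M z) / (w - z) + (\<integral>x. 1 / (z - complex_of_real x)\<^sup>2 \<partial>M)) \<longlongrightarrow> 0) (at z)"
  proof (rule Lim_null_comparison)
    show "\<forall>\<^sub>F w in at z. norm ((cauchy_G M w - cauchy_G M z) / (w - z) + (\<integral>x. 1 / (z - complex_of_real x)\<^sup>2 \<partial>M))
      \<le> cmod (w - z) * (2 / y ^ 3)"
      unfolding eventually_at using y bound
      by (intro exI[of _ "y / 2"]) (auto simp: dist_norm)
    have "((\<lambda>w. cmod (w - z) * (2 / y ^ 3)) \<longlongrightarrow> cmod (z - z) * (2 / y ^ 3)) (at z)"
      by (intro tendsto_intros)
    then show "((\<lambda>w. cmod (w - z) * (2 / y ^ 3)) \<longlongrightarrow> 0) (at z)" by simp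
  qed
  then show ?thesis
    unfolding has_field_derivative_iff by - (rule LIM_zero_cancel, simp only: diff_minus_eq_add)
qed

lemma cauchy_G_holomorphic:
  assumes "real_distribution M"
  shows "cauchy_G M holomorphic_on {z. Im z > 0}"
  using cauchy_G_has_derivative[OF assms]
  by (subst holomorphic_on_open) (auto simp: open_halfspace_Im_gt)

text \<open>The imaginary part of the Cauchy transform is the Cauchy kernel, so \<open>cauchy_form\<close> cannot
  distinguish the two measures.\<close>
lemma cauchy_G_inject:
  assumes MN: "real_distribution M" "real_distribution N"
    and eq: "\<And>z. Im z > 0 \<Longrightarrow> cauchy_G M z = cauchy_G N z"
  shows "M = N"
proof (rule cauchy_form_zero_imp_eq[OF zero_less_one MN])
  \<comment> \<open>A single height suffices, because one value of \<open>e\<close> already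
    separates measures in \<open>cauchy_form_zero_imp_eq\<close>.\<close>
  have ck: "(\<integral>x. cauchy_kernel 1 (y - x) \<partial>L) = - Im (cauchy_G L (Complex y 1))"
    if "real_distribution L" for y L
  proof -
    have k: "cauchy_kernel 1 (y - x) = - Im (1 / (Complex y 1 - complex_of_real x))" for x
      by (simp add: Im_divide cauchy_kernel_def)
    have "Im (cauchy_G L (Complex y 1)) = (\<integral>x. Im (1 / (Complex y 1 - complex_of_real x)) \<partial>L)"
      unfolding cauchy_G_def by (intro integral_Im[symmetric] integrable_cauchy_G that) simp
    then show ?thesis
      unfolding k by (simp only: Bochner_Integration.integral_minus)
  qed
  have "cauchy_form 1 L M = cauchy_form 1 L N" for L
    unfolding cauchy_form_def ck[OF MN(1)] ck[OF MN(2)] by (simp add: eq)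
  moreover have "cauchy_form 1 M N = cauchy_form 1 N M"
    by (simp add: cauchy_form_char MN mult.commute)
  ultimately show "cauchy_form 1 M M - 2 * cauchy_form 1 M N + cauchy_form 1 N N = 0"
    by simp
qed

section \<open>The semicircle integral\<close>

text \<open>Partial fractions in \<open>exp (i \<phi>)\<close> give the antiderivative
  \<open>P\<close>. The principal logarithm is smooth along the path because \<open>1 - w\<close>
  has positive real part for \<open>cmod w < 1\<close>. At 0 and at pi the two exponentials
  coincide, so the logarithms cancel and only the linear term contributes.\<close>

lemma has_integral_poisson_kernel:
  fixes q :: complex
  assumes q: "cmod q < 1"
  shows "((\<lambda>\<phi>. (1 - q\<^sup>2) / (1 - 2 * q * cos (complex_of_real \<phi>) + q\<^sup>2)) has_integral complex_of_real pi) {0..pi}"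
proof -
  define P where "P = (\<lambda>\<phi>::real. complex_of_real \<phi> + \<i> * (Ln (1 - q * exp (\<i> * \<phi>)) - Ln (1 - q * exp (- (\<i> * \<phi>)))))"
  have n: "cmod (q * exp (\<i> * complex_of_real \<phi>)) < 1" "cmod (q * exp (- (\<i> * complex_of_real \<phi>))) < 1" for \<phi> :: real
    using q by (simp_all add: norm_mult)
  have re: "Re (1 - w) > 0" if "cmod w < 1" for w
    using complex_Re_le_cmod[of w] that by simp
  have nn: "1 - w \<notin> \<real>\<^sub>\<le>\<^sub>0" "1 - w \<noteq> 0" if "cmod w < 1" for w
    using re[OF that] by (auto simp: complex_nonpos_Reals_iff)
  have deriv: "(P has_vector_derivative (1 - q\<^sup>2) / (1 - 2 * q * cos (complex_of_real \<phi>) + q\<^sup>2)) (at \<phi> within A)" for \<phi> A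
  proof -
    let ?e = "exp (\<i> * complex_of_real \<phi>)" and ?e' = "exp (- (\<i> * complex_of_real \<phi>))"
    define Q where "Q = (\<lambda>z. z + \<i> * (Ln (1 - q * exp (\<i> * z)) - Ln (1 - q * exp (- (\<i> * z)))))"
    have ee: "?e * ?e' = 1" by (simp flip: exp_add)
    have c: "2 * cos (complex_of_real \<phi>) = ?e + ?e'"
      by (simp add: cos_exp_eq)
    have den: "1 - 2 * q * cos (complex_of_real \<phi>) + q\<^sup>2 = (1 - q * ?e) * (1 - q * ?e')"
      using ee c by algebra
    have ii: "1 + \<i> * ((- (q * (a * \<i>))) / c - (- (q * (b * (- \<i>)))) / d) = 1 + q * a / c + q * b / d" for a b c d
    proof -
      have "\<i> * ((- (q * (a * \<i>))) / c) = q * a / c" "\<i> * ((- (q * (b * (- \<i>)))) / d) = - (q * b / d)"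
        unfolding times_divide_eq_right minus_divide_left by (simp_all add: algebra_simps)
      then show ?thesis by (simp only: right_diff_distrib) simp
    qed
    have "(Q has_field_derivative 1 + \<i> * ((- (q * (?e * \<i>))) / (1 - q * ?e) - (- (q * (?e' * (- \<i>)))) / (1 - q * ?e'))) (at (complex_of_real \<phi>))"
      unfolding Q_def using nn[OF n(1)[of \<phi>]] nn[OF n(2)[of \<phi>]]
      by (auto intro!: derivative_eq_intros simp: divide_inverse mult_ac)
    also have "1 + \<i> * ((- (q * (?e * \<i>))) / (1 - q * ?e) - (- (q * (?e' * (- \<i>)))) / (1 - q * ?e'))
      = 1 + q * ?e / (1 - q * ?e) + q * ?e' / (1 - q * ?e')"
      by (rule ii)
    also have "\<dots> = (1 - q\<^sup>2) / (1 - 2 * q * cos (complex_of_real \<phi>) + q\<^sup>2)"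
    proof -
      have "((1 - q * ?e) * (1 - q * ?e') + q * ?e * (1 - q * ?e') + q * ?e' * (1 - q * ?e)) = 1 - q\<^sup>2"
        using ee by algebra
      moreover have "1 + q * ?e / (1 - q * ?e) + q * ?e' / (1 - q * ?e')
        = ((1 - q * ?e) * (1 - q * ?e') + q * ?e * (1 - q * ?e') + q * ?e' * (1 - q * ?e)) / ((1 - q * ?e) * (1 - q * ?e'))"
        using nn(2)[OF n(1)[of \<phi>]] nn(2)[OF n(2)[of \<phi>]] by (simp add: add_divide_distrib)
      ultimately show ?thesis unfolding den by simp
    qed
    finally have "(Q has_field_derivative (1 - q\<^sup>2) / (1 - 2 * q * cos (complex_of_real \<phi>) + q\<^sup>2)) (at (complex_of_real \<phi>))" .
    from has_vector_derivative_real_field[OF this]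
    show ?thesis by (simp add: P_def Q_def o_def)
  qed
  have "P pi = complex_of_real pi" "P 0 = 0"
    using exp_pi_i by (simp_all add: P_def exp_minus)
  with fundamental_theorem_of_calculus[OF pi_ge_zero deriv] show ?thesis by simp
qed

text \<open>With \<open>C = (q + 1 / q) / 2\<close>, dividing \<open>1 - cos^2\<close> by
  \<open>C - cos\<close> leaves \<open>C + cos - (C^2 - 1) / (C - cos)\<close>. The last term is a
  multiple of the Poisson kernel, since \<open>1 - 2 q cos + q^2 = 2 q (C - cos)\<close>.\<close>

lemma has_integral_sin_squared_kernel:
  fixes q :: complex
  assumes q: "cmod q < 1" "q \<noteq> 0"
  shows "((\<lambda>\<phi>. sin (complex_of_real \<phi>) ^ 2 / ((q + 1 / q) / 2 - cos (complex_of_real \<phi>))) has_integral pi * q) {0..pi}"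
proof -
  define C where "C = (q + 1 / q) / 2"
  have den: "1 - 2 * q * cos (complex_of_real \<phi>) + q\<^sup>2 = 2 * q * (C - cos (complex_of_real \<phi>))" for \<phi>
    using q by (simp add: C_def field_simps power2_eq_square)
  have nz: "C - cos (complex_of_real \<phi>) \<noteq> 0" for \<phi> :: real
  proof -
    let ?e = "exp (\<i> * complex_of_real \<phi>)" and ?e' = "exp (- (\<i> * complex_of_real \<phi>))"
    have ee: "?e * ?e' = 1" by (simp flip: exp_add)
    have c: "2 * cos (complex_of_real \<phi>) = ?e + ?e'" by (simp add: cos_exp_eq)
    have "1 - 2 * q * cos (complex_of_real \<phi>) + q\<^sup>2 = (1 - q * ?e) * (1 - q * ?e')"
      using ee c by algebra
    moreover have "1 - q * ?e \<noteq> 0" "1 - q * ?e' \<noteq> 0"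
      using q by (auto simp: norm_mult dest!: arg_cong[where f=cmod])
    ultimately show ?thesis using den by auto
  qed
  have 1: "((\<lambda>\<phi>. C + cos (complex_of_real \<phi>)) has_integral (C * pi + sin (complex_of_real pi)) - (C * complex_of_real 0 + sin (complex_of_real 0))) {0..pi}"
  proof (rule fundamental_theorem_of_calculus[OF pi_ge_zero])
    fix x :: real
    have "((\<lambda>z. C * z + sin z) has_field_derivative C + cos (complex_of_real x)) (at (complex_of_real x))"
      by (auto intro!: derivative_eq_intros)
    from has_vector_derivative_real_field[OF this]
    show "((\<lambda>x. C * complex_of_real x + sin (complex_of_real x)) has_vector_derivative C + cos (complex_of_real x)) (at x within {0..pi})"
      by (simp add: o_def)
  qed
  have 2: "((\<lambda>\<phi>. (1/q - q) / 2 * ((1 - q\<^sup>2) / (1 - 2 * q * cos (complex_of_real \<phi>) + q\<^sup>2))) has_integral (1/q - q) / 2 * pi) {0..pi}"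
    by (intro has_integral_mult_right has_integral_poisson_kernel q)
  have sp: "sin (complex_of_real pi) = 0" by (simp only: sin_of_real sin_pi of_real_0)
  have eq: "C + cos (complex_of_real \<phi>) - (1/q - q) / 2 * ((1 - q\<^sup>2) / (1 - 2 * q * cos (complex_of_real \<phi>) + q\<^sup>2))
    = sin (complex_of_real \<phi>) ^ 2 / (C - cos (complex_of_real \<phi>))" for \<phi>
  proof -
    have a: "(1/q - q) / 2 * (1 - q\<^sup>2) = 2 * q * (C\<^sup>2 - 1)"
      using q by (simp add: C_def field_simps power2_eq_square)
    have "(1/q - q) / 2 * ((1 - q\<^sup>2) / (1 - 2 * q * cos (complex_of_real \<phi>) + q\<^sup>2)) = (C\<^sup>2 - 1) / (C - cos (complex_of_real \<phi>))"
      unfolding times_divide_eq_right a den using q by simp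
    moreover have "C + cos (complex_of_real \<phi>) - (C\<^sup>2 - 1) / (C - cos (complex_of_real \<phi>)) = sin (complex_of_real \<phi>) ^ 2 / (C - cos (complex_of_real \<phi>))"
      using nz[of \<phi>] sin_cos_squared_add[of "complex_of_real \<phi>"]
      by (simp add: field_simps power2_eq_square)
    ultimately show ?thesis by simp
  qed
  have "((\<lambda>\<phi>. C + cos (complex_of_real \<phi>) - (1/q - q) / 2 * ((1 - q\<^sup>2) / (1 - 2 * q * cos (complex_of_real \<phi>) + q\<^sup>2))) has_integral
     ((C * pi + sin (complex_of_real pi)) - (C * complex_of_real 0 + sin (complex_of_real 0))) - (1/q - q) / 2 * pi) {0..pi}"
    by (rule has_integral_diff[OF 1 2])
  also have "((C * pi + sin (complex_of_real pi)) - (C * complex_of_real 0 + sin (complex_of_real 0))) - (1/q - q) / 2 * pi = pi * q"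
    unfolding sp by (simp add: C_def field_simps)
  finally show ?thesis unfolding eq unfolding C_def .
qed

text \<open>The Joukowski parameter \<open>q\<close> uniformises the square root in the Stieltjes transform of the semicircle.\<close>
lemma has_integral_semicircle_joukowski:
  fixes q z :: complex and m r :: real
  assumes q: "cmod q < 1" "q \<noteq> 0" and r: "r > 0" and z: "z = m + r / 2 * (q + 1 / q)"
    and nz: "\<And>x. x \<in> {m - r..m + r} \<Longrightarrow> z \<noteq> complex_of_real x"
  shows "((\<lambda>x. complex_of_real (sqrt (r\<^sup>2 - (x - m)\<^sup>2)) / (z - complex_of_real x)) has_integral pi * r * q) {m - r..m + r}"
proof -
  let ?f = "\<lambda>x. complex_of_real (sqrt (r\<^sup>2 - (x - m)\<^sup>2)) / (z - complex_of_real x)"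
  let ?g = "\<lambda>\<phi>. m - r * cos \<phi>"
  have cf: "continuous_on {m - r..m + r} ?f"
    using nz by (intro continuous_intros) auto
  have "((\<lambda>\<phi>. (r * sin \<phi>) *\<^sub>R ?f (?g \<phi>)) has_integral integral {?g 0..?g pi} ?f) {0..pi}"
  proof (rule has_integral_substitution[OF pi_ge_zero _ _ cf])
    show "?g 0 \<le> ?g pi" using r by simp
    show "?g ` {0..pi} \<subseteq> {m - r..m + r}"
    proof (clarsimp, intro conjI)
      fix \<phi> show "r * cos \<phi> \<le> r" "- (r * cos \<phi>) \<le> r"
        using r mult_left_mono[of "-1" "cos \<phi>" r] by (simp_all add: mult_left_le)
    qed
    show "(?g has_real_derivative r * sin x) (at x within {0..pi})" if "x \<in> {0..pi}" for x
      by (auto intro!: derivative_eq_intros)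
  qed
  moreover have "((\<lambda>\<phi>. (r * sin \<phi>) *\<^sub>R ?f (?g \<phi>)) has_integral r * (pi * q)) {0..pi}"
  proof -
    \<comment> \<open>The substitution \<open>x = m - r cos \<phi>\<close> is increasing, at the
      price of a sign: \<open>z - x\<close> is \<open>- r\<close> times
      \<open>C - cos \<phi>\<close> with \<open>C\<close> formed from \<open>- q\<close> in place of
      \<open>q\<close>.\<close>
    have q': "cmod (-q) < 1" "- q \<noteq> 0" using q by auto
    have "((\<lambda>\<phi>. - r * (sin (complex_of_real \<phi>) ^ 2 / ((-q + 1 / -q) / 2 - cos (complex_of_real \<phi>)))) has_integral - r * (pi * -q)) {0..pi}"
      by (intro has_integral_mult_right has_integral_sin_squared_kernel q')
    also have "complex_of_real (- r) * (pi * -q) = r * (pi * q)" by simp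
    finally show ?thesis
    proof (rule has_integral_eq[rotated])
      fix \<phi> assume "\<phi> \<in> {0..pi}"
      then have s: "sin \<phi> \<ge> 0" by (simp add: sin_ge_zero)
      have sq: "r\<^sup>2 - (?g \<phi> - m)\<^sup>2 = (r * sin \<phi>)\<^sup>2"
        by (simp add: power_mult_distrib sin_squared_eq algebra_simps)
      have d: "z - complex_of_real (?g \<phi>) = - r * ((-q + 1 / -q) / 2 - cos (complex_of_real \<phi>))"
        unfolding z by (simp add: field_simps cos_of_real)
      have "sqrt (r\<^sup>2 - (?g \<phi> - m)\<^sup>2) = r * sin \<phi>"
        unfolding sq using s r by simp
      then have "(r * sin \<phi>) *\<^sub>R ?f (?g \<phi>) = complex_of_real (r * sin \<phi>) * complex_of_real (r * sin \<phi>) / (- r * ((-q + 1 / -q) / 2 - cos (complex_of_real \<phi>)))"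
        unfolding d by (simp add: scaleR_conv_of_real)
      also have "\<dots> = - r * (sin (complex_of_real \<phi>) ^ 2 / ((-q + 1 / -q) / 2 - cos (complex_of_real \<phi>)))"
        using r unfolding of_real_mult sin_of_real[symmetric] power2_eq_square
        by (simp add: divide_simps)
      finally show "- r * (sin (complex_of_real \<phi>) ^ 2 / ((-q + 1 / -q) / 2 - cos (complex_of_real \<phi>))) = (r * sin \<phi>) *\<^sub>R ?f (?g \<phi>)" ..
    qed
  qed
  ultimately have "integral {?g 0..?g pi} ?f = r * (pi * q)"
    by (rule has_integral_unique)
  then have "integral {m - r..m + r} ?f = pi * r * q" by (simp add: mult_ac)
  with integrable_continuous_real[OF cf] show ?thesis
    by (simp add: has_integral_iff)
qed

text \<open>The solutions of \<open>v^2 - 2 w v + 1 = 0\<close> have product 1, so one of them lies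
  in the open unit disc unless both have modulus 1; in that case \<open>1 / v\<close> is the
  conjugate of \<open>v\<close> and \<open>w = Re v\<close> is in the excluded interval.\<close>

lemma joukowski_exists:
  fixes w :: complex
  assumes "w \<notin> complex_of_real ` {-1..1}"
  obtains q where "cmod q < 1" "q \<noteq> 0" "w = (q + 1 / q) / 2"
proof -
  define v where "v = w + csqrt (w\<^sup>2 - 1)"
  have v: "v\<^sup>2 - 2 * w * v + 1 = 0"
    using power2_csqrt[of "w\<^sup>2 - 1"] unfolding v_def by algebra
  then have v0: "v \<noteq> 0" by auto
  have vw: "w = (v + 1 / v) / 2" using v v0 by (simp add: field_simps power2_eq_square)
  have n: "cmod v \<noteq> 1"
  proof
    assume "cmod v = 1"
    then have "1 / v = cnj v" using complex_div_cnj[of 1 v] by simp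
    then have "w = complex_of_real (Re v)" using vw complex_add_cnj[of v] by simp
    moreover have "Re v \<in> {-1..1}" using abs_Re_le_cmod[of v] \<open>cmod v = 1\<close> by auto
    ultimately show False using assms by auto
  qed
  show thesis
  proof (cases "cmod v < 1")
    case True then show ?thesis using that v0 vw by blast
  next
    case False
    with n have "cmod (1 / v) < 1" using v0 by (simp add: norm_divide divide_simps)
    moreover have "w = (1 / v + 1 / (1 / v)) / 2" using vw by (simp add: add.commute)
    ultimately show ?thesis using that v0 by (metis divide_eq_0_iff zero_neq_one)
  qed
qed

text \<open>The truncation is essential: \<open>sqrt\<close> is an odd function here, so without
  \<open>max 0\<close> the values off the interval would be negative instead of 0.\<close>

definition semicircle :: "real \<Rightarrow> real \<Rightarrow> real \<Rightarrow> real" where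
  "semicircle m r x = sqrt (max 0 (r\<^sup>2 - (x - m)\<^sup>2))"

lemma semicircle_measurable [measurable]: "semicircle m r \<in> borel_measurable borel"
  unfolding semicircle_def by measurable

lemma semicircle_nonneg: "semicircle m r x \<ge> 0"
  by (simp add: semicircle_def)

lemma semicircle_le: "r \<ge> 0 \<Longrightarrow> semicircle m r x \<le> r"
  unfolding semicircle_def by (rule real_le_lsqrt) auto

lemma semicircle_inside: "x \<in> {m - r..m + r} \<Longrightarrow> semicircle m r x = sqrt (r\<^sup>2 - (x - m)\<^sup>2)"
  by (simp add: semicircle_def abs_le_square_iff[symmetric] max_def abs_le_iff)

lemma semicircle_outside: "r \<ge> 0 \<Longrightarrow> x \<notin> {m - r<..<m + r} \<Longrightarrow> semicircle m r x = 0"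
proof -
  assume "r \<ge> 0" "x \<notin> {m - r<..<m + r}"
  then have "\<bar>r\<bar> \<le> \<bar>x - m\<bar>" by auto
  then have "r\<^sup>2 \<le> (x - m)\<^sup>2" by (simp only: abs_le_square_iff)
  then show ?thesis by (simp add: semicircle_def)
qed

lemma has_bochner_integral_semicircle_joukowski:
  fixes q z :: complex and m r :: real
  assumes q: "cmod q < 1" "q \<noteq> 0" and r: "r > 0" and z: "z = m + r / 2 * (q + 1 / q)"
    and nz: "\<And>x. x \<in> {m - r..m + r} \<Longrightarrow> z \<noteq> complex_of_real x"
  shows "has_bochner_integral lborel (\<lambda>x. complex_of_real (semicircle m r x) / (z - complex_of_real x)) (pi * r * q)"
proof -
  let ?f = "\<lambda>x. complex_of_real (sqrt (r\<^sup>2 - (x - m)\<^sup>2)) / (z - complex_of_real x)"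
  have cf: "continuous_on {m - r..m + r} ?f"
    using nz by (intro continuous_intros) auto
  have si: "set_integrable lborel {m - r..m + r} ?f"
    by (rule borel_integrable_atLeastAtMost'[OF cf])
  have "(LINT x:{m - r..m + r}|lborel. ?f x) = pi * r * q"
    using set_borel_integral_eq_integral(2)[OF si] has_integral_semicircle_joukowski[OF q r z nz]
    by (simp add: has_integral_iff)
  with si have "has_bochner_integral lborel (\<lambda>x. indicator {m - r..m + r} x *\<^sub>R ?f x) (pi * r * q)"
    by (simp add: has_bochner_integral_iff set_integrable_def set_lebesgue_integral_def)
  also have "(\<lambda>x. indicator {m - r..m + r} x *\<^sub>R ?f x) = (\<lambda>x. complex_of_real (semicircle m r x) / (z - complex_of_real x))"
  proof (rule ext)
    fix x show "indicator {m - r..m + r} x *\<^sub>R ?f x = complex_of_real (semicircle m r x) / (z - complex_of_real x)"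
      using semicircle_inside[of x m r] semicircle_outside[of r x m] r
      by (cases "x \<in> {m - r..m + r}") auto
  qed
  finally show ?thesis .
qed

definition semicircle_transform :: "real \<Rightarrow> real \<Rightarrow> complex \<Rightarrow> complex" where
  "semicircle_transform m r z = (\<integral>x. complex_of_real (semicircle m r x) / (z - complex_of_real x) \<partial>lborel)"

text \<open>In the Joukowski parameter the transform divided by pi is \<open>r q\<close>, so
  subtracting \<open>z - m = r / 2 (q + 1 / q)\<close> leaves \<open>r / 2 (q - 1 / q)\<close>,
  whose square is explicit. The sign statement selects the branch of the root: for
  \<open>cmod q < 1\<close> the real parts of \<open>q - 1 / q\<close> and \<open>q + 1 / q\<close>
  cannot both be of the same strict sign.\<close>

lemma semicircle_transform:
  fixes z :: complex
  assumes r: "r > 0" and nz: "\<And>x. x \<in> {m - r..m + r} \<Longrightarrow> z \<noteq> complex_of_real x"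
  shows "integrable lborel (\<lambda>x. complex_of_real (semicircle m r x) / (z - complex_of_real x))"
    and "(semicircle_transform m r z / pi - (z - m))\<^sup>2 = (z - m)\<^sup>2 - (complex_of_real r)\<^sup>2"
    and "Re (semicircle_transform m r z / pi - (z - m)) * Re (z - m) \<le> 0"
proof -
  have "(z - m) / r \<notin> complex_of_real ` {-1..1}"
  proof
    assume "(z - m) / r \<in> complex_of_real ` {-1..1}"
    then obtain y where y: "(z - m) / r = complex_of_real y" "-1 \<le> y" "y \<le> 1" by auto
    then have "z = complex_of_real (m + r * y)" using r by (simp add: field_simps)
    moreover have "m + r * y \<in> {m - r..m + r}"
      using y r mult_left_mono[of "-1" y r] by (auto simp: mult_left_le)
    ultimately show False using nz by blast
  qed
  then obtain q where q: "cmod q < 1" "q \<noteq> 0" and w: "(z - m) / r = (q + 1 / q) / 2"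
    by (rule joukowski_exists)
  have z: "z = m + r / 2 * (q + 1 / q)" using w r by (simp add: field_simps)
  note I = has_bochner_integral_semicircle_joukowski[OF q r z nz]
  then show "integrable lborel (\<lambda>x. complex_of_real (semicircle m r x) / (z - complex_of_real x))"
    by (simp add: has_bochner_integral_iff)
  have Jq: "semicircle_transform m r z / pi = r * q"
    using I by (simp add: semicircle_transform_def has_bochner_integral_iff)
  then show "(semicircle_transform m r z / pi - (z - m))\<^sup>2 = (z - m)\<^sup>2 - (complex_of_real r)\<^sup>2"
    using q unfolding z by (simp add: field_simps power2_eq_square)
  have zm: "z - m = complex_of_real (r / 2) * (q + 1 / q)" unfolding z by simp
  have J: "semicircle_transform m r z / pi - (z - m) = complex_of_real (r / 2) * (q - 1 / q)"
    unfolding zm Jq by (simp add: algebra_simps)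
  \<comment> \<open>\<open>Re (1 / q)\<close> is \<open>k\<close> times \<open>Re q\<close>, and
    \<open>k \<ge> 1\<close> is what \<open>cmod q < 1\<close> contributes.\<close>
  define k where "k = 1 / (cmod q)\<^sup>2"
  have k: "k \<ge> 1" using q by (simp add: k_def power_le_one)
  have Rq: "Re (1 / q) = Re q * k" by (simp add: k_def Re_divide cmod_power2)
  have "Re (complex_of_real (r / 2) * (q - 1 / q)) * Re (complex_of_real (r / 2) * (q + 1 / q))
    = - ((r / 2 * Re q)\<^sup>2 * ((k - 1) * (k + 1)))"
  proof -
    have "Re (complex_of_real a * w) = a * Re w" for a w by simp
    moreover have "a * (x - x * k) * (a * (x + x * k)) = - ((a * x)\<^sup>2 * ((k - 1) * (k + 1)))" for a x k :: real
      by (simp add: power2_eq_square algebra_simps)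
    ultimately show ?thesis by (simp only: Rq minus_complex.sel plus_complex.sel)
  qed
  also have "\<dots> \<le> 0" using k by simp
  finally show "Re (semicircle_transform m r z / pi - (z - m)) * Re (z - m) \<le> 0"
    unfolding J unfolding zm .
qed

lemma joukowski_real:
  fixes u :: real
  assumes "u > 1"
  defines "q \<equiv> u - sqrt (u\<^sup>2 - 1)"
  shows "0 < q" "q < 1" "(q + 1 / q) / 2 = u"
proof -
  have u2: "u\<^sup>2 > 1" using assms(1) by (simp add: one_less_power)
  have sq: "(sqrt (u\<^sup>2 - 1))\<^sup>2 = u\<^sup>2 - 1" using u2 by simp
  have "sqrt (u\<^sup>2 - 1) < u" using assms(1) by (intro real_less_lsqrt) auto
  then show 0: "0 < q" by (simp add: q_def)
  have "(u - 1)\<^sup>2 < u\<^sup>2 - 1" using assms(1) by (simp add: power2_eq_square algebra_simps)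
  then have "u - 1 < sqrt (u\<^sup>2 - 1)" by (rule real_less_rsqrt)
  then show "q < 1" by (simp add: q_def)
  have "q\<^sup>2 + 1 = 2 * u * q" using sq unfolding q_def by algebra
  then show "(q + 1 / q) / 2 = u" using 0 by (simp add: field_simps power2_eq_square)
qed

lemma sqrt_scale_sub: "r > 0 \<Longrightarrow> r * sqrt ((v / r)\<^sup>2 - 1) = sqrt (v\<^sup>2 - r\<^sup>2)" for r v :: real
proof -
  assume r: "r > 0"
  have "sqrt (v\<^sup>2 - r\<^sup>2) = sqrt (r\<^sup>2 * ((v / r)\<^sup>2 - 1))"
    using r by (simp add: right_diff_distrib power_divide)
  also have "\<dots> = r * sqrt ((v / r)\<^sup>2 - 1)" using r by (simp add: real_sqrt_mult)
  finally show ?thesis ..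
qed

lemma semicircle_transform_right:
  assumes r: "r > 0" and p: "p > m + r"
  shows "has_bochner_integral lborel (\<lambda>x. semicircle m r x / (p - x)) (pi * ((p - m) - sqrt ((p - m)\<^sup>2 - r\<^sup>2)))"
proof -
  define u where "u = (p - m) / r"
  have u: "u > 1" using r p by (simp add: u_def)
  define q where "q = u - sqrt (u\<^sup>2 - 1)"
  note q = joukowski_real[OF u, folded q_def]
  have "p = m + r / 2 * (q + 1 / q)" using q(3) r by (simp add: u_def field_simps)
  then have z: "complex_of_real p = m + r / 2 * (complex_of_real q + 1 / complex_of_real q)"
    by (metis of_real_add of_real_divide of_real_mult of_real_1 of_real_numeral)
  have "has_bochner_integral lborel (\<lambda>x. complex_of_real (semicircle m r x) / (complex_of_real p - complex_of_real x)) (pi * r * complex_of_real q)"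
    by (rule has_bochner_integral_semicircle_joukowski[OF _ _ r z]) (use q p in auto)
  then have "has_bochner_integral lborel (\<lambda>x. complex_of_real (semicircle m r x / (p - x))) (complex_of_real (pi * r * q))"
    by simp
  then have "has_bochner_integral lborel (\<lambda>x. semicircle m r x / (p - x)) (pi * r * q)"
    unfolding has_bochner_integral_iff complex_of_real_integrable_eq integral_complex_of_real of_real_eq_iff .
  also have "pi * r * q = pi * ((p - m) - sqrt ((p - m)\<^sup>2 - r\<^sup>2))"
  proof -
    have "pi * r * q = pi * (r * u - r * sqrt (u\<^sup>2 - 1))"
      by (simp only: q_def right_diff_distrib mult.assoc)
    moreover have "r * u = p - m" using r by (simp add: u_def)
    ultimately show ?thesis using sqrt_scale_sub[OF r, of "p - m"] by (simp only: u_def)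
  qed
  finally show ?thesis .
qed

lemma has_bochner_integral_monotone_convergence:
  fixes f :: "nat \<Rightarrow> 'a \<Rightarrow> real"
  assumes f: "\<And>n. integrable M (f n)" "\<And>x. mono (\<lambda>n. f n x)"
    and lim: "\<And>x. (\<lambda>n. f n x) \<longlonglongrightarrow> g x" "(\<lambda>n. integral\<^sup>L M (f n)) \<longlonglongrightarrow> c"
    and g: "g \<in> borel_measurable M"
  shows "has_bochner_integral M g c"
  unfolding has_bochner_integral_iff
  by (intro conjI integrable_monotone_convergence[OF f(1) _ _ lim(2) g]
      integral_monotone_convergence[OF f(1) _ _ lim(2) g] AE_I2 f lim)

lemma semicircle_reflect: "semicircle (-m) r (- x) = semicircle m r x"
  by (simp add: semicircle_def power2_commute add.commute)

lemma semicircle_transform_left_strict: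
  assumes r: "r > 0" and p: "p < m - r"
  shows "has_bochner_integral lborel (\<lambda>x. semicircle m r x / (x - p)) (pi * ((m - p) - sqrt ((m - p)\<^sup>2 - r\<^sup>2)))"
proof -
  have "has_bochner_integral lborel (\<lambda>x. semicircle (-m) r x / (- p - x)) (pi * ((- p - (-m)) - sqrt ((- p - (-m))\<^sup>2 - r\<^sup>2)))"
    by (rule semicircle_transform_right) (use r p in auto)
  from lborel_has_bochner_integral_real_affine_iff[of "-1", THEN iffD1, OF _ this, of 0]
  have "has_bochner_integral lborel (\<lambda>x. semicircle (-m) r (- x) / (- p - (- x))) (pi * ((- p - (-m)) - sqrt ((- p - (-m))\<^sup>2 - r\<^sup>2)))"
    by simp
  then show ?thesis
    by (simp add: semicircle_reflect)
qed

text \<open>The endpoint \<open>p = m - r\<close> is reached by monotone convergence from the left.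
  It is required for the Marchenko-Pastur density with \<open>lam = 1\<close>, whose support touches
  0.\<close>

lemma semicircle_transform_left:
  assumes r: "r > 0" and p: "p \<le> m - r"
  shows "has_bochner_integral lborel (\<lambda>x. semicircle m r x / (x - p)) (pi * ((m - p) - sqrt ((m - p)\<^sup>2 - r\<^sup>2)))"
proof -
  define p' where "p' = (\<lambda>n. p - 1 / real (Suc n))"
  have p'_less: "p' n < m - r" "p' n < p" for n
  proof -
    have "1 / real (Suc n) > 0" by simp
    then show "p' n < m - r" "p' n < p" using p unfolding p'_def by linarith+
  qed
  have p'_mono: "p' k \<le> p' n" if "k \<le> n" for k n
    using that by (simp add: p'_def frac_le)
  have p'_lim: "p' \<longlonglongrightarrow> p"
    unfolding p'_def using tendsto_diff[OF tendsto_const LIMSEQ_inverse_real_of_nat, of p]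
    by (simp add: inverse_eq_divide)
  note I = semicircle_transform_left_strict[OF r p'_less(1)]
  let ?f = "\<lambda>n x. semicircle m r x / (x - p' n)"
  have mono: "mono (\<lambda>n. ?f n x)" for x
  proof (intro monoI)
    fix k n :: nat assume "k \<le> n"
    show "?f k x \<le> ?f n x"
    proof (cases "x > p")
      case True
      then show ?thesis using p'_mono[OF \<open>k \<le> n\<close>] p'_less(2)[of k] p'_less(2)[of n] semicircle_nonneg[of m r x]
        by (intro divide_left_mono mult_pos_pos) auto
    next
      case False
      then show ?thesis using semicircle_outside[of r x m] p r by auto
    qed
  qed
  have lim: "(\<lambda>n. ?f n x) \<longlonglongrightarrow> semicircle m r x / (x - p)" for x
  proof (cases "x > p")
    case True
    then show ?thesis by (intro tendsto_intros p'_lim) auto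
  next
    case False
    then show ?thesis using semicircle_outside[of r x m] p r by auto
  qed
  have lim2: "(\<lambda>n. integral\<^sup>L lborel (?f n)) \<longlonglongrightarrow> pi * ((m - p) - sqrt ((m - p)\<^sup>2 - r\<^sup>2))"
    using I by (auto simp: has_bochner_integral_iff intro!: tendsto_intros p'_lim)
  have "integrable lborel (?f n)" for n using I by (auto simp: has_bochner_integral_iff)
  from has_bochner_integral_monotone_convergence[OF this mono lim lim2]
  show ?thesis by simp
qed

text \<open>For \<open>s > 0\<close> this is a partial fraction decomposition into two transforms,
  at 0 and at \<open>- s\<close>. The difference quotient of the two roots is rationalised so that
  the value stays meaningful at \<open>s = 0\<close>, the case \<open>lam = 1\<close>, which follows
  by monotone convergence.\<close>

lemma semicircle_double_transform:
  assumes r: "r > 0" and mr: "m - r > 0" and s: "s \<ge> 0"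
  shows "has_bochner_integral lborel (\<lambda>x. semicircle m r x / (x * (x + s)))
    (pi * ((2 * m + s) / (sqrt ((m + s)\<^sup>2 - r\<^sup>2) + sqrt (m\<^sup>2 - r\<^sup>2)) - 1))"
proof -
  define c where "c = (\<lambda>s. pi * ((2 * m + s) / (sqrt ((m + s)\<^sup>2 - r\<^sup>2) + sqrt (m\<^sup>2 - r\<^sup>2)) - 1))"
  have g0: "sqrt (m\<^sup>2 - r\<^sup>2) > 0" using r mr by (simp add: power_strict_mono)
  have gs: "sqrt ((m + s)\<^sup>2 - r\<^sup>2) > 0" if "s \<ge> 0" for s
    using r mr that by (simp add: power_strict_mono)
  have strict: "has_bochner_integral lborel (\<lambda>x. semicircle m r x / (x * (x + s))) (c s)" if s: "s > 0" for s
  proof -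
    have A: "has_bochner_integral lborel (\<lambda>x. semicircle m r x / (x - 0)) (pi * ((m - 0) - sqrt ((m - 0)\<^sup>2 - r\<^sup>2)))"
      by (rule semicircle_transform_left) (use r mr in auto)
    have B: "has_bochner_integral lborel (\<lambda>x. semicircle m r x / (x - (-s))) (pi * ((m - (-s)) - sqrt ((m - (-s))\<^sup>2 - r\<^sup>2)))"
      by (rule semicircle_transform_left) (use r mr s in auto)
    have "has_bochner_integral lborel (\<lambda>x. (semicircle m r x / (x - 0) - semicircle m r x / (x - (-s))) / s)
      ((pi * ((m - 0) - sqrt ((m - 0)\<^sup>2 - r\<^sup>2)) - pi * ((m - (-s)) - sqrt ((m - (-s))\<^sup>2 - r\<^sup>2))) / s)"
      by (intro has_bochner_integral_divide_zero has_bochner_integral_diff A B)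
    also have "(\<lambda>x. (semicircle m r x / (x - 0) - semicircle m r x / (x - (-s))) / s) = (\<lambda>x. semicircle m r x / (x * (x + s)))"
    proof (rule ext)
      fix x
      show "(semicircle m r x / (x - 0) - semicircle m r x / (x - (-s))) / s = semicircle m r x / (x * (x + s))"
      proof (cases "x > 0")
        case True
        then have "x \<noteq> 0" "x + s \<noteq> 0" using s by auto
        then have "1 / x - 1 / (x + s) = s / (x * (x + s))" by (simp add: field_simps)
        then have "semicircle m r x * (1 / x - 1 / (x + s)) / s = semicircle m r x / (x * (x + s))"
          using s by simp
        then show ?thesis by (simp add: right_diff_distrib)
      next
        case False
        then show ?thesis using semicircle_outside[of r x m] r mr by simp
      qed
    qed
    also have "(pi * ((m - 0) - sqrt ((m - 0)\<^sup>2 - r\<^sup>2)) - pi * ((m - (-s)) - sqrt ((m - (-s))\<^sup>2 - r\<^sup>2))) / s = c s"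
    proof -
      define a where "a = sqrt ((m + s)\<^sup>2 - r\<^sup>2)"
      define b where "b = sqrt (m\<^sup>2 - r\<^sup>2)"
      have ab: "a > 0" "b > 0" using g0 gs[of s] s by (auto simp: a_def b_def)
      have "a\<^sup>2 = (m + s)\<^sup>2 - r\<^sup>2" "b\<^sup>2 = m\<^sup>2 - r\<^sup>2"
        using g0 gs[of s] s by (auto simp: a_def b_def)
      then have "(a - b) * (a + b) = s * (2 * m + s)" by (simp add: power2_eq_square algebra_simps)
      then have eq: "(2 * m + s) / (a + b) = (a - b) / s" using ab s by (simp add: field_simps)
      have "c s = pi * ((a - b) / s - 1)"
        unfolding c_def a_def[symmetric] b_def[symmetric] eq ..
      then show ?thesis
        using s by (simp add: a_def[symmetric] b_def[symmetric] field_simps)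
    qed
    finally show ?thesis .
  qed
  have "has_bochner_integral lborel (\<lambda>x. semicircle m r x / (x * (x + s))) (c s)"
  proof (cases "s = 0")
    case False with s strict show ?thesis by simp
  next
    case True
    define e where "e = (\<lambda>n. 1 / real (Suc n))"
    have e_pos: "e n > 0" for n by (simp add: e_def)
    have e_mono: "e n \<le> e k" if "k \<le> n" for k n using that by (simp add: e_def frac_le)
    have e_lim: "e \<longlonglongrightarrow> 0" unfolding e_def
      using LIMSEQ_inverse_real_of_nat by (simp add: inverse_eq_divide)
    let ?f = "\<lambda>n x. semicircle m r x / (x * (x + e n))"
    have mono: "mono (\<lambda>n. ?f n x)" for x
    proof (intro monoI)
      fix k n :: nat assume "k \<le> n"
      show "?f k x \<le> ?f n x"
      proof (cases "x > 0")
        case True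
        then show ?thesis using e_mono[OF \<open>k \<le> n\<close>] e_pos[of k] e_pos[of n] semicircle_nonneg[of m r x]
          by (intro divide_left_mono mult_pos_pos mult_left_mono) (auto intro!: mult_pos_pos add_pos_pos)
      next
        case False
        then show ?thesis using semicircle_outside[of r x m] r mr by simp
      qed
    qed
    have lim: "(\<lambda>n. ?f n x) \<longlonglongrightarrow> semicircle m r x / (x * (x + 0))" for x
    proof (cases "x > 0")
      case True
      then show ?thesis by (intro tendsto_intros e_lim) auto
    next
      case False
      then show ?thesis using semicircle_outside[of r x m] r mr by simp
    qed
    have "(\<lambda>n. c (e n)) \<longlonglongrightarrow> c 0"
      unfolding c_def using g0 gs[of 0] by (intro tendsto_intros e_lim) auto
    then have lim2: "(\<lambda>n. integral\<^sup>L lborel (?f n)) \<longlonglongrightarrow> c 0"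
      using strict[OF e_pos] by (simp add: has_bochner_integral_iff)
    have "integrable lborel (?f n)" for n using strict[OF e_pos] by (simp add: has_bochner_integral_iff)
    from has_bochner_integral_monotone_convergence[OF this mono lim lim2]
    show ?thesis using True by simp
  qed
  then show ?thesis by (simp add: c_def)
qed

section \<open>Cauchy transforms near infinity\<close>

text \<open>Only the height tends to infinity. A truncated cone of height \<open>\<beta>\<close>
  lies in \<open>Im z > \<beta>\<close>, so whatever holds eventually here holds on all high enough
  cones, and bounded perturbations of the identity preserve the filter.\<close>

definition Im_at_top :: "complex filter" where
  "Im_at_top = filtercomap Im at_top"

lemma eventually_Im_at_top: "eventually P Im_at_top \<longleftrightarrow> (\<exists>\<rho>. \<forall>z. Im z > \<rho> \<longrightarrow> P z)"
  unfolding Im_at_top_def by (rule eventually_filtercomap_at_top_dense)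

lemma filterlim_Im_Im_at_top: "filterlim Im at_top Im_at_top"
  unfolding Im_at_top_def by (rule filterlim_filtercomap)

lemma filterlim_Im_at_top: "filterlim f Im_at_top F \<longleftrightarrow> filterlim (\<lambda>x. Im (f x)) at_top F"
  unfolding Im_at_top_def by (simp add: filterlim_filtercomap_iff o_def)

lemma filterlim_cmod_Im_at_top: "filterlim cmod at_top Im_at_top"
proof (rule filterlim_at_top_mono)
  show "filterlim Im at_top Im_at_top" by (rule filterlim_Im_Im_at_top)
  show "\<forall>\<^sub>F x in Im_at_top. Im x \<le> cmod x"
    using abs_Im_le_cmod by (intro always_eventually allI) (metis abs_le_D1)
qed

lemma tendsto_inverse_Im_at_top: "((\<lambda>z. 1 / z) \<longlongrightarrow> 0) Im_at_top"
proof (rule tendsto_norm_zero_cancel)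
  have "((\<lambda>z. inverse (cmod z)) \<longlongrightarrow> 0) Im_at_top"
    by (rule tendsto_inverse_0_at_top[OF filterlim_cmod_Im_at_top])
  then show "((\<lambda>z. norm (1 / z)) \<longlongrightarrow> 0) Im_at_top"
    by (simp add: norm_divide inverse_eq_divide)
qed

lemma Im_at_top_perturb:
  assumes "\<forall>\<^sub>F z in Im_at_top. cmod (f z - z) \<le> C"
  shows "filterlim f Im_at_top Im_at_top"
  unfolding filterlim_Im_at_top
proof (rule filterlim_at_top_mono)
  show "filterlim (\<lambda>z. - C + Im z) at_top Im_at_top"
    by (rule filterlim_tendsto_add_at_top[OF tendsto_const filterlim_Im_Im_at_top])
  show "\<forall>\<^sub>F z in Im_at_top. - C + Im z \<le> Im (f z)"
    using assms
  proof eventually_elim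
    case (elim z) then show ?case using abs_Im_le_cmod[of "f z - z"] by simp
  qed
qed

text \<open>\<open>z (z G - 1)\<close> is the integral of \<open>z x / (z - x)\<close>, and
  \<open>z - x\<close> is at least half of \<open>z\<close> in modulus once
  \<open>cmod z \<ge> 2 * R\<close>. The third estimate, stronger than the first limit, keeps
  \<open>reciprocal_F\<close> at bounded distance from the identity.\<close>

lemma cauchy_G_asymptotics:
  assumes L: "real_distribution L" and R: "R > 0" and supp: "AE x in L. \<bar>x\<bar> \<le> R"
  shows "((\<lambda>z. z * cauchy_G L z) \<longlongrightarrow> 1) Im_at_top"
    and "(cauchy_G L \<longlongrightarrow> 0) Im_at_top"
    and "\<forall>\<^sub>F z in Im_at_top. cmod (z * (z * cauchy_G L z - 1)) \<le> 2 * R"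
proof -
  interpret L: real_distribution L by fact
  note [measurable_cong] = L.events_eq_borel
  have bound: "cmod (z * (z * cauchy_G L z - 1)) \<le> 2 * R" if z: "Im z > 0" "cmod z \<ge> 2 * R" for z
  proof -
    have nz: "z - complex_of_real x \<noteq> 0" for x using z by (auto simp: complex_eq_iff)
    have i: "integrable L (\<lambda>x. 1 / (z - complex_of_real x))" by (rule integrable_cauchy_G[OF L z(1)])
    have "z * (z * cauchy_G L z - 1) = z * (\<integral>x. z * (1 / (z - complex_of_real x)) - 1 \<partial>L)"
      unfolding cauchy_G_def
      using Bochner_Integration.integral_diff[OF integrable_mult_right[OF i] L.integrable_const, of z 1] L.prob_space
      by (simp only: integral_mult_right_zero) simp
    also have "\<dots> = (\<integral>x. z * (z * (1 / (z - complex_of_real x)) - 1) \<partial>L)" by simp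
    finally have eq: "z * (z * cauchy_G L z - 1) = (\<integral>x. z * (z * (1 / (z - complex_of_real x)) - 1) \<partial>L)" .
    have "cmod (\<integral>x. z * (z * (1 / (z - complex_of_real x)) - 1) \<partial>L) \<le> (\<integral>x. cmod (z * (z * (1 / (z - complex_of_real x)) - 1)) \<partial>L)"
      by (rule integral_norm_bound)
    also have "\<dots> \<le> (\<integral>x. 2 * R \<partial>L)"
    proof (rule integral_mono_AE)
      show "integrable L (\<lambda>x. cmod (z * (z * (1 / (z - complex_of_real x)) - 1)))"
        by (intro integrable_norm integrable_mult_right Bochner_Integration.integrable_diff L.integrable_const i)
      show "AE x in L. cmod (z * (z * (1 / (z - complex_of_real x)) - 1)) \<le> 2 * R"
        using supp
      proof eventually_elim
        case (elim x)
        have "z * (z * (1 / (z - complex_of_real x)) - 1) = z * complex_of_real x / (z - complex_of_real x)"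
          using nz[of x] by (simp add: field_simps)
        then have "cmod (z * (z * (1 / (z - complex_of_real x)) - 1)) = cmod z * \<bar>x\<bar> / cmod (z - complex_of_real x)"
          by (simp add: norm_divide norm_mult)
        also have "\<dots> \<le> cmod z * R / (cmod z / 2)"
        proof (intro frac_le mult_left_mono)
          have "cmod z - \<bar>x\<bar> \<le> cmod (z - complex_of_real x)"
            using norm_triangle_ineq2[of z "complex_of_real x"] by simp
          then show "cmod z / 2 \<le> cmod (z - complex_of_real x)" using elim z by linarith
        qed (use elim z R in auto)
        also have "\<dots> = 2 * R" using z R by auto
        finally show ?case .
      qed
    qed simp
    also have "(\<integral>x. 2 * R \<partial>L) = 2 * R" using L.prob_space by simp
    finally show ?thesis by (simp only: eq)
  qed
  show ev: "\<forall>\<^sub>F z in Im_at_top. cmod (z * (z * cauchy_G L z - 1)) \<le> 2 * R"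
    unfolding eventually_Im_at_top
  proof (intro exI[of _ "2 * R"] allI impI bound)
    fix z :: complex assume "2 * R < Im z"
    then show "Im z > 0" "cmod z \<ge> 2 * R" using R abs_Im_le_cmod[of z] by auto
  qed
  have nz: "\<forall>\<^sub>F z in Im_at_top. z \<noteq> 0"
    unfolding eventually_Im_at_top by (rule exI[of _ 0]) auto
  have "((\<lambda>z. z * cauchy_G L z - 1) \<longlongrightarrow> 0) Im_at_top"
  proof (rule Lim_null_comparison)
    show "((\<lambda>z. 2 * R * norm (1 / z)) \<longlongrightarrow> 0) Im_at_top"
      using tendsto_mult_right_zero[OF tendsto_norm_zero[OF tendsto_inverse_Im_at_top]] .
    show "\<forall>\<^sub>F z in Im_at_top. norm (z * cauchy_G L z - 1) \<le> 2 * R * norm (1 / z)"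
      using ev nz
    proof eventually_elim
      fix z :: complex assume "cmod (z * (z * cauchy_G L z - 1)) \<le> 2 * R" "z \<noteq> 0"
      then show "norm (z * cauchy_G L z - 1) \<le> 2 * R * norm (1 / z)"
        unfolding norm_mult[of z "_ - _"] norm_divide norm_one
        by (simp add: pos_le_divide_eq mult.commute)
    qed
  qed
  then show lim: "((\<lambda>z. z * cauchy_G L z) \<longlongrightarrow> 1) Im_at_top"
    by (rule LIM_zero_cancel)
  have "((\<lambda>z. (z * cauchy_G L z) * (1 / z)) \<longlongrightarrow> 1 * 0) Im_at_top"
    by (intro tendsto_mult lim tendsto_inverse_Im_at_top)
  moreover have "\<forall>\<^sub>F z in Im_at_top. z * cauchy_G L z * (1 / z) = cauchy_G L z"
    using nz by eventually_elim simp
  ultimately show "(cauchy_G L \<longlongrightarrow> 0) Im_at_top"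
    using Lim_transform_eventually[of "\<lambda>z. z * cauchy_G L z * (1 / z)" "1 * 0" Im_at_top] by simp
qed

section \<open>Parameters and the candidate measure\<close>

locale free_beta_prime =
  fixes t \<theta> lam :: real
  assumes t: "t > 0" and \<theta>: "\<theta> > 0" and lam1: "1 \<le> lam" and lam_less: "lam < 1 + t / \<theta>"
begin

definition "m = t + \<theta> + \<theta> * lam"
definition "r = 2 * sqrt (\<theta> * lam * (t + \<theta>))"
definition "s = t * (lam - 1)"
text \<open>The constant term of the linear coefficient \<open>(2 \<theta> + t) z + c\<close> in the
  quadratic equation of the Cauchy transform; it is \<open>- t\<close> times the positive quantity
  of \<open>gap\<close>.\<close>

definition "c = t * \<theta> * (lam - 1) - t\<^sup>2"

lemma s_nonneg: "s \<ge> 0" using t lam1 by (simp add: s_def)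

lemma gap: "t - \<theta> * (lam - 1) > 0"
  using lam_less \<theta> by (simp add: field_simps)

lemma r_pos: "r > 0" using t \<theta> lam1 by (simp add: r_def)

lemma r_sq: "r\<^sup>2 = 4 * (\<theta> * lam * (t + \<theta>))"
  using t \<theta> lam1 by (simp add: r_def power_mult_distrib)

lemma m_pos: "m > 0" using t \<theta> lam1 by (simp add: m_def add_pos_pos)

text \<open>At 0 and \<open>- s\<close>, the zeros of the leading coefficient of the quadratic, the
  discriminant is the square of the linear coefficient. This is why the square roots disappear here
  and in \<open>mrs\<close>.\<close>

lemma mr0: "m\<^sup>2 - r\<^sup>2 = (t - \<theta> * (lam - 1))\<^sup>2"
  unfolding r_sq m_def by (simp add: power2_eq_square algebra_simps)

lemma mrs: "(m + s)\<^sup>2 - r\<^sup>2 = (t + \<theta> * (lam - 1) + t * (lam - 1))\<^sup>2"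
  unfolding r_sq m_def s_def by (simp add: power2_eq_square algebra_simps)

lemma mr_pos: "m - r > 0"
proof -
  have "r\<^sup>2 < m\<^sup>2" using mr0 gap zero_less_power[OF gap, of 2] by linarith
  then show ?thesis using m_pos power_less_imp_less_base[of r 2 m] by simp
qed

lemma support_pos: "x \<in> {m - r..m + r} \<Longrightarrow> x > 0"
  using mr_pos by auto

lemma semicircle_nonpos: "x \<le> 0 \<Longrightarrow> semicircle m r x = 0"
  using semicircle_outside[of r x m] r_pos mr_pos by auto

lemma c1: "has_bochner_integral lborel (\<lambda>x. semicircle m r x / x) (2 * pi * \<theta> * lam)"
proof -
  have "has_bochner_integral lborel (\<lambda>x. semicircle m r x / (x - 0)) (pi * ((m - 0) - sqrt ((m - 0)\<^sup>2 - r\<^sup>2)))"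
    by (rule semicircle_transform_left) (use r_pos mr_pos in auto)
  moreover have "pi * ((m - 0) - sqrt ((m - 0)\<^sup>2 - r\<^sup>2)) = 2 * pi * \<theta> * lam"
    unfolding diff_zero mr0 using gap by (simp add: m_def algebra_simps)
  ultimately show ?thesis by (simp only: diff_zero)
qed

text \<open>The total mass of the candidate up to normalisation. By \<open>gap\<close> the root at 0
  is \<open>t - \<theta> * (lam - 1)\<close> and not its negative, so the two roots add up to
  \<open>t * (1 + lam)\<close>; with this sign the mass is 1 and no atom is left over.\<close>

lemma c0: "has_bochner_integral lborel (\<lambda>x. semicircle m r x / (x * (x + s))) (2 * pi * \<theta> / t)"
proof -
  have p: "t + \<theta> * (lam - 1) + t * (lam - 1) > 0"
    using t \<theta> lam1 by (simp add: add_pos_nonneg)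
  have l: "1 + lam > 0" using lam1 by simp
  have "pi * ((2 * m + s) / (sqrt ((m + s)\<^sup>2 - r\<^sup>2) + sqrt (m\<^sup>2 - r\<^sup>2)) - 1)
    = pi * ((2 * m + s) / (t * (1 + lam)) - 1)"
    using p gap unfolding mr0 mrs by (simp add: algebra_simps)
  also have "\<dots> = 2 * pi * \<theta> / t"
  proof -
    have "2 * m + s = (t + 2 * \<theta>) * (1 + lam)" by (simp add: m_def s_def algebra_simps)
    then have eq: "(2 * m + s) / (t * (1 + lam)) = (t + 2 * \<theta>) / t" using t l by simp
    show ?thesis unfolding eq using t by (simp add: field_simps)
  qed
  finally show ?thesis
    using semicircle_double_transform[OF r_pos mr_pos s_nonneg] by simp
qed

definition dens :: "real \<Rightarrow> real" where
  "dens x = t * semicircle m r x / (2 * pi * \<theta> * x * (x + s))"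

definition mu0 :: "real measure" where
  "mu0 = density lborel dens"

lemma dens_measurable [measurable]: "dens \<in> borel_measurable borel"
  unfolding dens_def by measurable

lemma dens_nonneg: "dens x \<ge> 0"
proof (cases "x > 0")
  case True
  then show ?thesis using t \<theta> s_nonneg semicircle_nonneg[of m r x] by (simp add: dens_def)
next
  case False
  then show ?thesis by (simp add: dens_def semicircle_nonpos)
qed

lemma dens_integral: "has_bochner_integral lborel dens 1"
proof -
  have "has_bochner_integral lborel (\<lambda>x. t / (2 * pi * \<theta>) * (semicircle m r x / (x * (x + s)))) (t / (2 * pi * \<theta>) * (2 * pi * \<theta> / t))"
    by (intro has_bochner_integral_mult_right c0)
  also have "t / (2 * pi * \<theta>) * (2 * pi * \<theta> / t) = 1" using t \<theta> by simp
  finally show ?thesis by (simp add: dens_def[abs_def] mult.assoc)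
qed

lemma mu0_distr: "real_distribution mu0"
proof -
  have "(\<integral>\<^sup>+x. ennreal (dens x) \<partial>lborel) = 1"
    using dens_integral dens_nonneg by (subst nn_integral_eq_integral) (auto simp: has_bochner_integral_iff)
  then have "prob_space mu0"
    unfolding mu0_def by (intro prob_spaceI) (simp add: emeasure_density)
  then show ?thesis
    by (simp add: real_distribution_def real_distribution_axioms_def mu0_def)
qed

lemma mu0_support: "AE x in mu0. x \<in> {m - r<..<m + r}"
proof -
  have "x \<in> {m - r<..<m + r}" if "dens x > 0" for x
  proof (rule ccontr)
    assume "x \<notin> {m - r<..<m + r}"
    then have "dens x = 0" using semicircle_outside[of r x m] r_pos by (auto simp: dens_def)
    with that show False by simp
  qed
  then show ?thesis unfolding mu0_def by (subst AE_density) auto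
qed

text \<open>Partial fractions: \<open>z (z + s) / (x (x + s) (z - x))\<close> equals
  \<open>1 / (z - x) + z / (x (x + s)) + 1 / x\<close>. The first term gives the semicircle
  transform, and the other two, integrated by \<open>c0\<close> and \<open>c1\<close>, produce the
  linear polynomial.\<close>

lemma cauchy_G_mu0:
  fixes z :: complex
  assumes nz: "\<And>x. x \<in> {m - r..m + r} \<Longrightarrow> z \<noteq> complex_of_real x"
  shows "integrable mu0 (\<lambda>x. 1 / (z - complex_of_real x))"
    and "2 * \<theta> * z * (z + s) * cauchy_G mu0 z - ((2 * \<theta> + t) * z + c) = t * (semicircle_transform m r z / pi - (z - m))"
proof -
  note J = semicircle_transform(1)[OF r_pos nz]
  have C0: "has_bochner_integral lborel (\<lambda>x. complex_of_real (semicircle m r x / (x * (x + s)))) (complex_of_real (2 * pi * \<theta> / t))"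
    by (intro has_bochner_integral_of_real c0)
  have C1: "has_bochner_integral lborel (\<lambda>x. complex_of_real (semicircle m r x / x)) (complex_of_real (2 * pi * \<theta> * lam))"
    by (intro has_bochner_integral_of_real c1)
  let ?I = "\<lambda>x. complex_of_real (dens x) * (1 / (z - complex_of_real x))"
  have I: "integrable lborel ?I"
  proof -
    have "bounded ((\<lambda>x. 1 / (z - complex_of_real x)) ` {m - r..m + r})"
      using nz by (intro compact_imp_bounded compact_continuous_image continuous_intros) auto
    then obtain B where "\<forall>y\<in>(\<lambda>x. 1 / (z - complex_of_real x)) ` {m - r..m + r}. cmod y \<le> B"
      unfolding bounded_iff by blast
    then have B: "\<And>x. x \<in> {m - r..m + r} \<Longrightarrow> cmod (1 / (z - complex_of_real x)) \<le> B"
      by blast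
    show ?thesis
    proof (rule Bochner_Integration.integrable_bound)
      show "integrable lborel (\<lambda>x. B * dens x)" using dens_integral by (auto simp: has_bochner_integral_iff)
      show "AE x in lborel. norm (?I x) \<le> norm (B * dens x)"
      proof (intro AE_I2)
        fix x
        show "norm (?I x) \<le> norm (B * dens x)"
        proof (cases "x \<in> {m - r..m + r}")
          case True
          have "norm (?I x) \<le> dens x * B"
            unfolding norm_mult using B[OF True] dens_nonneg[of x] by (intro mult_mono) auto
          then show ?thesis by (simp add: mult.commute)
        next
          case False
          then show ?thesis using semicircle_outside[of r x m] r_pos by (auto simp: dens_def)
        qed
      qed
    qed measurable
  qed
  then show "integrable mu0 (\<lambda>x. 1 / (z - complex_of_real x))"
    unfolding mu0_def using dens_nonneg by (subst integrable_density) (auto simp: scaleR_conv_of_real)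
  have G: "cauchy_G mu0 z = (\<integral>x. ?I x \<partial>lborel)"
    unfolding mu0_def cauchy_G_def using dens_nonneg by (subst integral_density) (auto simp: scaleR_conv_of_real)
  have "has_bochner_integral lborel (\<lambda>x. complex_of_real (t / pi) * (complex_of_real (semicircle m r x) / (z - complex_of_real x)
       + z * complex_of_real (semicircle m r x / (x * (x + s))) + complex_of_real (semicircle m r x / x)))
     (complex_of_real (t / pi) * (semicircle_transform m r z + z * complex_of_real (2 * pi * \<theta> / t) + complex_of_real (2 * pi * \<theta> * lam)))"
    by (intro has_bochner_integral_mult_right has_bochner_integral_add C0 C1)
       (use J in \<open>simp add: has_bochner_integral_iff semicircle_transform_def\<close>)
  also have "(\<lambda>x. complex_of_real (t / pi) * (complex_of_real (semicircle m r x) / (z - complex_of_real x)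
       + z * complex_of_real (semicircle m r x / (x * (x + s))) + complex_of_real (semicircle m r x / x)))
     = (\<lambda>x. 2 * \<theta> * z * (z + s) * ?I x)"
  proof (rule ext)
    fix x
    show "complex_of_real (t / pi) * (complex_of_real (semicircle m r x) / (z - complex_of_real x)
       + z * complex_of_real (semicircle m r x / (x * (x + s))) + complex_of_real (semicircle m r x / x))
       = 2 * \<theta> * z * (z + s) * ?I x"
    proof (cases "x \<in> {m - r..m + r}")
      case True
      define X where "X = complex_of_real x"
      define S where "S = complex_of_real s"
      have x: "x > 0" by (rule support_pos[OF True])
      then have nX: "X \<noteq> 0" by (simp add: X_def)
      have nXS: "X + S \<noteq> 0" using x s_nonneg by (simp add: X_def S_def flip: of_real_add)
      have nzX: "z - X \<noteq> 0" using nz[OF True] by (simp add: X_def)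
      have key: "1 / (z - X) + z * (1 / (X * (X + S))) + 1 / X = z * (z + S) * (1 / (X * (X + S) * (z - X)))"
        using nX nXS nzX by (simp add: divide_simps) (simp add: algebra_simps)
      have d: "complex_of_real (dens x) = complex_of_real (t / pi) * complex_of_real (semicircle m r x) / (2 * \<theta>) * (1 / (X * (X + S)))"
        by (simp add: dens_def X_def S_def)
      have "complex_of_real (t / pi) * (complex_of_real (semicircle m r x) / (z - X)
       + z * complex_of_real (semicircle m r x / (x * (x + s))) + complex_of_real (semicircle m r x / x))
        = complex_of_real (t / pi) * complex_of_real (semicircle m r x) * (1 / (z - X) + z * (1 / (X * (X + S))) + 1 / X)"
        by (simp add: X_def S_def ring_distribs)
      also have "\<dots> = 2 * \<theta> * z * (z + S) * (complex_of_real (dens x) * (1 / (z - X)))"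
      proof -
        have gen: "a * z * w * (A / a * T * D) = A * (z * w * (T * D))" if "a \<noteq> 0" for a w A T D :: complex
          using that by (simp add: mult_ac)
        have E: "1 / (X * (X + S)) * (1 / (z - X)) = 1 / (X * (X + S) * (z - X))" by simp
        have "complex_of_real (2 * \<theta>) \<noteq> 0" using \<theta> by simp
        from gen[OF this] show ?thesis unfolding key d E[symmetric] by (rule sym)
      qed
      finally show ?thesis unfolding X_def S_def .
    next
      case False
      then show ?thesis using semicircle_outside[of r x m] r_pos by (auto simp: dens_def)
    qed
  qed
  finally have "2 * \<theta> * z * (z + s) * cauchy_G mu0 z = complex_of_real (t / pi) * (semicircle_transform m r z + z * complex_of_real (2 * pi * \<theta> / t) + complex_of_real (2 * pi * \<theta> * lam))"
    unfolding G by (simp only: has_bochner_integral_iff integral_mult_right_zero)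
  also have "\<dots> = t * (semicircle_transform m r z / pi) + 2 * \<theta> * z + 2 * \<theta> * lam * t"
    using t by (simp add: field_simps)
  finally show "2 * \<theta> * z * (z + s) * cauchy_G mu0 z - ((2 * \<theta> + t) * z + c) = t * (semicircle_transform m r z / pi - (z - m))"
    by (simp add: c_def m_def power2_eq_square algebra_simps)
qed

lemma mu0_quadratic:
  fixes z :: complex
  assumes z: "Im z > 0"
  shows "(2 * \<theta> * z * (z + s) * cauchy_G mu0 z - ((2 * \<theta> + t) * z + c))\<^sup>2 = t\<^sup>2 * ((z - m)\<^sup>2 - (complex_of_real r)\<^sup>2)"
proof -
  have nz: "z \<noteq> complex_of_real x" for x using z by auto
  show ?thesis
    unfolding cauchy_G_mu0(2)[OF nz] power_mult_distrib semicircle_transform(2)[OF r_pos nz] by simp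
qed

lemma mu0_quadratic':
  fixes z :: complex
  assumes z: "Im z > 0"
  shows "\<theta> * z * (z + s) * (cauchy_G mu0 z)\<^sup>2 - ((2 * \<theta> + t) * z + c) * cauchy_G mu0 z + (\<theta> + t) = 0"
proof -
  let ?G = "cauchy_G mu0 z"
  define A where "A = \<theta> * z * (z + s)"
  define B where "B = (2 * \<theta> + t) * z + c"
  have r2: "(complex_of_real r)\<^sup>2 = 4 * (\<theta> * lam * (t + \<theta>))"
    using arg_cong[OF r_sq, of complex_of_real] by simp
  \<comment> \<open>The identity that determines \<open>m\<close> and \<open>r\<close>: the
    discriminant is a multiple of a quadratic with zeros at the endpoints of the support.\<close>
  have disc: "t\<^sup>2 * ((z - m)\<^sup>2 - (complex_of_real r)\<^sup>2) = B\<^sup>2 - 4 * A * (\<theta> + t)"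
    unfolding r2 unfolding A_def B_def m_def s_def c_def by (simp add: power2_eq_square algebra_simps)
  have "(2 * A * ?G - B)\<^sup>2 = B\<^sup>2 - 4 * A * (\<theta> + t)"
    using mu0_quadratic[OF z] unfolding disc by (simp add: A_def B_def mult.assoc)
  then have "4 * A * (A * ?G\<^sup>2 - B * ?G + (\<theta> + t)) = 0"
    by (simp add: power2_eq_square algebra_simps)
  then have "4 * \<theta> * z * (z + s) * (A * ?G\<^sup>2 - B * ?G + (\<theta> + t)) = 0"
    by (simp add: A_def mult.assoc)
  moreover have "z + complex_of_real s \<noteq> 0" "z \<noteq> 0" using z by (auto simp: complex_eq_iff)
  ultimately show ?thesis using \<theta> by (simp add: A_def B_def)
qed

section \<open>The Marchenko-Pastur law and the R-transform in terms of it\<close>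

definition kappa :: "real measure" where
  "kappa = density lborel (kdens \<theta> lam)"

definition "m' = \<theta> * (lam + 1)"
definition "r' = 2 * \<theta> * sqrt lam"

lemma r'_pos: "r' > 0" using \<theta> lam1 by (simp add: r'_def)

lemma r'_sq: "r'\<^sup>2 = 4 * \<theta>\<^sup>2 * lam" using lam1 by (simp add: r'_def power_mult_distrib)

lemma a_plus_eq: "a_plus \<theta> lam = m' + r'" and a_minus_eq: "a_minus \<theta> lam = m' - r'"
  using lam1 by (simp_all add: a_plus_def a_minus_def m'_def r'_def power2_eq_square algebra_simps)

lemma mr'_nonneg: "m' - r' \<ge> 0"
  using \<theta> by (simp add: a_minus_eq[symmetric] a_minus_def)

lemma kdens_semicircle: "kdens \<theta> lam x = semicircle m' r' x / (2 * pi * \<theta> * x)"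
proof (cases "x \<in> {m' - r'<..<m' + r'}")
  case True
  then show ?thesis unfolding kdens_def a_plus_eq a_minus_eq
    using semicircle_inside[of x m' r'] by (simp add: power2_eq_square algebra_simps)
next
  case False
  then show ?thesis unfolding kdens_def a_plus_eq a_minus_eq
    using semicircle_outside[of r' x m'] r'_pos by auto
qed

lemma kdens_measurable [measurable]: "kdens \<theta> lam \<in> borel_measurable borel"
  unfolding kdens_semicircle[abs_def] by measurable

lemma semicircle'_nonpos: "x \<le> 0 \<Longrightarrow> semicircle m' r' x = 0"
  using semicircle_outside[of r' x m'] r'_pos mr'_nonneg by auto

lemma kdens_nonneg: "kdens \<theta> lam x \<ge> 0"
proof (cases "x > 0")
  case True
  then show ?thesis using \<theta> semicircle_nonneg[of m' r' x] by (simp add: kdens_semicircle)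
next
  case False
  then show ?thesis by (simp add: kdens_semicircle semicircle'_nonpos)
qed

lemma kdens_integral: "has_bochner_integral lborel (kdens \<theta> lam) 1"
proof -
  have "has_bochner_integral lborel (\<lambda>x. 1 / (2 * pi * \<theta>) * (semicircle m' r' x / (x - 0))) (1 / (2 * pi * \<theta>) * (pi * ((m' - 0) - sqrt ((m' - 0)\<^sup>2 - r'\<^sup>2))))"
    by (intro has_bochner_integral_mult_right semicircle_transform_left) (use r'_pos mr'_nonneg in auto)
  \<comment> \<open>Its root is \<open>\<theta> * (lam - 1)\<close> because
    \<open>lam \<ge> 1\<close>, which makes the total mass 1.\<close>
  moreover have "m'\<^sup>2 - r'\<^sup>2 = (\<theta> * (lam - 1))\<^sup>2"
    unfolding r'_sq m'_def by (simp add: power2_eq_square algebra_simps)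
  moreover have "1 / (2 * pi * \<theta>) * (pi * (m' - \<theta> * (lam - 1))) = 1"
    using \<theta> by (simp add: m'_def field_simps)
  ultimately show ?thesis
    using \<theta> lam1 by (simp add: kdens_semicircle[abs_def] mult.assoc)
qed

lemma kappa_distr: "real_distribution kappa"
proof -
  have "(\<integral>\<^sup>+x. ennreal (kdens \<theta> lam x) \<partial>lborel) = 1"
    using kdens_integral kdens_nonneg by (subst nn_integral_eq_integral) (auto simp: has_bochner_integral_iff)
  then have "prob_space kappa"
    unfolding kappa_def by (intro prob_spaceI) (simp add: emeasure_density)
  then show ?thesis
    by (simp add: real_distribution_def real_distribution_axioms_def kappa_def)
qed

lemma kappa_support: "AE x in kappa. x \<in> {m' - r'<..<m' + r'}"
proof -
  have "x \<in> {m' - r'<..<m' + r'}" if "kdens \<theta> lam x > 0" for x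
  proof (rule ccontr)
    assume "x \<notin> {m' - r'<..<m' + r'}"
    then have "kdens \<theta> lam x = 0" using semicircle_outside[of r' x m'] r'_pos by (auto simp: kdens_semicircle)
    with that show False by simp
  qed
  then show ?thesis unfolding kappa_def by (subst AE_density) auto
qed

lemma cauchy_G_kappa_density:
  "cauchy_G kappa z = (\<integral>x. complex_of_real (kdens \<theta> lam x) * (1 / (z - complex_of_real x)) \<partial>lborel)"
  unfolding kappa_def cauchy_G_def using kdens_nonneg
  by (subst integral_density) (auto simp: scaleR_conv_of_real)

text \<open>Writing \<open>u / (u - x) = 1 + x / (u - x)\<close> cancels the factor
  \<open>1 / x\<close> of the density, so \<open>u K\<close> is 1 plus a multiple of the semicircle
  transform. Its square is known, and the quadratic follows after division by
  \<open>4 \<theta> u\<close>.\<close>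

lemma kappa_quadratic:
  fixes u :: complex
  assumes u: "Im u > 0"
  shows "\<theta> * u * (cauchy_G kappa u)\<^sup>2 - (u + \<theta> * (1 - lam)) * cauchy_G kappa u + 1 = 0"
proof -
  have nz: "u \<noteq> complex_of_real x" for x using u by auto
  let ?K = "cauchy_G kappa u"
  have kd: "has_bochner_integral lborel (\<lambda>x. complex_of_real (kdens \<theta> lam x)) 1"
    using has_bochner_integral_of_real[OF kdens_integral, where 'a=complex] by simp
  have I: "has_bochner_integral lborel (\<lambda>x. complex_of_real (kdens \<theta> lam x)
       + 1 / (2 * pi * \<theta>) * (complex_of_real (semicircle m' r' x) / (u - complex_of_real x))) (1 + 1 / (2 * pi * \<theta>) * semicircle_transform m' r' u)"
    using semicircle_transform(1)[OF r'_pos nz]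
    by (intro has_bochner_integral_add has_bochner_integral_mult_right kd)
       (simp_all add: has_bochner_integral_iff semicircle_transform_def)
  also have "(\<lambda>x. complex_of_real (kdens \<theta> lam x) + 1 / (2 * pi * \<theta>) * (complex_of_real (semicircle m' r' x) / (u - complex_of_real x)))
    = (\<lambda>x. u * (complex_of_real (kdens \<theta> lam x) * (1 / (u - complex_of_real x))))"
  proof (rule ext)
    fix x
    show "complex_of_real (kdens \<theta> lam x) + 1 / (2 * pi * \<theta>) * (complex_of_real (semicircle m' r' x) / (u - complex_of_real x))
      = u * (complex_of_real (kdens \<theta> lam x) * (1 / (u - complex_of_real x)))"
    proof (cases "x > 0")
      case True
      have "u - complex_of_real x \<noteq> 0" using nz[of x] by simp
      then show ?thesis using True \<theta> by (simp add: kdens_semicircle field_simps)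
    next
      case False
      then show ?thesis by (simp add: kdens_semicircle semicircle'_nonpos)
    qed
  qed
  finally have "u * ?K = 1 + 1 / (2 * pi * \<theta>) * semicircle_transform m' r' u"
    unfolding cauchy_G_kappa_density by (simp only: has_bochner_integral_iff integral_mult_right_zero)
  then have "semicircle_transform m' r' u / pi = 2 * \<theta> * (u * ?K - 1)"
    using \<theta> by (simp add: field_simps)
  with semicircle_transform(2)[OF r'_pos nz, of m'] have
    "(2 * \<theta> * (u * ?K - 1) - (u - m'))\<^sup>2 = (u - m')\<^sup>2 - complex_of_real (r'\<^sup>2)" by simp
  moreover have "(2 * \<theta> * (u * ?K - 1) - (u - m'))\<^sup>2 - ((u - m')\<^sup>2 - complex_of_real (r'\<^sup>2))
     = 4 * \<theta> * u * (\<theta> * u * ?K\<^sup>2 - (u + \<theta> * (1 - lam)) * ?K + 1)"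
    unfolding r'_sq m'_def by (simp add: power2_eq_square algebra_simps)
  ultimately have "4 * \<theta> * u * (\<theta> * u * ?K\<^sup>2 - (u + \<theta> * (1 - lam)) * ?K + 1) = 0"
    by simp
  moreover have "complex_of_real \<theta> \<noteq> 0" "u \<noteq> 0" using \<theta> u by auto
  ultimately show ?thesis by simp
qed

text \<open>\<open>1 / (1 - w x) - 1 = w x / (1 - w x)\<close>, and the factor \<open>x\<close>
  cancels the \<open>1 / x\<close> of the Levy density.\<close>

lemma Rfun_eq:
  assumes "Im (1 / w) > 0"
  shows "Rfun t \<theta> lam w = t * cauchy_G kappa (1 / w)"
proof -
  have w: "w \<noteq> 0" using assms by auto
  have nz: "1 / w - complex_of_real x \<noteq> 0" for x using assms by (auto simp: complex_eq_iff)
  have "Rfun t \<theta> lam w = (\<integral>x. t * (complex_of_real (kdens \<theta> lam x) * (1 / (1 / w - complex_of_real x))) \<partial>lborel)"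
    unfolding Rfun_def
  proof (rule Bochner_Integration.integral_cong[OF refl])
    fix x
    show "(1 / (1 - w * complex_of_real x) - 1) * complex_of_real (t * kdens \<theta> lam x / x)
      = t * (complex_of_real (kdens \<theta> lam x) * (1 / (1 / w - complex_of_real x)))"
    proof (cases "x > 0")
      case True
      have "1 - w * complex_of_real x = w * (1 / w - complex_of_real x)" using w by (simp add: algebra_simps)
      then have n: "1 - w * complex_of_real x \<noteq> 0" using nz[of x] w by simp
      have a: "1 / (1 - w * complex_of_real x) - 1 = w * complex_of_real x / (1 - w * complex_of_real x)"
        using n by (simp add: field_simps)
      have b: "1 / (1 / w - complex_of_real x) = w / (1 - w * complex_of_real x)"
        using n w nz[of x] by (simp add: field_simps)
      show ?thesis unfolding a b using True n by (simp add: field_simps)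
    next
      case False
      then show ?thesis by (simp add: kdens_semicircle semicircle'_nonpos)
    qed
  qed
  then show ?thesis unfolding cauchy_G_kappa_density by (simp only: integral_mult_right_zero)
qed

end

section \<open>The R-transform\<close>

context free_beta_prime
begin

lemma mu0_bounded_support: "AE x in mu0. \<bar>x\<bar> \<le> m + r"
  using mu0_support by eventually_elim (use mr_pos in auto)

lemma kappa_bounded_support: "AE x in kappa. \<bar>x\<bar> \<le> m' + r'"
  using kappa_support by eventually_elim (use mr'_nonneg in auto)

lemma mr_sum_pos: "m + r > 0" "m' + r' > 0"
  using m_pos r_pos mr'_nonneg r'_pos by auto

lemmas mu0_asymptotics = cauchy_G_asymptotics[OF mu0_distr mr_sum_pos(1) mu0_bounded_support]
lemmas kappa_asymptotics = cauchy_G_asymptotics[OF kappa_distr mr_sum_pos(2) kappa_bounded_support]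

text \<open>The only possible inverse of \<open>reciprocal_F\<close>: solving
  \<open>R w = w * Finv (1 / w) - 1\<close> for \<open>Finv\<close> with
  \<open>R w = t * cauchy_G kappa (1 / w)\<close> gives this function.\<close>

definition H :: "complex \<Rightarrow> complex" where
  "H u = u * (1 + t * cauchy_G kappa u)"

lemma H_shift: "((\<lambda>w. H w - w) \<longlongrightarrow> complex_of_real t) Im_at_top"
proof -
  have "((\<lambda>w. t * (w * cauchy_G kappa w)) \<longlongrightarrow> complex_of_real t * 1) Im_at_top"
    by (intro tendsto_intros kappa_asymptotics(1))
  then show ?thesis by (simp add: H_def algebra_simps)
qed

lemma eventually_H_close: "\<forall>\<^sub>F w in Im_at_top. cmod (H w - w - t) < 1"
  using tendstoD[OF H_shift, of 1] by (simp add: dist_norm)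

lemma filterlim_H: "filterlim H Im_at_top Im_at_top"
proof (rule Im_at_top_perturb)
  show "\<forall>\<^sub>F z in Im_at_top. cmod (H z - z) \<le> t + 1"
    using eventually_H_close
  proof eventually_elim
    case (elim z)
    then show ?case using norm_triangle_ineq2[of "H z - z" "complex_of_real t"] t by simp
  qed
qed

lemma eventually_Im_pos: "\<forall>\<^sub>F z in Im_at_top. Im z > 0"
  unfolding eventually_Im_at_top by blast

text \<open>\<open>F z - z\<close> is \<open>- z (z G - 1) / (z G)\<close>. The numerator is at most
  \<open>2 * (m + r)\<close> in modulus and \<open>z G\<close> is eventually within
  \<open>1 / 2\<close> of 1, so the distance to the identity is bounded.\<close>

lemma filterlim_F: "filterlim (reciprocal_F mu0) Im_at_top Im_at_top"
proof (rule Im_at_top_perturb)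
  have "\<forall>\<^sub>F z in Im_at_top. dist (z * cauchy_G mu0 z) 1 < 1 / 2"
    by (rule tendstoD[OF mu0_asymptotics(1)]) simp
  then show "\<forall>\<^sub>F z in Im_at_top. cmod (reciprocal_F mu0 z - z) \<le> 4 * (m + r)"
    using mu0_asymptotics(3) eventually_Im_pos
  proof eventually_elim
    case (elim z)
    define g where "g = z * cauchy_G mu0 z"
    have z: "z \<noteq> 0" using elim by auto
    have g: "cmod (g - 1) < 1 / 2" using elim by (simp add: g_def dist_norm)
    have g1: "cmod g \<ge> 1 / 2"
      using norm_triangle_ineq2[of 1 "1 - g"] g by (simp add: norm_minus_commute)
    then have g0: "g \<noteq> 0" by auto
    have "reciprocal_F mu0 z - z = - (z * (g - 1)) / g"
      using z g0 by (simp add: reciprocal_F_def g_def field_simps)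
    then have "cmod (reciprocal_F mu0 z - z) = cmod (z * (g - 1)) / cmod g"
      by (simp add: norm_divide norm_minus_cancel)
    also have "\<dots> \<le> 2 * (m + r) / (1 / 2)"
      using elim(2) g1 mr_sum_pos by (intro frac_le) (auto simp: g_def)
    finally show ?case by simp
  qed
qed

text \<open>\<open>H\<close> and \<open>reciprocal_F mu0\<close> satisfy the same quadratic equation, and near infinity the
  second root is excluded by the limits \<open>-1\<close> and \<open>-t\<close> of the complementary factors below.\<close>
lemma eventually_H_F: "\<forall>\<^sub>F z in Im_at_top. H (reciprocal_F mu0 z) = z"
proof -
  let ?F = "reciprocal_F mu0"
  have A: "((\<lambda>z. (z * cauchy_G mu0 z - 1) / t) \<longlongrightarrow> (1 - 1) / complex_of_real t) Im_at_top"
    by (intro tendsto_intros mu0_asymptotics) (use t in auto)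
  have "((\<lambda>z. \<theta> * ((z * cauchy_G mu0 z - 1) / t + cauchy_G kappa (?F z)) - 1 - \<theta> * (1 - lam) * (1 / ?F z))
    \<longlongrightarrow> complex_of_real \<theta> * ((1 - 1) / complex_of_real t + 0) - 1 - complex_of_real (\<theta> * (1 - lam)) * 0) Im_at_top"
    by (intro tendsto_diff tendsto_add tendsto_mult tendsto_const A
        filterlim_compose[OF kappa_asymptotics(2) filterlim_F]
        filterlim_compose[OF tendsto_inverse_Im_at_top filterlim_F])
  then have "\<forall>\<^sub>F z in Im_at_top. \<theta> * ((z * cauchy_G mu0 z - 1) / t + cauchy_G kappa (?F z)) - 1 - \<theta> * (1 - lam) * (1 / ?F z) \<noteq> 0"
    by (rule tendsto_imp_eventually_ne) simp
  moreover have "\<forall>\<^sub>F z in Im_at_top. Im (?F z) > 0"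
    by (rule filterlim_F[unfolded filterlim_iff, rule_format, OF eventually_Im_pos])
  ultimately show ?thesis
    using eventually_Im_pos
  proof eventually_elim
    case (elim z)
    define G where "G = cauchy_G mu0 z"
    define u where "u = ?F z"
    define K where "K = cauchy_G kappa u"
    have u: "u \<noteq> 0" "Im u > 0" using elim by (auto simp: u_def)
    have z: "z \<noteq> 0" using elim by auto
    have G: "G = 1 / u" "G \<noteq> 0" using u by (auto simp: u_def reciprocal_F_def G_def)
    \<comment> \<open>Chosen so that \<open>z = u * (1 + t * g)\<close>; thus \<open>H u = z\<close>
      amounts to \<open>g = K\<close>.\<close>
    define g where "g = (z * G - 1) / t"
    have t0: "complex_of_real t \<noteq> 0" and th0: "complex_of_real \<theta> \<noteq> 0" using t \<theta> by auto
    have q1: "\<theta> * u * K\<^sup>2 - (u + \<theta> * (1 - lam)) * K + 1 = 0"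
      unfolding K_def by (rule kappa_quadratic) (rule u)
    have zu: "z = u * (1 + t * g)" using G t0 u by (simp add: g_def field_simps)
    have q2': "\<theta> * z * (z + s) * G\<^sup>2 - ((2 * \<theta> + t) * z + c) * G + (\<theta> + t) = 0"
      unfolding G_def by (rule mu0_quadratic') (rule elim)
    \<comment> \<open>With \<open>G = 1 / u\<close> and \<open>z = u (1 + t g)\<close> the quadratic
      of the candidate turns into the Marchenko-Pastur quadratic, now satisfied by \<open>g\<close>.
      Read backwards, this substitution is the origin of \<open>s\<close> and
      \<open>c\<close>.\<close>
    have q2: "\<theta> * u * g\<^sup>2 - (u + \<theta> * (1 - lam)) * g + 1 = 0"
    proof -
      have Gu: "G * u = 1" using G u by simp
      have "t\<^sup>2 * (\<theta> * u * g\<^sup>2 - (u + \<theta> * (1 - lam)) * g + 1) =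
        u * (\<theta> * z * (z + s) * G\<^sup>2 - ((2 * \<theta> + t) * z + c) * G + (\<theta> + t))"
        using Gu unfolding zu s_def c_def of_real_mult of_real_add of_real_diff of_real_1 of_real_power of_real_numeral
        by algebra
      then show ?thesis unfolding q2' using t0 by simp
    qed
    have prod: "(g - K) * (\<theta> * u * (g + K) - (u + \<theta> * (1 - lam))) = 0"
      using q1 q2 by algebra
    have fac: "\<theta> * u * (g + K) - (u + \<theta> * (1 - lam)) = u * (\<theta> * (g + K) - 1 - \<theta> * (1 - lam) * (1 / u))"
      using u by (simp add: field_simps)
    have "\<theta> * (g + K) - 1 - \<theta> * (1 - lam) * (1 / u) \<noteq> 0"
      using elim(1) unfolding g_def K_def G_def u_def .
    then have "g = K" using u prod unfolding fac mult_eq_0_iff by auto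
    then have "H u = z" using zu unfolding H_def K_def[symmetric] by simp
    then show ?case unfolding u_def .
  qed
qed

text \<open>The composition in the other order. \<open>eventually_H_F\<close> gives injectivity of
  \<open>reciprocal_F\<close>; that its image covers a cone needs this statement. The comparison of
  quadratics is now made for \<open>G\<close> at the point \<open>H w\<close>, with
  \<open>V = 1 / w\<close> as the other solution.\<close>

lemma eventually_F_H: "\<forall>\<^sub>F w in Im_at_top. cauchy_G mu0 (H w) = 1 / w"
proof -
  have zw: "((\<lambda>w. 1 + t * cauchy_G kappa w) \<longlongrightarrow> 1 + complex_of_real t * 0) Im_at_top"
    by (intro tendsto_intros kappa_asymptotics)
  have "((\<lambda>w. \<theta> * (1 + s * (1 / H w)) * (H w * cauchy_G mu0 (H w) + (1 + t * cauchy_G kappa w)) - (2 * \<theta> + t) - c * (1 / H w))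
     \<longlongrightarrow> complex_of_real \<theta> * (1 + complex_of_real s * 0) * (1 + (1 + complex_of_real t * 0)) - (2 * \<theta> + t) - complex_of_real c * 0) Im_at_top"
    by (intro tendsto_intros zw filterlim_compose[OF tendsto_inverse_Im_at_top filterlim_H]
        filterlim_compose[OF mu0_asymptotics(1) filterlim_H] kappa_asymptotics)
  then have "\<forall>\<^sub>F w in Im_at_top. \<theta> * (1 + s * (1 / H w)) * (H w * cauchy_G mu0 (H w) + (1 + t * cauchy_G kappa w)) - (2 * \<theta> + t) - c * (1 / H w) \<noteq> 0"
    by (rule tendsto_imp_eventually_ne) (use t in simp)
  moreover have "\<forall>\<^sub>F w in Im_at_top. Im (H w) > 0"
    by (rule filterlim_H[unfolded filterlim_iff, rule_format, OF eventually_Im_pos])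
  ultimately show ?thesis
    using eventually_Im_pos
  proof eventually_elim
    case (elim w)
    define z where "z = H w"
    define G where "G = cauchy_G mu0 z"
    define K where "K = cauchy_G kappa w"
    have w: "w \<noteq> 0" using elim by auto
    have z: "z \<noteq> 0" "Im z > 0" using elim by (auto simp: z_def)
    have zu: "z = w * (1 + t * K)" by (simp add: z_def H_def K_def)
    have q1: "\<theta> * w * K\<^sup>2 - (w + \<theta> * (1 - lam)) * K + 1 = 0"
      unfolding K_def by (rule kappa_quadratic) (rule elim)
    have q2: "\<theta> * z * (z + s) * G\<^sup>2 - ((2 * \<theta> + t) * z + c) * G + (\<theta> + t) = 0"
      unfolding G_def by (rule mu0_quadratic') (rule z)
    define V where "V = 1 / w"
    have V: "V * w = 1" using w by (simp add: V_def)
    have q3: "\<theta> * z * (z + s) * V\<^sup>2 - ((2 * \<theta> + t) * z + c) * V + (\<theta> + t) = 0"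
    proof -
      have "w * (\<theta> * z * (z + s) * V\<^sup>2 - ((2 * \<theta> + t) * z + c) * V + (\<theta> + t)) =
        t\<^sup>2 * (\<theta> * w * K\<^sup>2 - (w + \<theta> * (1 - lam)) * K + 1)"
        using V unfolding zu s_def c_def of_real_mult of_real_add of_real_diff of_real_1 of_real_power of_real_numeral
        by algebra
      then show ?thesis unfolding q1 using w by simp
    qed
    have prod: "(G - V) * (\<theta> * z * (z + s) * (G + V) - ((2 * \<theta> + t) * z + c)) = 0"
      using q2 q3 by algebra
    have fac: "\<theta> * z * (z + s) * (G + V) - ((2 * \<theta> + t) * z + c)
      = z * (\<theta> * (1 + s * (1 / z)) * (z * G + (1 + t * K)) - (2 * \<theta> + t) - c * (1 / z))"
    proof -
      have "z * V = (V * w) * (1 + t * K)" unfolding zu by (simp only: mult_ac)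
      then have zV: "1 + t * K = z * V" unfolding V by simp
      show ?thesis unfolding zV using z by (simp add: field_simps)
    qed
    have "\<theta> * (1 + s * (1 / z)) * (z * G + (1 + t * K)) - (2 * \<theta> + t) - c * (1 / z) \<noteq> 0"
      using elim(1) unfolding z_def G_def K_def .
    then have "G = V" using z prod unfolding fac mult_eq_0_iff by auto
    then show ?case unfolding G_def V_def z_def .
  qed
qed

lemma mu0_has_R_transform: "has_R_transform mu0 (Rfun t \<theta> lam)"
proof -
  obtain \<rho>1 where \<rho>1: "\<And>z. Im z > \<rho>1 \<Longrightarrow> H (reciprocal_F mu0 z) = z"
    using eventually_H_F unfolding eventually_Im_at_top by blast
  define \<beta>' where "\<beta>' = max \<rho>1 1"
  have "\<forall>\<^sub>F w in Im_at_top. Im (H w) > \<beta>'"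
    using filterlim_H eventually_Im_at_top[of "\<lambda>z. Im z > \<beta>'"] by (auto simp: filterlim_iff)
  \<comment> \<open>As \<open>H w\<close> is within 1 of \<open>w + t\<close>, this height gives
    \<open>Im w + t + 1 < 2 * (Im w - 1)\<close>, so \<open>H\<close> maps the cone of opening 1
    into the cone of opening 2.\<close>
  moreover have "\<forall>\<^sub>F w in Im_at_top. Im w > t + 3"
    unfolding eventually_Im_at_top by blast
  ultimately have "\<forall>\<^sub>F w in Im_at_top. cauchy_G mu0 (H w) = 1 / w \<and> cmod (H w - w - t) < 1 \<and> Im (H w) > \<beta>' \<and> Im w > t + 3"
    using eventually_H_close eventually_F_H by eventually_elim auto
  then obtain \<rho>2 where \<rho>2: "\<And>w. Im w > \<rho>2 \<Longrightarrow> cauchy_G mu0 (H w) = 1 / w" "\<And>w. Im w > \<rho>2 \<Longrightarrow> cmod (H w - w - t) < 1"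
     "\<And>w. Im w > \<rho>2 \<Longrightarrow> Im (H w) > \<beta>'" "\<And>w. Im w > \<rho>2 \<Longrightarrow> Im w > t + 3"
    unfolding eventually_Im_at_top by blast
  define \<beta> where "\<beta> = max \<rho>2 1"
  show ?thesis
    unfolding has_R_transform_def
  proof (rule exI[of _ 1], rule exI[of _ \<beta>], rule exI[of _ 2], rule exI[of _ \<beta>'], rule exI[of _ H],
      intro conjI ballI allI impI)
    show "inj_on (reciprocal_F mu0) (cone 2 \<beta>')"
      by (rule inj_on_inverseI[of _ H]) (auto simp: cone_def \<beta>'_def intro!: \<rho>1)
    show "H w \<in> cone 2 \<beta>'" if "w \<in> cone 1 \<beta>" for w
    proof -
      have w: "Im w > \<rho>2" "\<bar>Re w\<bar> < Im w" using that by (auto simp: cone_def \<beta>_def)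
      have "\<bar>Re (H w) - Re w - t\<bar> < 1" "\<bar>Im (H w) - Im w\<bar> < 1"
        using \<rho>2(2)[OF w(1)] abs_Re_le_cmod[of "H w - w - t"] abs_Im_le_cmod[of "H w - w - t"] by simp_all
      then show ?thesis using \<rho>2(3,4)[OF w(1)] w t by (simp add: cone_def)
    qed
    show "reciprocal_F mu0 (H w) = w" if "w \<in> cone 1 \<beta>" for w
      using \<rho>2(1)[of w] that by (auto simp: cone_def \<beta>_def reciprocal_F_def)
    show "Rfun t \<theta> lam w = w * H (1 / w) - 1" if "1 / w \<in> cone 1 \<beta>" for w
    proof -
      have i: "Im (1 / w) > 0" using that by (auto simp: cone_def \<beta>_def)
      then have "w \<noteq> 0" by auto
      then show ?thesis by (simp add: Rfun_eq[OF i] H_def)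
    qed
  qed (auto simp: \<beta>_def \<beta>'_def)
qed

lemma is_mu_mu0: "is_mu t \<theta> lam mu0"
proof -
  interpret M: real_distribution mu0 by (rule mu0_distr)
  show ?thesis
    unfolding is_mu_def using mu0_has_R_transform M.prob_space_axioms M.events_eq_borel by simp
qed

text \<open>The R-transform forces \<open>Finv = H\<close> on a cone, so the Cauchy transforms of
  both measures take the value \<open>1 / u\<close> at \<open>H u\<close> for all high
  \<open>u\<close> in it. Such points accumulate in the upper half-plane; analytic continuation and
  \<open>cauchy_G_inject\<close> do the rest.\<close>

lemma is_mu_unique:
  assumes mu: "is_mu t \<theta> lam \<mu>"
  shows "\<mu> = mu0"
proof -
  have M: "real_distribution \<mu>"
    using mu unfolding is_mu_def real_distribution_def real_distribution_axioms_def
    by (auto simp: sets_eq_imp_space_eq[of \<mu> borel])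
  obtain \<alpha> \<beta> \<alpha>' \<beta>' Finv where p: "\<alpha> > 0" "\<beta> > 0" "\<alpha>' > 0" "\<beta>' > 0"
    and F: "\<And>w. w \<in> cone \<alpha> \<beta> \<Longrightarrow> Finv w \<in> cone \<alpha>' \<beta>' \<and> reciprocal_F \<mu> (Finv w) = w"
    and Rt: "\<And>w. 1 / w \<in> cone \<alpha> \<beta> \<Longrightarrow> Rfun t \<theta> lam w = w * Finv (1 / w) - 1"
    using mu unfolding is_mu_def has_R_transform_def by blast
  have Finv: "Finv u = H u" if u: "u \<in> cone \<alpha> \<beta>" for u
  proof -
    have i: "Im u > 0" using u p by (auto simp: cone_def)
    then have u0: "u \<noteq> 0" by auto
    have "t * cauchy_G kappa u = (1 / u) * Finv u - 1"
      using Rt[of "1 / u"] Rfun_eq[of "1 / u"] u i by simp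
    then show ?thesis using u0 by (simp add: H_def field_simps)
  qed
  have G: "cauchy_G \<mu> (H u) = 1 / u" "Im (H u) > 0" if u: "u \<in> cone \<alpha> \<beta>" for u
  proof -
    have "reciprocal_F \<mu> (H u) = u" and c: "H u \<in> cone \<alpha>' \<beta>'" using F[OF u] Finv[OF u] by auto
    then have "1 / reciprocal_F \<mu> (H u) = 1 / u" by simp
    then show "cauchy_G \<mu> (H u) = 1 / u" by (simp add: reciprocal_F_def)
    show "Im (H u) > 0" using c p by (auto simp: cone_def)
  qed
  obtain \<rho> where \<rho>: "\<And>w. Im w > \<rho> \<Longrightarrow> cauchy_G mu0 (H w) = 1 / w"
    using eventually_F_H unfolding eventually_Im_at_top by blast
  define Y where "Y = max \<rho> \<beta> + 1"
  define U where "U = H ` {u \<in> cone \<alpha> \<beta>. Im u > \<rho>}"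
  \<comment> \<open>The imaginary axis lies in every cone up to the height condition, and
    \<open>Y\<close> exceeds both thresholds.\<close>
  define u where "u = (\<lambda>y. Complex 0 (Y + y))"
  have u: "u y \<in> cone \<alpha> \<beta>" "Im (u y) > \<rho>" if "y \<ge> 0" for y
    using that p by (auto simp: u_def Y_def cone_def intro!: mult_pos_pos)
  have U: "U \<subseteq> {z. Im z > 0}" "\<And>z. z \<in> U \<Longrightarrow> cauchy_G \<mu> z = cauchy_G mu0 z"
    using G \<rho> by (auto simp: U_def)
  have lim: "H (u 0) islimpt U"
    unfolding islimpt_sequential
  proof (intro exI[of _ "\<lambda>n. H (u (1 / real (Suc n)))"] conjI allI)
    fix n
    \<comment> \<open>\<open>H\<close> is injective on the cone because
      \<open>cauchy_G \<mu> (H u) = 1 / u\<close> recovers \<open>u\<close>.\<close>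
    have "H (u (1 / real (Suc n))) \<noteq> H (u 0)"
    proof
      assume "H (u (1 / real (Suc n))) = H (u 0)"
      then have "1 / u (1 / real (Suc n)) = 1 / u 0"
        using G(1)[OF u(1)] by (metis divide_nonneg_nonneg of_nat_0_le_iff order_refl zero_le_one)
      then show False by (simp add: u_def)
    qed
    moreover have "H (u (1 / real (Suc n))) \<in> U" unfolding U_def using u by auto
    ultimately show "H (u (1 / real (Suc n))) \<in> U - {H (u 0)}" by simp
  next
    have "isCont (cauchy_G kappa) (u 0)"
      by (rule DERIV_isCont[OF cauchy_G_has_derivative[OF kappa_distr]]) (use p in \<open>auto simp: u_def Y_def\<close>)
    then have "isCont H (u 0)" unfolding H_def by (intro continuous_intros)
    moreover have "(\<lambda>n. u (1 / real (Suc n))) \<longlonglongrightarrow> u 0"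
    proof -
      have "(\<lambda>n. Complex 0 (Y + inverse (real (Suc n)))) \<longlonglongrightarrow> Complex 0 (Y + 0)"
        by (intro tendsto_Complex tendsto_intros LIMSEQ_inverse_real_of_nat)
      then show ?thesis by (simp add: u_def inverse_eq_divide)
    qed
    ultimately show "(\<lambda>n. H (u (1 / real (Suc n)))) \<longlonglongrightarrow> H (u 0)"
      by (rule isCont_tendsto_compose)
  qed
  have eq: "cauchy_G \<mu> z = cauchy_G mu0 z" if z: "Im z > 0" for z
  proof -
    have "cauchy_G \<mu> z - cauchy_G mu0 z = 0"
    proof (rule analytic_continuation[of "\<lambda>z. cauchy_G \<mu> z - cauchy_G mu0 z" "{z. Im z > 0}" U "H (u 0)" z])
      show "(\<lambda>z. cauchy_G \<mu> z - cauchy_G mu0 z) holomorphic_on {z. Im z > 0}"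
        by (intro holomorphic_intros cauchy_G_holomorphic M mu0_distr)
      show "connected {z. Im z > 0}" by (intro convex_connected convex_halfspace_Im_gt)
      show "H (u 0) \<in> {z. Im z > 0}" using G(2)[OF u(1)[of 0]] by simp
    qed (use U lim z in \<open>auto simp: open_halfspace_Im_gt\<close>)
    then show ?thesis by simp
  qed
  show ?thesis by (rule cauchy_G_inject[OF M mu0_distr eq])
qed

end

section \<open>The logarithmic potential\<close>

lemma Re_of_real_mult: "Re (complex_of_real a * z) = a * Re z"
  by simp

text \<open>One-sided, so that it can be integrated over the line with total mass 1; the negative
  part of \<open>ln \<bar>x - y\<bar>\<close> is
  \<open>ln_neg (x - y) + ln_neg (y - x)\<close>.\<close>

definition ln_neg :: "real \<Rightarrow> real" where
  "ln_neg d = indicator {0..1} d * (- ln d)"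

lemma ln_neg_measurable [measurable]: "ln_neg \<in> borel_measurable borel"
  unfolding ln_neg_def[abs_def] by measurable

lemma ln_neg_nonneg: "ln_neg d \<ge> 0"
proof (cases "d = 0")
  case False
  then show ?thesis by (cases "d \<in> {0..1}") (auto simp: ln_neg_def ln_le_zero_iff)
qed (simp add: ln_neg_def)

lemma nn_integral_ln_neg: "(\<integral>\<^sup>+d. ennreal (ln_neg d) \<partial>lborel) = 1"
proof -
  have "((\<lambda>d. - ln d) has_integral (1 - 1 * ln 1) - (0 - 0 * ln 0)) {0..1::real}"
  proof (rule fundamental_theorem_of_calculus_interior)
    \<comment> \<open>At 0 the antiderivative takes the value 0 by \<open>ln 0 = 0\<close>, which is
      also its limit, so it is continuous on the closed interval.\<close>
    have c0: "((\<lambda>d::real. d - d * ln d) \<longlongrightarrow> 0) (at_right 0)" by real_asymp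
    have "continuous (at x within {0..1}) (\<lambda>d::real. d - d * ln d)" if "x \<in> {0..1}" for x
    proof (cases "x = 0")
      case True
      then show ?thesis using c0 by (simp add: continuous_within at_within_Icc_at_right)
    next
      case False
      then show ?thesis using that by (intro continuous_intros) auto
    qed
    then show "continuous_on {0..1} (\<lambda>d::real. d - d * ln d)"
      by (simp add: continuous_on_eq_continuous_within)
    fix x :: real assume x: "x \<in> {0<..<1}"
    have "((\<lambda>d. d - d * ln d) has_real_derivative - ln x) (at x)"
      using x by (auto intro!: derivative_eq_intros)
    then show "((\<lambda>d. d - d * ln d) has_vector_derivative - ln x) (at x)"
      by (simp add: has_real_derivative_iff_has_vector_derivative)
  qed simp
  then have I: "((\<lambda>d. - ln d) has_integral 1) {0..1::real}" by simp
  have "- ln x \<ge> 0" if "x \<in> {0..1}" for x :: real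
    using ln_neg_nonneg[of x] that by (simp add: ln_neg_def)
  from nn_integral_has_integral_lebesgue[OF this I] show ?thesis
    by (simp add: ln_neg_def)
qed

text \<open>From \<open>\<bar>x - y\<bar> \<le> (1 + x) * (1 + y)\<close>. The bound is a sum of
  functions of one variable, hence comparable with the two halves of the potential.\<close>

lemma ln_abs_diff_le:
  fixes x y :: real
  assumes "x > 0" "y > 0"
  shows "ln \<bar>x - y\<bar> \<le> ln (1 + x) + ln (1 + y)"
proof (cases "x = y")
  case True
  then show ?thesis using assms by simp
next
  case False
  have "(1 + x) * (1 + y) = 1 + x + y + x * y" by (simp add: algebra_simps)
  moreover have "x * y > 0" using assms by simp
  ultimately have "\<bar>x - y\<bar> \<le> (1 + x) * (1 + y)" using assms by linarith
  then have "ln \<bar>x - y\<bar> \<le> ln ((1 + x) * (1 + y))" using False by (intro ln_mono) auto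
  also have "\<dots> = ln (1 + x) + ln (1 + y)" using assms by (intro ln_mult_pos) auto
  finally show ?thesis .
qed

lemma abs_ln_le:
  assumes "x > 0" "y > 0"
  shows "\<bar>ln \<bar>x - y\<bar>\<bar> \<le> ln_neg (x - y) + ln_neg (y - x) + (ln (1 + x) + ln (1 + y))"
proof -
  have p: "ln (1 + x) \<ge> 0" "ln (1 + y) \<ge> 0" using assms by auto
  note n = ln_neg_nonneg[of "x - y"] ln_neg_nonneg[of "y - x"]
  consider "x = y" | "0 < \<bar>x - y\<bar>" "\<bar>x - y\<bar> \<le> 1" | "\<bar>x - y\<bar> > 1" by force
  then show ?thesis
  proof cases
    case 1
    then show ?thesis using p n by simp
  next
    case 2
    have "\<bar>ln \<bar>x - y\<bar>\<bar> = - ln \<bar>x - y\<bar>" using 2 by (simp add: ln_le_zero_iff)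
    also have "\<dots> \<le> ln_neg (x - y) + ln_neg (y - x)"
      using 2 n by (cases "x > y") (auto simp: ln_neg_def)
    finally show ?thesis using p by linarith
  next
    case 3
    have "ln \<bar>x - y\<bar> \<le> ln (1 + x) + ln (1 + y)" using assms by (rule ln_abs_diff_le)
    moreover have "ln \<bar>x - y\<bar> \<ge> 0" using 3 by simp
    ultimately show ?thesis using n by linarith
  qed
qed

section \<open>Integrability of the logarithm against the candidate\<close>

context free_beta_prime
begin

text \<open>An upper bound of the density: the semicircle is at most \<open>r\<close>, and
  \<open>x * (x + s) \<ge> (m - r)^2\<close> on the support.\<close>

definition "D = t * r / (2 * pi * \<theta> * ((m - r) * (m - r)))"

lemma D_nonneg: "D \<ge> 0"
  using t r_pos \<theta> by (simp add: D_def)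

lemma dens_le: "dens x \<le> D"
proof (cases "x \<in> {m - r<..<m + r}")
  case True
  have "t * semicircle m r x \<le> t * r" using semicircle_le[of r m x] r_pos t by simp
  moreover have "(m - r) * (m - r) \<le> x * (x + s)"
    using True mr_pos s_nonneg by (intro mult_mono) auto
  then have "2 * pi * \<theta> * ((m - r) * (m - r)) \<le> 2 * pi * \<theta> * (x * (x + s))"
    using \<theta> by (intro mult_left_mono) auto
  moreover have "0 < 2 * pi * \<theta> * ((m - r) * (m - r))" using \<theta> mr_pos by simp
  ultimately have "t * semicircle m r x / (2 * pi * \<theta> * (x * (x + s))) \<le> D"
    unfolding D_def using t r_pos by (intro frac_le) auto
  then show ?thesis by (simp add: dens_def mult.assoc)
next
  case False
  then show ?thesis using semicircle_outside[of r x m] r_pos D_nonneg by (simp add: dens_def)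
qed

lemma mu0_prob_space: "prob_space mu0"
  using mu0_distr by (simp add: real_distribution_def)

lemma sets_mu0 [measurable_cong]: "sets mu0 = sets borel"
  by (simp add: mu0_def)

lemma space_mu0 [simp]: "space mu0 = UNIV"
  by (simp add: mu0_def)

definition "K0 = 2 * D + ln (1 + (m + r))"

lemma K0_nonneg: "K0 \<ge> 0"
  using D_nonneg mr_sum_pos by (simp add: K0_def)

text \<open>Since the density is at most \<open>D\<close>, the logarithmic singularity costs at most
  \<open>D\<close> on each side of \<open>x\<close>; away from it the support bounds the logarithm.
  The bound grows only like \<open>ln (1 + x)\<close>.\<close>

lemma nn_integral_abs_ln_mu0:
  assumes x: "x > 0"
  shows "(\<integral>\<^sup>+y. ennreal \<bar>ln \<bar>x - y\<bar>\<bar> \<partial>mu0) \<le> ennreal (K0 + ln (1 + x))"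
proof -
  interpret M: prob_space mu0 by (rule mu0_prob_space)
  have "(\<integral>\<^sup>+y. ennreal \<bar>ln \<bar>x - y\<bar>\<bar> \<partial>mu0)
    \<le> (\<integral>\<^sup>+y. (ennreal (ln_neg (x - y)) + ennreal (ln_neg (y - x))) + ennreal (ln (1 + x) + ln (1 + (m + r))) \<partial>mu0)"
  proof (rule nn_integral_mono_AE)
    show "AE y in mu0. ennreal \<bar>ln \<bar>x - y\<bar>\<bar> \<le> (ennreal (ln_neg (x - y)) + ennreal (ln_neg (y - x))) + ennreal (ln (1 + x) + ln (1 + (m + r)))"
      using mu0_support
    proof eventually_elim
      case (elim y)
      then have y: "y > 0" using mr_pos by auto
      have "ln (1 + y) \<le> ln (1 + (m + r))" using y elim by (subst ln_le_cancel_iff) auto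
      then have "\<bar>ln \<bar>x - y\<bar>\<bar> \<le> ln_neg (x - y) + ln_neg (y - x) + (ln (1 + x) + ln (1 + (m + r)))"
        using abs_ln_le[OF x y] by linarith
      then have "ennreal \<bar>ln \<bar>x - y\<bar>\<bar> \<le> ennreal (ln_neg (x - y) + ln_neg (y - x) + (ln (1 + x) + ln (1 + (m + r))))"
        by (rule ennreal_leI)
      also have "\<dots> = (ennreal (ln_neg (x - y)) + ennreal (ln_neg (y - x))) + ennreal (ln (1 + x) + ln (1 + (m + r)))"
        using ln_neg_nonneg x mr_sum_pos by (simp add: ennreal_plus)
      finally show ?case .
    qed
  qed
  also have "\<dots> = (\<integral>\<^sup>+y. ennreal (ln_neg (x - y)) \<partial>mu0) + (\<integral>\<^sup>+y. ennreal (ln_neg (y - x)) \<partial>mu0) + ennreal (ln (1 + x) + ln (1 + (m + r)))"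
    using M.emeasure_space_1 by (simp add: nn_integral_add)
  also have "\<dots> \<le> ennreal D + ennreal D + ennreal (ln (1 + x) + ln (1 + (m + r)))"
  proof (intro add_mono order_refl)
    have *: "(\<integral>\<^sup>+y. ennreal (f y) \<partial>mu0) \<le> ennreal D" if "(\<integral>\<^sup>+y. ennreal (f y) \<partial>lborel) = 1" "f \<in> borel_measurable borel" for f
    proof -
      note [measurable] = that(2)
      have "(\<integral>\<^sup>+y. ennreal (f y) \<partial>mu0) = (\<integral>\<^sup>+y. ennreal (dens y) * ennreal (f y) \<partial>lborel)"
        unfolding mu0_def by (subst nn_integral_density) auto
      also have "\<dots> \<le> (\<integral>\<^sup>+y. ennreal D * ennreal (f y) \<partial>lborel)"
        by (intro nn_integral_mono mult_right_mono ennreal_leI dens_le) simp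
      also have "\<dots> = ennreal D" using that by (simp add: nn_integral_cmult)
      finally show ?thesis .
    qed
    have "(\<integral>\<^sup>+y. ennreal (ln_neg (x - y)) \<partial>lborel) = 1"
      using nn_integral_real_affine[of "\<lambda>d. ennreal (ln_neg d)" "-1" x] nn_integral_ln_neg by simp
    then show "(\<integral>\<^sup>+y. ennreal (ln_neg (x - y)) \<partial>mu0) \<le> ennreal D" by (rule *) measurable
    have "(\<integral>\<^sup>+y. ennreal (ln_neg (y - x)) \<partial>lborel) = 1"
      using nn_integral_real_affine[of "\<lambda>d. ennreal (ln_neg d)" "1" "-x"] nn_integral_ln_neg by simp
    then show "(\<integral>\<^sup>+y. ennreal (ln_neg (y - x)) \<partial>mu0) \<le> ennreal D" by (rule *) measurable
  qed
  also have "\<dots> = ennreal (K0 + ln (1 + x))"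
    using D_nonneg x mr_sum_pos by (simp add: K0_def flip: ennreal_plus)
  finally show ?thesis .
qed

lemma integrable_ln_mu0:
  assumes x: "x > 0"
  shows "integrable mu0 (\<lambda>y. ln \<bar>x - y\<bar>)"
proof (rule integrableI_bounded)
  show "(\<integral>\<^sup>+y. ennreal (norm (ln \<bar>x - y\<bar>)) \<partial>mu0) < \<infinity>"
    using nn_integral_abs_ln_mu0[OF x] by (simp add: le_less_trans[OF _ ennreal_less_top])
qed measurable

lemma mu0_no_atom: "AE y in mu0. x \<noteq> y"
proof -
  have "AE y in lborel. x \<noteq> y" using AE_lborel_singleton[of x] by eventually_elim auto
  then show ?thesis unfolding mu0_def by (subst AE_density) auto
qed

definition U :: "real \<Rightarrow> real" where
  "U x = (\<integral>y. ln \<bar>x - y\<bar> \<partial>mu0)"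

text \<open>A logarithmic moment of \<open>N\<close> absorbs the growth of the bound above. Atoms of
  \<open>N\<close> do no harm, because \<open>mu0\<close> has none and the diagonal is a null
  set.\<close>

lemma finite_log_energy_mu0:
  assumes N: "real_distribution N" and pos: "AE x in N. x > 0" and int: "integrable N (\<lambda>x. ln (1 + x))"
  shows "finite_log_energy N mu0" and "integrable N U" and "log_energy N mu0 = (\<integral>x. U x \<partial>N)"
proof -
  interpret N: real_distribution N by fact
  interpret M: prob_space mu0 by (rule mu0_prob_space)
  interpret P: pair_prob_space N mu0 ..
  note [measurable_cong] = N.events_eq_borel
  have 1: "AE p in N \<Otimes>\<^sub>M mu0. fst p \<noteq> snd p"
  proof (rule P.AE_pair_measure)
    show "{p \<in> space (N \<Otimes>\<^sub>M mu0). fst p \<noteq> snd p} \<in> sets (N \<Otimes>\<^sub>M mu0)" by measurable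
  qed (auto intro: mu0_no_atom)
  have "(\<integral>\<^sup>+p. ennreal (norm (ln \<bar>fst p - snd p\<bar>)) \<partial>(N \<Otimes>\<^sub>M mu0)) = (\<integral>\<^sup>+x. (\<integral>\<^sup>+y. ennreal \<bar>ln \<bar>x - y\<bar>\<bar> \<partial>mu0) \<partial>N)"
    by (subst M.nn_integral_fst[symmetric]) auto
  also have "\<dots> \<le> (\<integral>\<^sup>+x. ennreal (K0 + ln (1 + x)) \<partial>N)"
    by (rule nn_integral_mono_AE, rule AE_mp[OF pos], rule AE_I2) (auto intro: nn_integral_abs_ln_mu0)
  also have "\<dots> < \<infinity>"
  proof -
    have "(\<integral>\<^sup>+x. ennreal (K0 + ln (1 + x)) \<partial>N) = ennreal (\<integral>x. K0 + ln (1 + x) \<partial>N)"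
    proof (rule nn_integral_eq_integral)
      show "AE x in N. 0 \<le> K0 + ln (1 + x)"
        using pos by eventually_elim (use K0_nonneg in auto)
    qed (use int in auto)
    then show ?thesis by simp
  qed
  finally have 2: "integrable (N \<Otimes>\<^sub>M mu0) (\<lambda>p. ln \<bar>fst p - snd p\<bar>)"
    by (intro integrableI_bounded) auto
  show "finite_log_energy N mu0"
    using 1 2 by (simp add: finite_log_energy_def)
  show "integrable N U" unfolding U_def using P.integrable_fst'[OF 2] by simp
  show "log_energy N mu0 = (\<integral>x. U x \<partial>N)"
    unfolding log_energy_def U_def using P.integral_fst'[OF 2] by simp
qed

section \<open>Boundary values of the Cauchy transform on the real axis\<close>

definition W :: "complex \<Rightarrow> complex" where
  "W z = complex_of_real (2 * \<theta>) * z * (z + complex_of_real s) * cauchy_G mu0 z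
    - (complex_of_real (2 * \<theta> + t) * z + complex_of_real c)"

text \<open>\<open>t^2 * P\<close> is the discriminant of the quadratic
  \<open>A G^2 - B G + (\<theta> + t) = 0\<close> of the Cauchy transform, and
  \<open>W = 2 A G - B\<close> is one of its two square roots.\<close>

definition P :: "complex \<Rightarrow> complex" where
  "P z = (z - complex_of_real m)\<^sup>2 - (complex_of_real r)\<^sup>2"

lemma W_sq: "Im z > 0 \<Longrightarrow> (W z)\<^sup>2 = t\<^sup>2 * P z"
  unfolding W_def P_def by (rule mu0_quadratic)

text \<open>\<open>W\<close> is \<open>-t\<close> times the branch of the square root of \<open>P\<close> with positive imaginary part, so its
  real part is an explicit continuous function up to the real axis.\<close>
lemma Re_W:
  assumes z: "Im z > 0"
  shows "Re (W z) = - t * sgn (Re z - m) * sqrt ((cmod (P z) + Re (P z)) / 2)"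
proof -
  have nz: "z \<noteq> complex_of_real x" for x using z by auto
  have "W z = t * (semicircle_transform m r z / pi - (z - m))"
    unfolding W_def by (rule cauchy_G_mu0(2)[OF nz])
  then have "Re (W z) * Re (z - m) = t * (Re (semicircle_transform m r z / pi - (z - m)) * Re (z - m))"
    by (simp only: Re_of_real_mult mult.assoc)
  also have "\<dots> \<le> 0"
    by (rule mult_nonneg_nonpos[OF less_imp_le[OF t] semicircle_transform(3)[OF r_pos nz]])
  finally have sgn: "Re (W z) * (Re z - m) \<le> 0" by simp
  have cm: "(cmod (W z))\<^sup>2 = t\<^sup>2 * cmod (P z)"
    using arg_cong[OF W_sq[OF z], of cmod] by (simp add: norm_power norm_mult)
  have re: "(Re (W z))\<^sup>2 - (Im (W z))\<^sup>2 = t\<^sup>2 * Re (P z)"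
    using arg_cong[OF W_sq[OF z], of Re] by (simp add: Re_of_real_mult power2_eq_square flip: of_real_mult)
  have "(Re (W z))\<^sup>2 = t\<^sup>2 * ((cmod (P z) + Re (P z)) / 2)"
    using cm re unfolding cmod_power2 by (simp add: algebra_simps)
  then have ab: "\<bar>Re (W z)\<bar> = t * sqrt ((cmod (P z) + Re (P z)) / 2)"
    using t by (metis real_sqrt_abs real_sqrt_mult abs_of_pos)
  show ?thesis
  proof (cases "Re z - m" "0::real" rule: linorder_cases)
    case less
    with sgn have "Re (W z) \<ge> 0" by (simp add: mult_le_0_iff)
    with ab less show ?thesis by simp
  next
    \<comment> \<open>On the vertical line through \<open>m\<close> the value of \<open>P\<close> is
      real and negative, so its root is purely imaginary, in accordance with
      \<open>sgn 0 = 0\<close>.\<close>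
    case equal
    then have P: "P z = complex_of_real (- (Im z)\<^sup>2 - r\<^sup>2)"
      unfolding P_def by (simp add: complex_eq_iff power2_eq_square)
    have "cmod (P z) = (Im z)\<^sup>2 + r\<^sup>2" unfolding P norm_of_real by simp
    then have "cmod (P z) + Re (P z) = 0" by (simp add: P)
    with ab equal show ?thesis by simp
  next
    case greater
    with sgn have "Re (W z) \<le> 0" by (simp add: mult_le_0_iff)
    with ab greater show ?thesis by simp
  qed
qed

lemma cmod_W: "Im z > 0 \<Longrightarrow> cmod (W z) = t * sqrt (cmod (P z))"
proof -
  assume z: "Im z > 0"
  have "(cmod (W z))\<^sup>2 = t\<^sup>2 * cmod (P z)"
    using arg_cong[OF W_sq[OF z], of cmod] by (simp add: norm_power norm_mult)
  then show ?thesis using t by (metis real_sqrt_abs real_sqrt_mult abs_of_pos abs_norm_cancel)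
qed

text \<open>\<open>- w\<close> is the boundary value of the real part of \<open>W\<close>; it
  vanishes on the support, where the discriminant is not positive.\<close>

definition w :: "real \<Rightarrow> real" where
  "w x = t * sgn (x - m) * sqrt (max 0 ((x - m)\<^sup>2 - r\<^sup>2))"

definition B :: "real \<Rightarrow> real" where
  "B x = (2 * \<theta> + t) * x + c"

text \<open>The boundary value of the real part of the Cauchy transform, which on the support stands
  for a principal value integral.\<close>

definition g :: "real \<Rightarrow> real" where
  "g x = (B x - w x) / (2 * \<theta> * x * (x + s))"

lemma g_measurable [measurable]: "g \<in> borel_measurable borel"
  unfolding g_def[abs_def] w_def B_def by measurable

abbreviation zn :: "real \<Rightarrow> nat \<Rightarrow> complex" where
  "zn x n \<equiv> complex_of_real x + \<i> * complex_of_real (1 / real (Suc n))"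

lemma zn_lim: "zn x \<longlonglongrightarrow> complex_of_real x"
proof -
  have "(\<lambda>n. complex_of_real x + \<i> * complex_of_real (inverse (real (Suc n)))) \<longlonglongrightarrow> complex_of_real x + \<i> * complex_of_real 0"
    by (intro tendsto_intros LIMSEQ_inverse_real_of_nat)
  then show ?thesis by (simp add: inverse_eq_divide)
qed

lemma Im_zn: "Im (zn x n) > 0" by simp

lemma cauchy_G_W:
  assumes "Im z > 0"
  shows "cauchy_G mu0 z = (W z + (of_real (2 * \<theta> + t) * z + c)) * (1 / (of_real (2 * \<theta>) * z * (z + s)))"
proof -
  have "z \<noteq> 0" "z + complex_of_real s \<noteq> 0" "complex_of_real (2 * \<theta>) \<noteq> 0" using assms \<theta> by (auto simp: complex_eq_iff)
  then have "complex_of_real (2 * \<theta>) * z * (z + s) \<noteq> 0" by simp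
  then show ?thesis unfolding W_def by simp
qed

lemma Re_G_lim:
  assumes x: "x > 0"
  shows "(\<lambda>n. Re (cauchy_G mu0 (zn x n))) \<longlonglongrightarrow> g x"
proof -
  let ?q = "\<lambda>n. 1 / (complex_of_real (2 * \<theta>) * zn x n * (zn x n + s))"
  let ?b = "\<lambda>n. (complex_of_real (2 * \<theta> + t) * zn x n + c)"
  have xs: "complex_of_real x + complex_of_real s \<noteq> 0" using x s_nonneg by (simp flip: of_real_add)
  have q: "?q \<longlonglongrightarrow> 1 / (complex_of_real (2 * \<theta>) * complex_of_real x * (complex_of_real x + s))"
    by (intro tendsto_intros zn_lim) (use x xs \<theta> in auto)
  have b: "?b \<longlonglongrightarrow> complex_of_real (2 * \<theta> + t) * complex_of_real x + c"
    by (intro tendsto_intros zn_lim)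
  have P: "(\<lambda>n. P (zn x n)) \<longlonglongrightarrow> P (complex_of_real x)"
    unfolding P_def by (intro tendsto_intros zn_lim)
  have Px: "P (complex_of_real x) = complex_of_real ((x - m)\<^sup>2 - r\<^sup>2)" by (simp add: P_def)
  have ReW: "(\<lambda>n. Re (W (zn x n))) \<longlonglongrightarrow> - w x"
  proof -
    have "(\<lambda>n. - t * sgn (x - m) * sqrt ((cmod (P (zn x n)) + Re (P (zn x n))) / 2))
      \<longlonglongrightarrow> - t * sgn (x - m) * sqrt ((cmod (P (complex_of_real x)) + Re (P (complex_of_real x))) / 2)"
      by (intro tendsto_intros P) simp
    moreover have "Re (W (zn x n)) = - t * sgn (x - m) * sqrt ((cmod (P (zn x n)) + Re (P (zn x n))) / 2)" for n
      using Re_W[OF Im_zn, of x n] by simp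
    moreover have "(\<bar>v\<bar> + v) / 2 = max 0 v" for v :: real by (simp add: max_def)
    then have "- t * sgn (x - m) * sqrt ((cmod (P (complex_of_real x)) + Re (P (complex_of_real x))) / 2) = - w x"
      unfolding Px w_def by (simp only: norm_of_real Re_complex_of_real)
    ultimately show ?thesis by simp
  qed
  \<comment> \<open>\<open>Im W\<close> is merely bounded by \<open>cmod_W\<close>, but
    \<open>?q\<close> has a real limit, so the product with \<open>Im (?q n)\<close> vanishes and
    the limit of \<open>Re W\<close> determines that of \<open>Re G\<close>.\<close>
  have ImW: "(\<lambda>n. Im (W (zn x n)) * Im (?q n)) \<longlonglongrightarrow> 0"
  proof (rule Lim_null_comparison)
    have "(\<lambda>n. t * sqrt (cmod (P (zn x n))) * \<bar>Im (?q n)\<bar>) \<longlonglongrightarrow>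
       t * sqrt (cmod (P (complex_of_real x))) * \<bar>Im (1 / (complex_of_real (2 * \<theta>) * complex_of_real x * (complex_of_real x + s)))\<bar>"
      by (intro tendsto_intros P q)
    also have "Im (1 / (complex_of_real (2 * \<theta>) * complex_of_real x * (complex_of_real x + s))) = 0"
      by (metis Im_complex_of_real of_real_1 of_real_add of_real_divide of_real_mult)
    finally show "(\<lambda>n. t * sqrt (cmod (P (zn x n))) * \<bar>Im (?q n)\<bar>) \<longlonglongrightarrow> 0" by simp
    show "\<forall>\<^sub>F n in sequentially. norm (Im (W (zn x n)) * Im (?q n)) \<le> t * sqrt (cmod (P (zn x n))) * \<bar>Im (?q n)\<bar>"
    proof (intro always_eventually allI)
      fix n
      have "\<bar>Im (W (zn x n))\<bar> \<le> t * sqrt (cmod (P (zn x n)))"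
        using abs_Im_le_cmod[of "W (zn x n)"] cmod_W[OF Im_zn] by metis
      then show "norm (Im (W (zn x n)) * Im (?q n)) \<le> t * sqrt (cmod (P (zn x n))) * \<bar>Im (?q n)\<bar>"
        unfolding real_norm_def abs_mult by (intro mult_right_mono) auto
    qed
  qed
  have "(\<lambda>n. Re (W (zn x n)) * Re (?q n) - Im (W (zn x n)) * Im (?q n) + Re (?b n * ?q n)) \<longlonglongrightarrow>
     - w x * Re (1 / (complex_of_real (2 * \<theta>) * complex_of_real x * (complex_of_real x + s))) - 0
      + Re ((complex_of_real (2 * \<theta> + t) * complex_of_real x + c) * (1 / (complex_of_real (2 * \<theta>) * complex_of_real x * (complex_of_real x + s))))"
    by (intro tendsto_add tendsto_diff tendsto_mult ReW ImW tendsto_Re q b)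
  also have "(\<lambda>n. Re (W (zn x n)) * Re (?q n) - Im (W (zn x n)) * Im (?q n) + Re (?b n * ?q n)) = (\<lambda>n. Re (cauchy_G mu0 (zn x n)))"
  proof (rule ext)
    fix n
    have "Re (cauchy_G mu0 (zn x n)) = Re (W (zn x n) * ?q n + ?b n * ?q n)"
      unfolding cauchy_G_W[OF Im_zn] by (simp only: distrib_right)
    then show "Re (W (zn x n)) * Re (?q n) - Im (W (zn x n)) * Im (?q n) + Re (?b n * ?q n) = Re (cauchy_G mu0 (zn x n))"
      by (simp only: plus_complex.sel times_complex.sel)
  qed
  also have "1 / (complex_of_real (2 * \<theta>) * complex_of_real x * (complex_of_real x + s)) = complex_of_real (1 / (2 * \<theta> * x * (x + s)))"
    by simp
  also have "(complex_of_real (2 * \<theta> + t) * complex_of_real x + c) * complex_of_real (1 / (2 * \<theta> * x * (x + s)))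
    = complex_of_real (B x * (1 / (2 * \<theta> * x * (x + s))))"
    by (simp add: B_def)
  also have "- w x * Re (complex_of_real (1 / (2 * \<theta> * x * (x + s)))) - 0 + Re (complex_of_real (B x * (1 / (2 * \<theta> * x * (x + s))))) = g x"
    unfolding g_def by (simp add: diff_divide_distrib)
  finally show ?thesis .
qed

text \<open>The bound for dominated convergence in \<open>U_diff\<close>: on a compact interval away
  from 0 and \<open>- s\<close> the modulus of \<open>W\<close> is controlled by that of the
  polynomial \<open>P\<close>, uniformly in the height.\<close>

lemma Re_G_bound:
  assumes a: "a > 0" and ab: "a \<le> b"
  obtains C where "\<And>x n. x \<in> {a..b} \<Longrightarrow> \<bar>Re (cauchy_G mu0 (zn x n))\<bar> \<le> C"
proof -
  define S where "S = ((b + 1 + m)\<^sup>2 + r\<^sup>2)"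
  define C where "C = (t * sqrt S + ((2 * \<theta> + t) * (b + 1) + \<bar>c\<bar>)) / (2 * \<theta> * a * a)"
  have "\<bar>Re (cauchy_G mu0 (zn x n))\<bar> \<le> C" if x: "x \<in> {a..b}" for x n
  proof -
    define z where "z = zn x n"
    have z: "Im z > 0" unfolding z_def by (rule Im_zn)
    have zb: "cmod z \<le> b + 1"
    proof -
      have "cmod z \<le> cmod (complex_of_real x) + cmod (\<i> * complex_of_real (1 / real (Suc n)))"
        unfolding z_def by (rule norm_triangle_ineq)
      also have "\<dots> = \<bar>x\<bar> + 1 / real (Suc n)"
        unfolding norm_mult norm_of_real by simp
      also have "\<dots> \<le> b + 1" using x a by (intro add_mono) auto
      finally show ?thesis .
    qed
    have za: "cmod z \<ge> a" "cmod (z + s) \<ge> a"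
      using complex_Re_le_cmod[of z] complex_Re_le_cmod[of "z + s"] x s_nonneg by (auto simp: z_def)
    have "cmod (P z) \<le> (cmod (z - m))\<^sup>2 + r\<^sup>2"
      unfolding P_def by (rule order_trans[OF norm_triangle_ineq4]) (simp add: norm_power)
    also have "cmod (z - m) \<le> b + 1 + m"
      using norm_triangle_ineq4[of z "complex_of_real m"] zb m_pos by simp
    then have "(cmod (z - m))\<^sup>2 + r\<^sup>2 \<le> S" unfolding S_def by (simp add: power_mono)
    finally have PS: "cmod (P z) \<le> S" .
    have W: "cmod (W z) \<le> t * sqrt S" unfolding cmod_W[OF z] using PS t by (intro mult_left_mono) auto
    have Bz: "cmod (of_real (2 * \<theta> + t) * z + c) \<le> (2 * \<theta> + t) * (b + 1) + \<bar>c\<bar>"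
    proof (rule order_trans[OF norm_triangle_ineq] , intro add_mono)
      show "cmod (of_real (2 * \<theta> + t) * z) \<le> (2 * \<theta> + t) * (b + 1)"
        unfolding norm_mult norm_of_real using zb t \<theta> by (intro mult_mono) auto
    qed simp
    have "\<bar>Re (cauchy_G mu0 z)\<bar> \<le> cmod (cauchy_G mu0 z)" by (rule abs_Re_le_cmod)
    also have "\<dots> = cmod (W z + (of_real (2 * \<theta> + t) * z + c)) / (2 * \<theta> * cmod z * cmod (z + s))"
      unfolding cauchy_G_W[OF z] using \<theta> by (simp add: norm_mult norm_divide)
    also have "\<dots> \<le> C"
      unfolding C_def
    proof (rule frac_le)
      show "cmod (W z + (of_real (2 * \<theta> + t) * z + c)) \<le> t * sqrt S + ((2 * \<theta> + t) * (b + 1) + \<bar>c\<bar>)"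
        by (rule order_trans[OF norm_triangle_ineq]) (intro add_mono W Bz)
      show "0 < 2 * \<theta> * a * a" using \<theta> a by simp
      show "2 * \<theta> * a * a \<le> 2 * \<theta> * cmod z * cmod (z + s)"
        using \<theta> a za by (intro mult_mono) auto
      show "0 \<le> t * sqrt S + ((2 * \<theta> + t) * (b + 1) + \<bar>c\<bar>)"
        using t \<theta> a ab by (simp add: S_def)
    qed
    finally show ?thesis unfolding z_def .
  qed
  then show thesis by (rule that)
qed

end

section \<open>The derivative of the logarithmic potential\<close>

context free_beta_prime
begin

text \<open>The logarithmic potential at the complex point \<open>x + i y\<close>. For
  \<open>y > 0\<close> it is smooth in \<open>x\<close>, with derivative the real part of the Cauchy
  transform there.\<close>

definition Uy :: "real \<Rightarrow> real \<Rightarrow> real" where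
  "Uy y x = (\<integral>v. ln ((x - v)\<^sup>2 + y\<^sup>2) / 2 \<partial>mu0)"

text \<open>Domination uniform in the height \<open>y \<le> 1\<close>: the argument of the logarithm
  lies between \<open>(x - v)^2\<close> and \<open>(x + (m + r) + 1)^2\<close>.\<close>

lemma ln_quad_bound:
  assumes "x > 0" "0 < y" "y \<le> 1" "0 < v" "v < m + r" "x \<noteq> v"
  shows "\<bar>ln ((x - v)\<^sup>2 + y\<^sup>2) / 2\<bar> \<le> \<bar>ln \<bar>x - v\<bar>\<bar> + ln (x + (m + r) + 1)"
proof -
  have d: "(x - v)\<^sup>2 > 0" using assms by simp
  have l: "ln ((x - v)\<^sup>2) = 2 * ln \<bar>x - v\<bar>"
    using assms by (simp add: ln_realpow[of "\<bar>x - v\<bar>" 2, simplified])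
  have lo: "ln ((x - v)\<^sup>2) \<le> ln ((x - v)\<^sup>2 + y\<^sup>2)"
    using d by (intro ln_mono) simp_all
  have "(x - v)\<^sup>2 + y\<^sup>2 \<le> (x + (m + r) + 1)\<^sup>2"
  proof -
    define A where "A = x + (m + r)"
    have A: "A > 0" using assms mr_sum_pos by (simp add: A_def)
    have "\<bar>x - v\<bar> \<le> \<bar>A\<bar>" using assms mr_sum_pos by (auto simp: A_def)
    then have "(x - v)\<^sup>2 \<le> A\<^sup>2" by (simp only: abs_le_square_iff)
    moreover have "y\<^sup>2 \<le> 1" using assms by (simp add: power_le_one)
    moreover have "(A + 1)\<^sup>2 = A\<^sup>2 + 2 * A + 1"
      by (simp add: power2_eq_square algebra_simps)
    ultimately show ?thesis using A unfolding A_def[symmetric] by linarith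
  qed
  then have "ln ((x - v)\<^sup>2 + y\<^sup>2) \<le> ln ((x + (m + r) + 1)\<^sup>2)"
    using d assms mr_sum_pos by (subst ln_le_cancel_iff) (auto intro: add_pos_nonneg)
  also have "\<dots> = 2 * ln (x + (m + r) + 1)"
    using assms mr_sum_pos by (subst ln_realpow) auto
  finally have hi: "ln ((x - v)\<^sup>2 + y\<^sup>2) \<le> 2 * ln (x + (m + r) + 1)" .
  have "ln (x + (m + r) + 1) \<ge> 0" using assms mr_sum_pos by simp
  then show ?thesis using lo hi unfolding l by linarith
qed

lemma Uy_lim:
  assumes x: "x > 0"
  shows "(\<lambda>n. Uy (1 / real (Suc n)) x) \<longlonglongrightarrow> U x"
  unfolding Uy_def U_def
proof (rule integral_dominated_convergence)
  interpret M: prob_space mu0 by (rule mu0_prob_space)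
  show "integrable mu0 (\<lambda>v. \<bar>ln \<bar>x - v\<bar>\<bar> + ln (x + (m + r) + 1))"
    using integrable_ln_mu0[OF x] by simp
  show "AE v in mu0. (\<lambda>n. ln ((x - v)\<^sup>2 + (1 / real (Suc n))\<^sup>2) / 2) \<longlonglongrightarrow> ln \<bar>x - v\<bar>"
    using mu0_no_atom[of x]
  proof eventually_elim
    case (elim v)
    have l: "ln ((x - v)\<^sup>2 + 0\<^sup>2) / 2 = ln \<bar>x - v\<bar>"
      using elim by (simp add: ln_realpow[of "\<bar>x - v\<bar>" 2, simplified])
    have "(\<lambda>n. ln ((x - v)\<^sup>2 + (inverse (real (Suc n)))\<^sup>2) / 2) \<longlonglongrightarrow> ln ((x - v)\<^sup>2 + 0\<^sup>2) / 2"
      using elim by (intro tendsto_intros LIMSEQ_inverse_real_of_nat) auto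
    then show ?case unfolding l by (simp add: inverse_eq_divide)
  qed
  show "AE v in mu0. norm (ln ((x - v)\<^sup>2 + (1 / real (Suc n))\<^sup>2) / 2) \<le> \<bar>ln \<bar>x - v\<bar>\<bar> + ln (x + (m + r) + 1)" for n
    using mu0_no_atom[of x] mu0_support
  proof eventually_elim
    case (elim v)
    then show ?case using ln_quad_bound[of x "1 / real (Suc n)" v] x mr_pos by simp
  qed
qed measurable

text \<open>The fundamental theorem in \<open>x\<close> for each fixed point of the support,
  followed by Fubini's theorem; the kernel is at most \<open>1 / y\<close> by the inequality between
  the arithmetic and geometric means.\<close>

lemma Uy_diff:
  assumes y: "y > 0" and ab: "a \<le> b"
  shows "Uy y b - Uy y a = (\<integral>x. indicator {a..b} x * Re (cauchy_G mu0 (complex_of_real x + \<i> * complex_of_real y)) \<partial>lborel)"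
proof -
  interpret M: prob_space mu0 by (rule mu0_prob_space)
  interpret Q: pair_sigma_finite mu0 lborel ..
  let ?k = "\<lambda>v x. (x - v) / ((x - v)\<^sup>2 + y\<^sup>2)"
  have pos: "(x - v)\<^sup>2 + y\<^sup>2 > 0" for x v using y by (simp add: add_nonneg_pos)
  have k_bound: "\<bar>?k v x\<bar> \<le> 1 / y" for v x
  proof -
    have "2 * (\<bar>x - v\<bar> * y) \<le> (x - v)\<^sup>2 + y\<^sup>2"
      using sum_squares_bound[of "\<bar>x - v\<bar>" y] by (simp add: mult.assoc)
    moreover have "0 \<le> \<bar>x - v\<bar> * y" using y by simp
    ultimately have "\<bar>x - v\<bar> * y \<le> (x - v)\<^sup>2 + y\<^sup>2" by linarith
    then have "\<bar>x - v\<bar> / ((x - v)\<^sup>2 + y\<^sup>2) \<le> 1 / y"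
      using pos[of x v] y by (simp only: pos_divide_le_eq) (simp add: pos_le_divide_eq)
    then show ?thesis using pos[of x v] by (simp only: abs_divide abs_of_pos)
  qed
  have FTC: "has_bochner_integral lborel (\<lambda>x. ?k v x * indicator {a..b} x) (ln ((b - v)\<^sup>2 + y\<^sup>2) / 2 - ln ((a - v)\<^sup>2 + y\<^sup>2) / 2)" for v
  proof (rule has_bochner_integral_FTC_Icc_real[OF ab])
    fix x
    show "((\<lambda>x. ln ((x - v)\<^sup>2 + y\<^sup>2) / 2) has_real_derivative ?k v x) (at x)"
    proof -
      have "((\<lambda>x. (x - v)\<^sup>2 + y\<^sup>2) has_real_derivative 2 * (x - v)) (at x)"
        by (auto intro!: derivative_eq_intros)
      then have "((\<lambda>x. ln ((x - v)\<^sup>2 + y\<^sup>2)) has_real_derivative 1 / ((x - v)\<^sup>2 + y\<^sup>2) * (2 * (x - v))) (at x)"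
        by (rule DERIV_chain2[where f=ln and g="\<lambda>x. (x - v)\<^sup>2 + y\<^sup>2" and x=x, OF DERIV_ln_divide[OF pos]])
      then have "((\<lambda>x. ln ((x - v)\<^sup>2 + y\<^sup>2) / 2) has_real_derivative 1 / ((x - v)\<^sup>2 + y\<^sup>2) * (2 * (x - v)) / 2) (at x)"
        by (rule DERIV_cdivide)
      also have "1 / ((x - v)\<^sup>2 + y\<^sup>2) * (2 * (x - v)) / 2 = ?k v x"
      proof -
        have "1 / q * (2 * e) / 2 = e / q" for q e :: real by simp
        then show ?thesis .
      qed
      finally show ?thesis .
    qed
    show "isCont (?k v) x" using pos[of x v] by (intro continuous_intros) auto
  qed
  have i: "integrable mu0 (\<lambda>v. ln ((x - v)\<^sup>2 + y\<^sup>2) / 2)" for x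
  proof (rule M.integrable_const_bound[where B="\<bar>ln (y\<^sup>2)\<bar> + \<bar>ln ((\<bar>x\<bar> + (m + r))\<^sup>2 + y\<^sup>2)\<bar>"])
    show "AE v in mu0. norm (ln ((x - v)\<^sup>2 + y\<^sup>2) / 2) \<le> \<bar>ln (y\<^sup>2)\<bar> + \<bar>ln ((\<bar>x\<bar> + (m + r))\<^sup>2 + y\<^sup>2)\<bar>"
      using mu0_support
    proof eventually_elim
      case (elim v)
      have "\<bar>x - v\<bar> \<le> \<bar>\<bar>x\<bar> + (m + r)\<bar>" using elim mr_pos by auto
      then have "(x - v)\<^sup>2 \<le> (\<bar>x\<bar> + (m + r))\<^sup>2" by (simp only: abs_le_square_iff)
      then have hi: "ln ((x - v)\<^sup>2 + y\<^sup>2) \<le> ln ((\<bar>x\<bar> + (m + r))\<^sup>2 + y\<^sup>2)"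
        using pos[of x v] by (intro ln_mono) auto
      have lo: "ln (y\<^sup>2) \<le> ln ((x - v)\<^sup>2 + y\<^sup>2)" using y by (intro ln_mono) auto
      show ?case using hi lo by simp
    qed
  qed measurable
  have I: "integrable (mu0 \<Otimes>\<^sub>M lborel) (\<lambda>(v, x). ?k v x * indicator {a..b} x)"
  proof (rule Q.Fubini_integrable)
    show "integrable mu0 (\<lambda>v. \<integral>x. norm (case (v, x) of (v, x) \<Rightarrow> ?k v x * indicator {a..b} x) \<partial>lborel)"
    proof (rule M.integrable_const_bound[where B="1 / y * (b - a)"])
      have "(\<integral>x. norm (?k v x * indicator {a..b} x) \<partial>lborel) \<le> (\<integral>x. 1 / y * indicator {a..b} x \<partial>lborel)" for v
      proof (rule integral_mono)
        show "integrable lborel (\<lambda>x. norm (?k v x * indicator {a..b} x))"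
          using FTC[of v] by (intro integrable_norm) (auto simp: has_bochner_integral_iff)
        show "norm (?k v x * indicator {a..b} x) \<le> 1 / y * indicator {a..b} x" for x
          using k_bound[of x v] by (simp add: indicator_def del: abs_divide)
      qed (use ab in simp)
      moreover have "(\<integral>x. 1 / y * indicator {a..b} x \<partial>lborel) = 1 / y * (b - a)" using ab by simp
      ultimately have *: "(\<integral>x. norm (?k v x * indicator {a..b} x) \<partial>lborel) \<le> 1 / y * (b - a)" for v by metis
      have "norm (\<integral>x. norm (?k v x * indicator {a..b} x) \<partial>lborel) \<le> 1 / y * (b - a)" for v
      proof -
        have "0 \<le> (\<integral>x. norm (?k v x * indicator {a..b} x) \<partial>lborel)" by (rule integral_nonneg_AE) simp
        with *[of v] show ?thesis by (simp only: real_norm_def abs_of_nonneg)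
      qed
      then show "AE v in mu0. norm (\<integral>x. norm (case (v, x) of (v, x) \<Rightarrow> ?k v x * indicator {a..b} x) \<partial>lborel) \<le> 1 / y * (b - a)"
        by simp
    qed measurable
    show "AE v in mu0. integrable lborel (\<lambda>x. case (v, x) of (v, x) \<Rightarrow> ?k v x * indicator {a..b} x)"
      using FTC by (auto simp: has_bochner_integral_iff)
  qed measurable
  have "Uy y b - Uy y a = (\<integral>v. (\<integral>x. ?k v x * indicator {a..b} x \<partial>lborel) \<partial>mu0)"
    unfolding Uy_def has_bochner_integral_integral_eq[OF FTC]
    by (rule Bochner_Integration.integral_diff[OF i i, symmetric])
  also have "\<dots> = (\<integral>x. (\<integral>v. ?k v x * indicator {a..b} x \<partial>mu0) \<partial>lborel)"
    using Q.Fubini_integral[OF I] by simp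
  also have "\<dots> = (\<integral>x. indicator {a..b} x * Re (cauchy_G mu0 (complex_of_real x + \<i> * complex_of_real y)) \<partial>lborel)"
  proof (rule Bochner_Integration.integral_cong[OF refl])
    fix x
    let ?z = "complex_of_real x + \<i> * complex_of_real y"
    have "Re (cauchy_G mu0 ?z) = (\<integral>v. Re (1 / (?z - complex_of_real v)) \<partial>mu0)"
      unfolding cauchy_G_def by (intro integral_Re[symmetric] integrable_cauchy_G mu0_distr) (use y in simp)
    also have "\<dots> = (\<integral>v. ?k v x \<partial>mu0)"
      by (intro Bochner_Integration.integral_cong refl) (simp add: Re_divide)
    finally show "(\<integral>v. ?k v x * indicator {a..b} x \<partial>mu0) = indicator {a..b} x * Re (cauchy_G mu0 ?z)"
      by (simp only: integral_mult_left_zero mult.commute[of "indicator {a..b} x"])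
  qed
  finally show ?thesis .
qed

text \<open>The limit of \<open>Uy_diff\<close> as the height tends to 0: the integrals converge by
  \<open>Re_G_lim\<close> and \<open>Re_G_bound\<close>, the potentials by
  \<open>Uy_lim\<close>.\<close>

lemma U_diff:
  assumes a: "a > 0" and ab: "a \<le> b"
  shows "has_bochner_integral lborel (\<lambda>x. indicator {a..b} x * g x) (U b - U a)"
proof -
  obtain C where C: "\<And>x n. x \<in> {a..b} \<Longrightarrow> \<bar>Re (cauchy_G mu0 (zn x n))\<bar> \<le> C"
    by (rule Re_G_bound[OF a ab]) blast
  interpret M: prob_space mu0 by (rule mu0_prob_space)
  let ?f = "\<lambda>n x. indicator {a..b} x * Re (cauchy_G mu0 (zn x n))"
  have m: "?f n \<in> borel_measurable lborel" for n
    unfolding cauchy_G_def by measurable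
  have C': "integrable lborel (\<lambda>x. indicator {a..b} x * C)" using ab by simp
  have lim: "AE x in lborel. (\<lambda>n. ?f n x) \<longlonglongrightarrow> indicator {a..b} x * g x"
  proof (intro AE_I2)
    fix x
    show "(\<lambda>n. ?f n x) \<longlonglongrightarrow> indicator {a..b} x * g x"
      using Re_G_lim[of x] a by (cases "x \<in> {a..b}") auto
  qed
  have bd: "AE x in lborel. norm (?f n x) \<le> indicator {a..b} x * C" for n
    using C by (intro AE_I2) (auto simp: indicator_def)
  have gm: "(\<lambda>x. indicator {a..b} x * g x) \<in> borel_measurable lborel" by measurable
  have int: "integrable lborel (\<lambda>x. indicator {a..b} x * g x)"
    by (rule integrable_dominated_convergence[OF gm m C' lim bd])
  have "(\<lambda>n. integral\<^sup>L lborel (?f n)) \<longlonglongrightarrow> (\<integral>x. indicator {a..b} x * g x \<partial>lborel)"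
    by (rule integral_dominated_convergence[OF gm m C' lim bd])
  moreover have "integral\<^sup>L lborel (?f n) = Uy (1 / real (Suc n)) b - Uy (1 / real (Suc n)) a" for n
    by (subst Uy_diff[OF _ ab]) auto
  moreover have "(\<lambda>n. Uy (1 / real (Suc n)) b - Uy (1 / real (Suc n)) a) \<longlonglongrightarrow> U b - U a"
    using a ab by (intro tendsto_diff Uy_lim) auto
  ultimately have "(\<integral>x. indicator {a..b} x * g x \<partial>lborel) = U b - U a"
    using LIMSEQ_unique by simp
  with int show ?thesis by (simp add: has_bochner_integral_iff)
qed

section \<open>The equilibrium conditions\<close>

abbreviation V :: "real \<Rightarrow> real" where
  "V \<equiv> Vpot t \<theta> lam"

text \<open>The two formulas for the potential are the primitives of one rational function. It has
  simple poles at 0 and \<open>- s\<close> when \<open>lam > 1\<close>; for \<open>lam = 1\<close>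
  the poles merge into a double one, which produces the term in \<open>1 / x\<close>.\<close>

lemma V_deriv:
  assumes x: "x > 0"
  shows "(V has_real_derivative B x / (\<theta> * x * (x + s))) (at x)"
proof (cases "lam = 1")
  case True
  have Bs: "B x = (2 * \<theta> + t) * x - t\<^sup>2" "s = 0"
    unfolding B_def c_def s_def using True by simp_all
  have "((\<lambda>x. (2 + t / \<theta>) * ln x + t\<^sup>2 / (\<theta> * x)) has_real_derivative B x / (\<theta> * x * (x + s))) (at x)"
    unfolding Bs using x \<theta> by (auto intro!: derivative_eq_intros simp: field_simps power2_eq_square)
  then show ?thesis using True by (simp add: Vpot_def[abs_def])
next
  case False
  then have l: "lam - 1 > 0" using lam1 by simp
  have xs: "x + t * (lam - 1) > 0" using x t l by (simp add: add_pos_pos)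
  have "((\<lambda>x. (1 - t / (\<theta> * (lam - 1))) * ln x + (1 + t * lam / (\<theta> * (lam - 1))) * ln (x + t * (lam - 1)))
     has_real_derivative (1 - t / (\<theta> * (lam - 1))) * (1 / x) + (1 + t * lam / (\<theta> * (lam - 1))) * (1 / (x + t * (lam - 1)))) (at x)"
    using x xs by (auto intro!: derivative_eq_intros)
  also have "(1 - t / (\<theta> * (lam - 1))) * (1 / x) + (1 + t * lam / (\<theta> * (lam - 1))) * (1 / (x + t * (lam - 1)))
    = B x / (\<theta> * x * (x + s))"
  proof -
    define k where "k = lam - 1"
    have lam: "lam = 1 + k" by (simp add: k_def)
    have nz: "k \<noteq> 0" "x \<noteq> 0" "\<theta> \<noteq> 0" "x + t * k \<noteq> 0" using l x \<theta> xs by (auto simp: k_def)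
    have 1: "1 - t / (\<theta> * k) = (\<theta> * k - t) / (\<theta> * k)" "1 + t * lam / (\<theta> * k) = (\<theta> * k + t * (1 + k)) / (\<theta> * k)"
      using nz by (simp_all add: lam field_simps)
    have "(1 - t / (\<theta> * k)) * (1 / x) + (1 + t * lam / (\<theta> * k)) * (1 / (x + t * k))
      = ((\<theta> * k - t) * (x + t * k) + (\<theta> * k + t * (1 + k)) * x) / (\<theta> * k * (x * (x + t * k)))"
      unfolding 1 using nz by (simp add: add_divide_distrib mult_ac)
    also have "(\<theta> * k - t) * (x + t * k) + (\<theta> * k + t * (1 + k)) * x = k * B x"
      unfolding B_def c_def unfolding lam by (simp add: power2_eq_square algebra_simps)
    finally show ?thesis using nz by (simp add: s_def k_def[symmetric] mult_ac)
  qed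
  finally show ?thesis using False by (simp add: Vpot_def[abs_def])
qed

text \<open>In \<open>2 * g\<close> minus the derivative of \<open>V\<close> the linear coefficient
  \<open>B\<close> cancels and only the root of the discriminant remains.\<close>

lemma equilibrium_diff:
  assumes a: "a > 0" and ab: "a \<le> b"
  shows "has_bochner_integral lborel (\<lambda>x. indicator {a..b} x * (- w x / (\<theta> * x * (x + s))))
    ((2 * U b - V b) - (2 * U a - V a))"
proof -
  have "has_bochner_integral lborel (\<lambda>x. B x / (\<theta> * x * (x + s)) * indicator {a..b} x) (V b - V a)"
  proof (rule has_bochner_integral_FTC_Icc_real[OF ab])
    fix x assume x: "a \<le> x"
    then have "x > 0" "x + s > 0" using a s_nonneg by auto
    then show "(V has_real_derivative B x / (\<theta> * x * (x + s))) (at x)"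
      and "isCont (\<lambda>x. B x / (\<theta> * x * (x + s))) x"
      unfolding B_def using \<theta> by (auto intro!: V_deriv[unfolded B_def] continuous_intros)
  qed
  from has_bochner_integral_diff[OF has_bochner_integral_mult_right[OF U_diff[OF a ab], of 2] this]
  have "has_bochner_integral lborel (\<lambda>x. 2 * (indicator {a..b} x * g x) - B x / (\<theta> * x * (x + s)) * indicator {a..b} x)
     (2 * (U b - U a) - (V b - V a))" by simp
  also have "(\<lambda>x. 2 * (indicator {a..b} x * g x) - B x / (\<theta> * x * (x + s)) * indicator {a..b} x)
    = (\<lambda>x. indicator {a..b} x * (- w x / (\<theta> * x * (x + s))))"
  proof (rule ext)
    fix x
    have "2 * (a / (2 * k)) = a / k" for a k :: real by simp
    from this[of "B x - w x" "\<theta> * x * (x + s)"]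
    have "2 * g x = (B x - w x) / (\<theta> * x * (x + s))" unfolding g_def by (simp only: mult.assoc)
    then have "2 * g x - B x / (\<theta> * x * (x + s)) = - w x / (\<theta> * x * (x + s))"
      by (simp add: diff_divide_distrib)
    then show "2 * (indicator {a..b} x * g x) - B x / (\<theta> * x * (x + s)) * indicator {a..b} x
      = indicator {a..b} x * (- w x / (\<theta> * x * (x + s)))"
      by (simp add: indicator_def)
  qed
  finally show ?thesis by (simp add: algebra_simps)
qed

text \<open>The equilibrium constant, evaluated at the centre because \<open>w\<close> changes sign
  around it.\<close>

definition "ell = 2 * U m - V m"

text \<open>The integrand in \<open>equilibrium_diff\<close> is nonpositive to the right of
  \<open>m\<close> and nonnegative to the left, so \<open>2 U - V\<close> does not increase when
  moving away from the centre in either direction.\<close>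

lemma equilibrium_le:
  assumes x: "x > 0"
  shows "2 * U x - V x \<le> ell"
proof (cases "x \<ge> m")
  case True
  note I = equilibrium_diff[OF m_pos True]
  have "(\<integral>v. indicator {m..x} v * (- w v / (\<theta> * v * (v + s))) \<partial>lborel) \<le> (\<integral>v. 0 \<partial>(lborel :: real measure))"
  proof (rule integral_mono)
    fix v
    have "- w v / (\<theta> * v * (v + s)) \<le> 0" if "v \<ge> m"
      using that m_pos s_nonneg \<theta> t by (intro divide_nonpos_nonneg) (auto simp: w_def sgn_if)
    then show "indicator {m..x} v * (- w v / (\<theta> * v * (v + s))) \<le> 0"
      by (cases "v \<in> {m..x}") auto
  qed (use I in \<open>auto simp: has_bochner_integral_iff\<close>)
  then show ?thesis using I by (simp add: has_bochner_integral_iff ell_def)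
next
  case False
  note I = equilibrium_diff[OF x, of m]
  have "(\<integral>v. 0 \<partial>(lborel :: real measure)) \<le> (\<integral>v. indicator {x..m} v * (- w v / (\<theta> * v * (v + s))) \<partial>lborel)"
  proof (rule integral_mono)
    fix v
    have "- w v / (\<theta> * v * (v + s)) \<ge> 0" if "v \<le> m" "v \<ge> x"
      using that x s_nonneg \<theta> t by (intro divide_nonneg_nonneg) (auto simp: w_def sgn_if)
    then show "0 \<le> indicator {x..m} v * (- w v / (\<theta> * v * (v + s)))"
      by (cases "v \<in> {x..m}") auto
  qed (use I False in \<open>auto simp: has_bochner_integral_iff\<close>)
  then show ?thesis using I False by (simp add: has_bochner_integral_iff ell_def)
qed

lemma w_support: "x \<in> {m - r..m + r} \<Longrightarrow> w x = 0"
proof -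
  assume "x \<in> {m - r..m + r}"
  then have "\<bar>x - m\<bar> \<le> \<bar>r\<bar>" by auto
  then have "(x - m)\<^sup>2 \<le> r\<^sup>2" by (simp only: abs_le_square_iff)
  then show ?thesis by (simp add: w_def)
qed

lemma equilibrium_eq:
  assumes x: "x \<in> {m - r..m + r}"
  shows "2 * U x - V x = ell"
proof -
  have *: "2 * U b - V b = 2 * U a - V a" if "a \<le> b" "a \<in> {m - r..m + r}" "b \<in> {m - r..m + r}" for a b
  proof -
    have "(\<lambda>v. indicator {a..b} v * (- w v / (\<theta> * v * (v + s)))) = (\<lambda>v. 0)"
      using w_support that by (auto simp: fun_eq_iff indicator_def)
    then show ?thesis
      using equilibrium_diff[OF support_pos[OF that(2)] that(1)] by (simp add: has_bochner_integral_iff)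
  qed
  have "m \<in> {m - r..m + r}" using r_pos by auto
  then show ?thesis using *[of x m] *[of m x] x unfolding ell_def by linarith
qed

end

section \<open>The energy functional\<close>

lemma e2ennreal_max_ereal: "e2ennreal (max (ereal x) 0) = ennreal x"
proof -
  have "max (ereal x) 0 = ereal (max x 0)" by (simp add: max_def zero_ereal_def)
  then show ?thesis by (simp add: max_def ennreal_neg)
qed

lemma prob_on_posD:
  assumes "prob_on_pos N"
  shows "real_distribution N" "AE x in N. x > 0"
proof -
  have s: "sets N = sets borel" and p: "prob_space N" and e: "emeasure N {0<..} = 1"
    using assms by (auto simp: prob_on_pos_def)
  interpret N: prob_space N by fact
  show "real_distribution N"
    using s p by (simp add: real_distribution_def real_distribution_axioms_def sets_eq_imp_space_eq[OF s])
  have "N.prob {0<..} = 1" using e by (simp add: measure_def)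
  then have "AE x in N. x \<in> {0<..}" using s by (subst N.AE_in_set_eq_1) auto
  then show "AE x in N. x > 0" by simp
qed

lemma integrable_fstD:
  fixes f :: "real \<Rightarrow> real"
  assumes N: "real_distribution N" and int: "integrable (N \<Otimes>\<^sub>M N) (\<lambda>p. f (fst p))"
  shows "integrable N f"
proof -
  interpret N: real_distribution N by fact
  interpret NN: pair_prob_space N N ..
  have "integrable N (\<lambda>x. \<integral>y. f (fst (x, y)) \<partial>N)" by (rule NN.integrable_fst'[OF int])
  then show ?thesis using N.prob_space by simp
qed

lemma integral_component:
  fixes f :: "real \<Rightarrow> real"
  assumes N: "real_distribution N" and int: "integrable N f"
  shows "has_bochner_integral (N \<Otimes>\<^sub>M N) (\<lambda>p. f (fst p)) (\<integral>x. f x \<partial>N)"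
    and "has_bochner_integral (N \<Otimes>\<^sub>M N) (\<lambda>p. f (snd p)) (\<integral>x. f x \<partial>N)"
proof -
  interpret N: real_distribution N by fact
  interpret NN: pair_prob_space N N ..
  have "integrable (N \<Otimes>\<^sub>M N) (\<lambda>(x, y). f x)"
    by (rule NN.Fubini_integrable) (use int N.prob_space in auto)
  from this NN.integral_fst'[OF this] show "has_bochner_integral (N \<Otimes>\<^sub>M N) (\<lambda>p. f (fst p)) (\<integral>x. f x \<partial>N)"
    using N.prob_space by (simp add: has_bochner_integral_iff case_prod_beta')
  have "integrable (N \<Otimes>\<^sub>M N) (\<lambda>(x, y). f y)"
    by (rule NN.Fubini_integrable) (use int N.prob_space in auto)
  from this NN.integral_fst'[OF this] show "has_bochner_integral (N \<Otimes>\<^sub>M N) (\<lambda>p. f (snd p)) (\<integral>x. f x \<partial>N)"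
    using N.prob_space by (simp add: has_bochner_integral_iff case_prod_beta')
qed

section \<open>Growth of the potential and finiteness of the energy\<close>

context free_beta_prime
begin

lemma V_measurable [measurable]: "V \<in> borel_measurable borel"
  by (cases "lam = 1") (simp_all add: Vpot_def[abs_def])

definition "\<tau> = t / (2 * \<theta>)"

lemma \<tau>_pos: "\<tau> > 0" using t \<theta> by (simp add: \<tau>_def)

text \<open>The subcritical condition on \<open>lam\<close> makes \<open>V\<close> tend to infinity at \<open>0\<close>; at infinity the
  surplus \<open>\<tau>\<close> over the logarithmic kernel is what makes the energy coercive.\<close>
lemma V_growth:
  "\<exists>C\<ge>0. \<forall>x>0. (1 + \<tau>) * ln (1 + x) - C \<le> V x / 2"
proof (cases "lam = 1")
  case True
  define \<kappa> where "\<kappa> = 1 + \<tau>"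
  define \<delta> where "\<delta> = t\<^sup>2 / (2 * \<theta>)"
  have k: "\<kappa> > 0" "\<delta> > 0" using \<tau>_pos t \<theta> by (auto simp: \<kappa>_def \<delta>_def)
  \<comment> \<open>Chosen so that \<open>\<kappa> / b = \<delta>\<close>: the tangent bound for
    \<open>ln\<close> at \<open>b\<close> then controls \<open>\<kappa> * ln (1 + 1 / x)\<close> by
    exactly the term \<open>\<delta> / x\<close> of the potential plus a constant.\<close>
  define b where "b = \<kappa> / \<delta>"
  have b: "b > 0" using k by (simp add: b_def)
  define C where "C = \<kappa> * \<bar>ln b\<bar> + \<delta>"
  have "\<kappa> * ln (1 + x) - C \<le> V x / 2" if x: "x > 0" for x
  proof -
    define v where "v = 1 / x"
    have v: "v > 0" using x by (simp add: v_def)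
    have "ln ((1 + v) / b) \<le> (1 + v) / b - 1" using v b by (intro ln_le_minus_one) simp
    then have "ln (1 + v) \<le> ln b + (1 + v) / b" using v b by (simp add: ln_div)
    then have "\<kappa> * ln (1 + v) \<le> \<kappa> * (ln b + (1 + v) / b)" using k by (intro mult_left_mono) auto
    also have "\<dots> = \<kappa> * ln b + \<delta> * (1 + v)"
      using k by (simp add: b_def field_simps)
    also have "\<kappa> * ln b \<le> \<kappa> * \<bar>ln b\<bar>" using k by (intro mult_left_mono) auto
    finally have 1: "\<kappa> * ln (1 + v) \<le> C + \<delta> * v" by (simp add: C_def algebra_simps)
    have "1 + v = (1 + x) / x" using x by (simp add: v_def field_simps)
    then have "ln (1 + v) = ln (1 + x) - ln x" using x by (simp add: ln_div)
    with 1 have "\<kappa> * ln (1 + x) - C \<le> \<kappa> * ln x + \<delta> * v" by (simp add: algebra_simps)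
    also have "\<kappa> * ln x + \<delta> * v = V x / 2"
      using True \<theta> x by (simp add: Vpot_def \<kappa>_def \<tau>_def \<delta>_def v_def field_simps)
    finally show ?thesis .
  qed
  moreover have "C \<ge> 0" using k by (simp add: C_def)
  ultimately show ?thesis unfolding \<kappa>_def by blast
next
  case False
  then have l: "lam - 1 > 0" using lam1 by simp
  define A where "A = t / (\<theta> * (lam - 1)) - 1"
  define E where "E = 1 + t * lam / (\<theta> * (lam - 1))"
  have A: "A > 0" using gap l \<theta> by (simp add: A_def field_simps)
  have E: "E > 0" using l t \<theta> lam1 by (simp add: E_def add_pos_nonneg)
  \<comment> \<open>\<open>V = - A * ln x + E * ln (x + s)\<close>, so this difference is the growth
    rate of \<open>V\<close> at infinity.\<close>
  have EA: "E - A = 2 * (1 + \<tau>)"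
  proof -
    have "t * lam / (\<theta> * (lam - 1)) - t / (\<theta> * (lam - 1)) = t / \<theta>"
    proof -
      have "t * lam / (\<theta> * (lam - 1)) - t / (\<theta> * (lam - 1)) = t * (lam - 1) / (\<theta> * (lam - 1))"
        by (simp only: diff_divide_distrib[symmetric] right_diff_distrib mult_1_right)
      also have "\<dots> = t / \<theta>" using l by simp
      finally show ?thesis .
    qed
    then show ?thesis by (simp add: E_def A_def \<tau>_def)
  qed
  have s: "s > 0" using l t by (simp add: s_def)
  define C where "C = E / 2 * \<bar>ln s\<bar>"
  have "(1 + \<tau>) * ln (1 + x) - C \<le> V x / 2" if x: "x > 0" for x
  proof -
    have 1: "ln x \<le> ln (1 + x)" using x by simp
    have 2: "ln (1 + x) - \<bar>ln s\<bar> \<le> ln (x + s)"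
    proof (cases "s \<ge> 1")
      case True
      then have "ln (1 + x) \<le> ln (x + s)" using x by (intro ln_mono) auto
      then show ?thesis by linarith
    next
      case False
      then have "s * (1 + x) \<le> x + s" using x s by (simp add: algebra_simps mult_le_cancel_right1)
      then have "ln (s * (1 + x)) \<le> ln (x + s)" using x s by (intro ln_mono) auto
      moreover have "ln (s * (1 + x)) = ln s + ln (1 + x)" using x s by (intro ln_mult_pos) auto
      ultimately show ?thesis by linarith
    qed
    have "A * ln x \<le> A * ln (1 + x)" "E * (ln (1 + x) - \<bar>ln s\<bar>) \<le> E * ln (x + s)"
      using 1 2 A E by (auto intro: mult_left_mono)
    moreover have "V x = - A * ln x + E * ln (x + s)"
      using False by (simp add: Vpot_def A_def E_def s_def)
    moreover have "E * ln (1 + x) - A * ln (1 + x) = 2 * ((1 + \<tau>) * ln (1 + x))"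
      unfolding left_diff_distrib[symmetric] EA by (rule mult.assoc)
    moreover have "C = E * \<bar>ln s\<bar> / 2" by (simp add: C_def)
    ultimately show ?thesis unfolding right_diff_distrib by linarith
  qed
  moreover have "C \<ge> 0" using E by (simp add: C_def)
  ultimately show ?thesis by blast
qed

text \<open>A real-valued version of the kernel. On the diagonal \<open>ln 0 = 0\<close> gives it a
  finite value instead of \<open>-\<infinity>\<close>, so every comparison of the two assumes that
  the diagonal is avoided almost everywhere.\<close>

definition Kr :: "real \<times> real \<Rightarrow> real" where
  "Kr p = ln \<bar>fst p - snd p\<bar> - V (fst p) / 2 - V (snd p) / 2"

lemma energy_kernel_Kr: "fst p \<noteq> snd p \<Longrightarrow> energy_kernel t \<theta> lam p = ereal (Kr p)"
  by (simp add: energy_kernel_def Kr_def)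

lemma Sigma_V_eq_integral:
  assumes nd: "AE p in M \<Otimes>\<^sub>M M. fst p \<noteq> snd p" and int: "integrable (M \<Otimes>\<^sub>M M) Kr"
  shows "Sigma_V t \<theta> lam M = ereal (\<integral>p. Kr p \<partial>(M \<Otimes>\<^sub>M M))"
proof -
  have 1: "(\<integral>\<^sup>+ p. e2ennreal (max (energy_kernel t \<theta> lam p) 0) \<partial>(M \<Otimes>\<^sub>M M)) = (\<integral>\<^sup>+ p. ennreal (Kr p) \<partial>(M \<Otimes>\<^sub>M M))"
    by (rule nn_integral_cong_AE, use nd in eventually_elim) (simp add: energy_kernel_Kr e2ennreal_max_ereal)
  have 2: "(\<integral>\<^sup>+ p. e2ennreal (max (- energy_kernel t \<theta> lam p) 0) \<partial>(M \<Otimes>\<^sub>M M)) = (\<integral>\<^sup>+ p. ennreal (- Kr p) \<partial>(M \<Otimes>\<^sub>M M))"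
    by (rule nn_integral_cong_AE, use nd in eventually_elim)
       (simp add: energy_kernel_Kr e2ennreal_max_ereal flip: uminus_ereal.simps(1) e2ennreal_max_ereal)
  have fin: "(\<integral>\<^sup>+ p. ennreal (Kr p) \<partial>(M \<Otimes>\<^sub>M M)) \<noteq> \<infinity>" "(\<integral>\<^sup>+ p. ennreal (- Kr p) \<partial>(M \<Otimes>\<^sub>M M)) \<noteq> \<infinity>"
    using int by (auto simp: real_integrable_def)
  have e: "enn2ereal X = ereal (enn2real X)" if "X \<noteq> \<infinity>" for X
    using that by (cases X) auto
  show ?thesis
    unfolding Sigma_V_def 1 2 e[OF fin(1)] e[OF fin(2)] real_lebesgue_integral_def[OF int] by simp
qed

text \<open>Under these conditions the three terms of the symmetrised kernel are integrable
  separately, which \<open>Sigma_V\<close> itself does not require.\<close>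

definition regular :: "real measure \<Rightarrow> bool" where
  "regular N \<longleftrightarrow> finite_log_energy N N \<and> integrable N (\<lambda>x. ln (1 + x)) \<and> integrable N V"

lemma Sigma_V_regular:
  assumes N: "real_distribution N" and reg: "regular N"
  shows "Sigma_V t \<theta> lam N = ereal (log_energy N N - (\<integral>x. V x \<partial>N))"
proof -
  have int: "integrable (N \<Otimes>\<^sub>M N) (\<lambda>p. ln \<bar>fst p - snd p\<bar>)" and nd: "AE p in N \<Otimes>\<^sub>M N. fst p \<noteq> snd p" and V: "integrable N V"
    using reg by (auto simp: regular_def finite_log_energy_def)
  have "has_bochner_integral (N \<Otimes>\<^sub>M N) (\<lambda>p. ln \<bar>fst p - snd p\<bar> - V (fst p) / 2 - V (snd p) / 2)
     (log_energy N N - (\<integral>x. V x \<partial>N) / 2 - (\<integral>x. V x \<partial>N) / 2)"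
    by (intro has_bochner_integral_diff has_bochner_integral_divide_zero integral_component N V)
       (use int in \<open>simp add: has_bochner_integral_iff log_energy_def\<close>)
  then have "integrable (N \<Otimes>\<^sub>M N) Kr" "(\<integral>p. Kr p \<partial>(N \<Otimes>\<^sub>M N)) = log_energy N N - (\<integral>x. V x \<partial>N)"
    by (simp_all add: Kr_def[abs_def] has_bochner_integral_iff)
  then show ?thesis using Sigma_V_eq_integral[OF nd] by simp
qed

lemma energy_kernel_measurable [measurable]:
  "energy_kernel t \<theta> lam \<in> borel_measurable (borel \<Otimes>\<^sub>M borel)"
  unfolding energy_kernel_def[abs_def] by measurable

text \<open>By \<open>V_growth\<close> the kernel is at most
  \<open>2 C - \<tau> ln (1 + x) - \<tau> ln (1 + y)\<close>. Its positive part therefore has a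
  finite integral, so energy above \<open>-\<infinity>\<close> forces a finite negative part. This
  makes the diagonal a null set and \<open>Kr\<close> integrable; the surplus \<open>\<tau>\<close>
  then yields the logarithmic moment, from which the integrability of \<open>V\<close> and finally
  of the logarithm follow.\<close>

lemma regularI:
  assumes N: "prob_on_pos N" and fin: "Sigma_V t \<theta> lam N \<noteq> -\<infinity>"
  shows "regular N"
proof -
  note RD = prob_on_posD(1)[OF N]
  interpret N: real_distribution N by (rule RD)
  interpret NN: pair_prob_space N N ..
  note [measurable_cong] = N.events_eq_borel
  obtain C where C0: "C \<ge> 0" and C: "\<And>x. x > 0 \<Longrightarrow> (1 + \<tau>) * ln (1 + x) - C \<le> V x / 2"
    using V_growth by blast
  have pos: "AE p in N \<Otimes>\<^sub>M N. fst p > 0 \<and> snd p > 0"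
  proof (rule NN.AE_pair_measure)
    show "{p \<in> space (N \<Otimes>\<^sub>M N). fst p > 0 \<and> snd p > 0} \<in> sets (N \<Otimes>\<^sub>M N)" by measurable
    show "AE x in N. AE y in N. fst (x, y) > 0 \<and> snd (x, y) > 0"
      using prob_on_posD(2)[OF N]
    proof eventually_elim
      case (elim x)
      show ?case using prob_on_posD(2)[OF N] by eventually_elim (use elim in auto)
    qed
  qed
  have Kr_le: "Kr p \<le> 2 * C - \<tau> * ln (1 + fst p) - \<tau> * ln (1 + snd p)" if "fst p > 0" "snd p > 0" for p
    using ln_abs_diff_le[OF that] C[OF that(1)] C[OF that(2)] by (simp add: Kr_def algebra_simps)
  have Kr_le_C: "Kr p \<le> 2 * C" if "fst p > 0" "snd p > 0" for p
  proof -
    have "\<tau> * ln (1 + fst p) \<ge> 0" "\<tau> * ln (1 + snd p) \<ge> 0" using \<tau>_pos that by auto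
    then show ?thesis using Kr_le[OF that] by linarith
  qed
  let ?Pos = "\<integral>\<^sup>+ p. e2ennreal (max (energy_kernel t \<theta> lam p) 0) \<partial>(N \<Otimes>\<^sub>M N)"
  let ?Neg = "\<integral>\<^sup>+ p. e2ennreal (max (- energy_kernel t \<theta> lam p) 0) \<partial>(N \<Otimes>\<^sub>M N)"
  have "?Pos \<le> (\<integral>\<^sup>+ p. ennreal (2 * C) \<partial>(N \<Otimes>\<^sub>M N))"
  proof (rule nn_integral_mono_AE, use pos in eventually_elim)
    fix p :: "real \<times> real" assume p: "fst p > 0 \<and> snd p > 0"
    show "e2ennreal (max (energy_kernel t \<theta> lam p) 0) \<le> ennreal (2 * C)"
    proof (cases "fst p = snd p")
      case True
      then show ?thesis by (simp add: energy_kernel_def max_def)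
    next
      case False
      then show ?thesis using Kr_le_C[of p] p by (simp add: energy_kernel_Kr e2ennreal_max_ereal ennreal_leI)
    qed
  qed
  also have "\<dots> < \<infinity>" using NN.P.emeasure_space_1 by (simp add: ennreal_mult_less_top)
  finally have Pos: "?Pos \<noteq> \<infinity>" by simp
  have Neg: "?Neg \<noteq> \<infinity>"
  proof
    assume "?Neg = \<infinity>"
    moreover obtain v where "?Pos = ennreal v" "v \<ge> 0" using Pos by (cases ?Pos) auto
    ultimately have "Sigma_V t \<theta> lam N = -\<infinity>" unfolding Sigma_V_def by simp
    with fin show False ..
  qed
  have "AE p in N \<Otimes>\<^sub>M N. e2ennreal (max (- energy_kernel t \<theta> lam p) 0) \<noteq> \<infinity>"
    by (rule nn_integral_noteq_infinite[OF _ Neg]) measurable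
  then have nd: "AE p in N \<Otimes>\<^sub>M N. fst p \<noteq> snd p"
    by eventually_elim (auto simp: energy_kernel_def max_def)
  have "(\<integral>\<^sup>+ p. ennreal (Kr p) \<partial>(N \<Otimes>\<^sub>M N)) = ?Pos"
    by (rule nn_integral_cong_AE, use nd in eventually_elim) (simp add: energy_kernel_Kr e2ennreal_max_ereal)
  moreover have "(\<integral>\<^sup>+ p. ennreal (- Kr p) \<partial>(N \<Otimes>\<^sub>M N)) = ?Neg"
    by (rule nn_integral_cong_AE, use nd in eventually_elim)
       (simp add: energy_kernel_Kr e2ennreal_max_ereal flip: uminus_ereal.simps(1) e2ennreal_max_ereal)
  moreover have Krm [measurable]: "Kr \<in> borel_measurable (N \<Otimes>\<^sub>M N)"
    unfolding Kr_def[abs_def] by measurable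
  ultimately have Kr: "integrable (N \<Otimes>\<^sub>M N) Kr"
    using Pos Neg by (simp add: real_integrable_def)
  have "integrable (N \<Otimes>\<^sub>M N) (\<lambda>p. ln (1 + fst p))"
  proof (rule Bochner_Integration.integrable_bound)
    show "integrable (N \<Otimes>\<^sub>M N) (\<lambda>p. (2 * C + \<bar>Kr p\<bar>) / \<tau>)" using Kr by simp
    show "AE p in N \<Otimes>\<^sub>M N. norm (ln (1 + fst p)) \<le> norm ((2 * C + \<bar>Kr p\<bar>) / \<tau>)"
      using pos
    proof eventually_elim
      case (elim p)
      have "\<tau> * ln (1 + snd p) \<ge> 0" using \<tau>_pos elim by auto
      then have "\<tau> * ln (1 + fst p) \<le> 2 * C + \<bar>Kr p\<bar>" using Kr_le[of p] elim by linarith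
      then have "ln (1 + fst p) \<le> (2 * C + \<bar>Kr p\<bar>) / \<tau>" using \<tau>_pos by (simp add: pos_le_divide_eq mult.commute)
      moreover have "ln (1 + fst p) \<ge> 0" using elim by simp
      ultimately show ?case
        unfolding real_norm_def using abs_ge_self[of "(2 * C + \<bar>Kr p\<bar>) / \<tau>"] by linarith
    qed
  qed measurable
  then have L: "integrable N (\<lambda>x. ln (1 + x))" by (rule integrable_fstD[OF RD])
  note L2 = integral_component[OF RD L]
  \<comment> \<open>For \<open>v = V x\<close> and \<open>u = V y\<close>: solving for
    \<open>v\<close> gives \<open>v = 2 (d - k) - u\<close>, and the lower bound on \<open>u\<close>
    turns this into an upper bound; the lower bound on \<open>v\<close> is the growth of
    \<open>V\<close>.\<close>
  have gen: "\<bar>v\<bar> \<le> 2 * (C + \<bar>k\<bar> + a + b)"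
    if "- C \<le> v / 2" "- C \<le> u / 2" "d \<le> a + b" "0 \<le> a" "0 \<le> b" "k = d - v / 2 - u / 2" for a b d k u v :: real
    using that unfolding distrib_left by linarith
  have "integrable (N \<Otimes>\<^sub>M N) (\<lambda>p. V (fst p))"
  proof (rule Bochner_Integration.integrable_bound)
    show "integrable (N \<Otimes>\<^sub>M N) (\<lambda>p. 2 * (C + \<bar>Kr p\<bar> + ln (1 + fst p) + ln (1 + snd p)))"
      using Kr L2 by (simp add: has_bochner_integral_iff)
    show "AE p in N \<Otimes>\<^sub>M N. norm (V (fst p)) \<le> norm (2 * (C + \<bar>Kr p\<bar> + ln (1 + fst p) + ln (1 + snd p)))"
      using pos
    proof eventually_elim
      case (elim p)
      have l: "ln (1 + fst p) \<ge> 0" "ln (1 + snd p) \<ge> 0" using elim by auto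
      then have "(1 + \<tau>) * ln (1 + fst p) \<ge> 0" "(1 + \<tau>) * ln (1 + snd p) \<ge> 0" using \<tau>_pos by auto
      then have "V (fst p) / 2 \<ge> - C" "V (snd p) / 2 \<ge> - C" using C[of "fst p"] C[of "snd p"] elim by auto
      moreover have "ln \<bar>fst p - snd p\<bar> \<le> ln (1 + fst p) + ln (1 + snd p)" using ln_abs_diff_le elim by blast
      ultimately have "\<bar>V (fst p)\<bar> \<le> 2 * (C + \<bar>Kr p\<bar> + ln (1 + fst p) + ln (1 + snd p))"
        using l by (intro gen[OF _ _ _ _ _ Kr_def])
      then show ?case by simp
    qed
  qed measurable
  then have V: "integrable N V" by (rule integrable_fstD[OF RD])
  note V2 = integral_component[OF RD V]
  have "integrable (N \<Otimes>\<^sub>M N) (\<lambda>p. Kr p + V (fst p) / 2 + V (snd p) / 2)"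
    using Kr V2 by (simp add: has_bochner_integral_iff)
  then have "integrable (N \<Otimes>\<^sub>M N) (\<lambda>p. ln \<bar>fst p - snd p\<bar>)" by (simp add: Kr_def)
  with nd L V show ?thesis by (simp add: regular_def finite_log_energy_def)
qed

lemma mu0_pos: "AE x in mu0. x > 0"
  using mu0_support by eventually_elim (use mr_pos in auto)

lemma prob_on_pos_mu0: "prob_on_pos mu0"
proof -
  interpret M: prob_space mu0 by (rule mu0_prob_space)
  have "emeasure mu0 {0<..} = 1"
    by (rule M.emeasure_eq_1_AE) (use mu0_pos in \<open>auto simp: sets_mu0\<close>)
  then show ?thesis using M.prob_space_axioms by (simp add: prob_on_pos_def sets_mu0)
qed

lemma regular_mu0: "regular mu0"
proof -
  interpret M: prob_space mu0 by (rule mu0_prob_space)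
  have *: "integrable mu0 f" if f: "continuous_on {m - r..m + r} f" "f \<in> borel_measurable borel" for f :: "real \<Rightarrow> real"
  proof -
    have "bounded (f ` {m - r..m + r})"
      by (intro compact_imp_bounded compact_continuous_image f) auto
    then obtain b where "\<forall>y\<in>f ` {m - r..m + r}. norm y \<le> b" unfolding bounded_iff by blast
    then have b: "norm (f x) \<le> b" if "x \<in> {m - r..m + r}" for x using that by blast
    show ?thesis
    proof (rule M.integrable_const_bound)
      show "AE x in mu0. norm (f x) \<le> b" using mu0_support by eventually_elim (rule b, auto)
    qed (use f in measurable)
  qed
  have L: "integrable mu0 (\<lambda>x. ln (1 + x))"
    by (rule *) (use mr_pos in \<open>auto intro!: continuous_intros\<close>)
  have V: "integrable mu0 V"
  proof (rule *)
    show "continuous_on {m - r..m + r} V"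
      by (intro continuous_at_imp_continuous_on ballI DERIV_isCont[OF V_deriv] support_pos)
  qed measurable
  show ?thesis
    using finite_log_energy_mu0(1)[OF mu0_distr mu0_pos L] L V by (simp add: regular_def)
qed

text \<open>Integrating \<open>2 U - V = ell\<close> against \<open>mu0\<close> expresses the
  potential term through the logarithmic energy.\<close>

lemma Sigma_V_mu0: "Sigma_V t \<theta> lam mu0 = ereal (ell - log_energy mu0 mu0)"
proof -
  have L: "integrable mu0 (\<lambda>x. ln (1 + x))" and V: "integrable mu0 V" using regular_mu0 by (auto simp: regular_def)
  note F = finite_log_energy_mu0[OF mu0_distr mu0_pos L]
  interpret M: prob_space mu0 by (rule mu0_prob_space)
  have "(\<integral>x. 2 * U x - V x \<partial>mu0) = (\<integral>x. ell \<partial>mu0)"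
  proof (rule integral_cong_AE)
    show "AE x in mu0. 2 * U x - V x = ell"
      using mu0_support by eventually_elim (rule equilibrium_eq, auto)
    show "(\<lambda>x. 2 * U x - V x) \<in> borel_measurable mu0" using F(2) V by measurable
  qed simp
  then have "2 * log_energy mu0 mu0 - (\<integral>x. V x \<partial>mu0) = ell"
    using F V M.prob_space by simp
  then have "log_energy mu0 mu0 - (\<integral>x. V x \<partial>mu0) = ell - log_energy mu0 mu0" by linarith
  then show ?thesis unfolding Sigma_V_regular[OF mu0_distr regular_mu0] by simp
qed

text \<open>With \<open>I\<close> the logarithmic energy, negative definiteness gives \<open>I N N -
  \<integral>V dN < 2 I N mu0 - \<integral>V dN - I mu0 mu0\<close>. The first two terms on the
  right are the integral of \<open>2 U - V\<close> against \<open>N\<close>, at most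
  \<open>ell\<close>, which leaves the energy of \<open>mu0\<close>.\<close>

lemma Sigma_V_less:
  assumes N: "prob_on_pos N" and ne: "N \<noteq> mu0"
  shows "Sigma_V t \<theta> lam N < Sigma_V t \<theta> lam mu0"
proof (cases "Sigma_V t \<theta> lam N = -\<infinity>")
  case True
  then show ?thesis unfolding Sigma_V_mu0 by simp
next
  case False
  note reg = regularI[OF N False]
  note RD = prob_on_posD[OF N]
  interpret N: real_distribution N by (rule RD(1))
  have L: "integrable N (\<lambda>x. ln (1 + x))" and V: "integrable N V" using reg by (auto simp: regular_def)
  note F = finite_log_energy_mu0[OF RD L]
  have "log_energy N N - 2 * log_energy N mu0 + log_energy mu0 mu0 < 0"
    by (rule log_energy_negative_definite[OF RD(1) mu0_distr _ F(1) _ ne])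
       (use reg regular_mu0 in \<open>auto simp: regular_def\<close>)
  moreover have "2 * log_energy N mu0 - (\<integral>x. V x \<partial>N) \<le> ell"
  proof -
    have "2 * log_energy N mu0 - (\<integral>x. V x \<partial>N) = (\<integral>x. 2 * U x - V x \<partial>N)"
      using F V by simp
    also have "\<dots> \<le> (\<integral>x. ell \<partial>N)"
    proof (rule integral_mono_AE)
      show "AE x in N. 2 * U x - V x \<le> ell" using RD(2) by eventually_elim (rule equilibrium_le)
    qed (use F V in simp_all)
    finally show ?thesis using N.prob_space by simp
  qed
  ultimately show ?thesis
    unfolding Sigma_V_mu0 Sigma_V_regular[OF RD(1) reg] by simp
qed

end

theorem theorem5p4:
  fixes t \<theta> lam :: real
  assumes "t > 0" and "\<theta> > 0" and "1 \<le> lam" and "lam < 1 + t / \<theta>"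
  shows "(\<exists>\<mu>. is_mu t \<theta> lam \<mu>) \<and>
         (\<forall>\<mu>. is_mu t \<theta> lam \<mu> \<longrightarrow>
            prob_on_pos \<mu> \<and>
            (\<forall>\<nu>. prob_on_pos \<nu> \<longrightarrow>
               Sigma_V t \<theta> lam \<nu> \<le> Sigma_V t \<theta> lam \<mu> \<and>
               (Sigma_V t \<theta> lam \<nu> = Sigma_V t \<theta> lam \<mu> \<longrightarrow> \<nu> = \<mu>)))"
proof -
  interpret free_beta_prime t \<theta> lam using assms by unfold_locales
  show ?thesis
  proof (intro conjI exI[of _ mu0] is_mu_mu0 allI impI)
    fix \<mu> assume "is_mu t \<theta> lam \<mu>"
    then have \<mu>: "\<mu> = mu0" by (rule is_mu_unique)
    show "prob_on_pos \<mu>" unfolding \<mu> by (rule prob_on_pos_mu0)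
    fix \<nu> assume \<nu>: "prob_on_pos \<nu>"
    show "Sigma_V t \<theta> lam \<nu> \<le> Sigma_V t \<theta> lam \<mu>"
      using Sigma_V_less[OF \<nu>] unfolding \<mu> by (cases "\<nu> = mu0") auto
    show "\<nu> = \<mu>" if "Sigma_V t \<theta> lam \<nu> = Sigma_V t \<theta> lam \<mu>"
      using Sigma_V_less[OF \<nu>] that unfolding \<mu> by force
  qed
qed

end
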